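(* Every planar graph that contains no cycle of length $5$ and no cycle of length $6$ (as subgraphs, not necessarily induced) is $(3,1)$-choosable.
   Context: Graphs are finite and simple. A list assignment $L$ on a graph $G$ assigns to each vertex $v$ a set $L(v)$ of colors. An $L$-coloring of $G$ is a function $\varphi$ on $V(G)$ with $\varphi(v)\in L(v)$ for every vertex $v$ and $\varphi(x)\neq\varphi(y)$ for every edge $xy$. A graph $G$ is $(k,d)$-choosable if $G$ has an $L$-coloring for every list assignment $L$ such that $|L(v)|\ge k$ for every vertex $v$ and $|L(x)\cap L(y)|\le d$ for every edge $xy$ of $G$. *)

theory Defs
  imports "HOL-Analysis.Analysis" "Graph_Theory.Pair_Digraph"
begin

text \<open>
  A finite simple graph is a \<^locale>\<open>pair_graph\<close>: an edge \<open>uv\<close> is represented by the two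
  arcs \<open>(u, v)\<close> and \<open>(v, u)\<close>.
\<close>

text \<open>
  Cycles are taken in the symmetric digraph. There, going back and forth along an edge counts as a
  cycle of length 2, so \<open>has_cycle_of_length\<close> has its usual meaning for undirected graphs only for
  lengths \<open>n \<ge> 3\<close>.
\<close>

definition has_cycle_of_length :: "'a pair_pre_digraph \<Rightarrow> nat \<Rightarrow> bool" where
  "has_cycle_of_length G n \<longleftrightarrow> (\<exists>p. pre_digraph.cycle (with_proj G) p \<and> length p = n)"

text \<open>
  In a plane drawing the edges are arbitrary (continuous) simple arcs in the plane, which is
  identified with the complex numbers. The two orientations of an edge are drawn as the same arc.
\<close>

definition plane_drawing ::
    "'a pair_pre_digraph \<Rightarrow> ('a \<Rightarrow> complex) \<Rightarrow> ('a \<times> 'a \<Rightarrow> real \<Rightarrow> complex) \<Rightarrow> bool" where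
  "plane_drawing G pos \<gamma> \<longleftrightarrow>
     inj_on pos (pverts G) \<and>
     (\<forall>(u, v) \<in> parcs G.
        arc (\<gamma> (u, v)) \<and> pathstart (\<gamma> (u, v)) = pos u \<and> pathfinish (\<gamma> (u, v)) = pos v \<and>
        \<gamma> (v, u) = reversepath (\<gamma> (u, v)) \<and>
        (\<forall>w \<in> pverts G - {u, v}. pos w \<notin> path_image (\<gamma> (u, v)))) \<and>
     (\<forall>(u, v) \<in> parcs G. \<forall>(x, y) \<in> parcs G. {u, v} \<noteq> {x, y} \<longrightarrow>
        path_image (\<gamma> (u, v)) \<inter> path_image (\<gamma> (x, y)) \<subseteq> pos ` ({u, v} \<inter> {x, y}))"

definition planar :: "'a pair_pre_digraph \<Rightarrow> bool" where
  "planar G \<longleftrightarrow> (\<exists>pos \<gamma>. plane_drawing G pos \<gamma>)"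

definition list_coloring ::
    "'a pair_pre_digraph \<Rightarrow> ('a \<Rightarrow> 'c set) \<Rightarrow> ('a \<Rightarrow> 'c) \<Rightarrow> bool" where
  "list_coloring G L \<phi> \<longleftrightarrow>
     (\<forall>v \<in> pverts G. \<phi> v \<in> L v) \<and> (\<forall>(x, y) \<in> parcs G. \<phi> x \<noteq> \<phi> y)"

text \<open>
  Lists may be infinite; as \<^const>\<open>card\<close> is 0 on infinite sets, finiteness is treated
  separately. The type of colors is a parameter because a definition cannot quantify over types;
  a statement with a free type variable for it covers all types of colors.
\<close>

definition choosable :: "'c itself \<Rightarrow> nat \<Rightarrow> nat \<Rightarrow> 'a pair_pre_digraph \<Rightarrow> bool" where
  "choosable TYPE('c) k d G \<longleftrightarrow>
     (\<forall>L :: 'a \<Rightarrow> 'c set.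
        (\<forall>v \<in> pverts G. infinite (L v) \<or> k \<le> card (L v)) \<and>
        (\<forall>(x, y) \<in> parcs G. finite (L x \<inter> L y) \<and> card (L x \<inter> L y) \<le> d) \<longrightarrow>
        (\<exists>\<phi>. list_coloring G L \<phi>))"

end

theory Submission
  imports Defs
begin

text \<open>Choose three-element sublists; then the lists of adjacent vertices share at most one colour. The
claim proved by induction on \<open>card U\<close> is stronger than colourability: every induced subgraph \<open>U\<close>
can be coloured with the colour of one vertex \<open>x0\<close> prescribed (\<open>colour_with_root\<close>). The
prescription makes the induction pass through cut vertices: colour the part that contains \<open>x0\<close>,
and prescribe in the other part the colour of the cut vertex. So a minimal counterexample \<open>U\<close> is
2-connected, and two opposite facts about it collide.

First, it has many edges (\<open>critical_dense\<close>): with \<open>e\<close> edges, \<open>n\<close> vertices and \<open>k\<close> complete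
subgraphs on four vertices, \<open>e \<ge> 2 n + k - 2\<close>. The starting point is that an edge \<open>xy\<close> can be settled
by one end alone, which avoids the only colour that the two lists may share. If all edges
outside \<open>S\<close> are assigned to ends outside \<open>S\<close> such that every vertex receives at most two, a
colouring of \<open>S\<close> extends greedily, since lists have three colours. A \<open>K\<^sub>4\<close> has six edges, and one of
them may even be left unassigned: some choice of what its vertices avoid always works, sometimes only
after a choice between two orientations of a triangle, which an extremal argument and Hall's
theorem make simultaneously for all such \<open>K\<^sub>4\<close>. Hall's theorem also produces the assignment, and
its failure is exactly a set that is too dense; applying this outside a set \<open>S\<close> that maximises
edges minus twice vertices minus touched \<open>K\<^sub>4\<close> forces \<open>S = U\<close>.

Second, it has few edges. Euler's formula with face lengths other than \<open>5\<close> and \<open>6\<close> gives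
\<open>7 f \<le> 2 e + 4 t + 3 q\<close>, for \<open>t\<close> triangular and \<open>q\<close> quadrangular faces, so together with the first
bound \<open>(\<Sum>v. 4 d v - 10) + 24 + 2 k \<le> 8 t + 6 q\<close>. The short faces must therefore be very dense around
the vertices. But without 5- and 6-cycles short faces share edges only in tiny clusters: a triangle, a quadrangle,
two triangles on a common edge, three triangles around a vertex of degree three, or two
quadrangles on the same four vertices. Each cluster distributes its weight over its vertices
(\<open>good_exists\<close>), and no vertex other than \<open>x0\<close> is charged more than \<open>4 d v - 10\<close> (\<open>vertex_pays\<close>), because the
configurations in which it would be are reducible: their vertices can be coloured last
(\<open>degree_ge_3\<close>, \<open>no_two_tails\<close>, \<open>no_two_pockets\<close>). The constant \<open>24\<close> exceeds what \<open>x0\<close> can contribute.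

The facial cycles come from the topology of the drawing. Starting with a cycle, whose two faces are
given by the Jordan curve theorem, the graph is built up by ears, and each ear cuts one face into
two (\<open>crosscut_inside\<close>, \<open>crosscut_outside\<close>, \<open>face_sys_ear\<close>).\<close>

section \<open>Cutting a Jordan domain along an arc\<close>

text \<open>The theta curve lemma gives the two bounded pieces; their frontiers are read off from
the Jordan curve theorem for the two closed curves through \<open>P\<close>.\<close>

lemma crosscut_inside:
  fixes A B P :: "real \<Rightarrow> complex"
  assumes arcs: "arc A" "arc B" "arc P"
    and ends: "pathstart A = a" "pathfinish A = b" "pathstart B = a" "pathfinish B = b"
      "pathstart P = a" "pathfinish P = b"
    and AB: "path_image A \<inter> path_image B = {a,b}"
    and AP: "path_image A \<inter> path_image P = {a,b}"
    and BP: "path_image B \<inter> path_image P = {a,b}"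
    and inn: "path_image P - {a,b} \<subseteq> inside (path_image A \<union> path_image B)"
  obtains f1 f2 where "open f1" "open f2" "connected f1" "connected f2" "f1 \<noteq> {}" "f2 \<noteq> {}"
    "f1 \<inter> f2 = {}" "f1 \<union> f2 = inside (path_image A \<union> path_image B) - path_image P"
    "frontier f1 = path_image A \<union> path_image P" "frontier f2 = path_image B \<union> path_image P"
proof -
  have ab: "a \<noteq> b" using arcs(1) ends arc_distinct_ends by blast
  have sp: "simple_path A" "simple_path B" "simple_path P" using arcs arc_imp_simple_path by auto
  have inP: "path_image P \<inter> inside (path_image A \<union> path_image B) \<noteq> {}"
  proof -
    have "P (1/2) \<in> path_image P" by (simp add: path_image_def)
    moreover have "P (1/2) \<noteq> P 0" "P (1/2) \<noteq> P 1"
      using arcs(3) by (auto simp: arc_def dest: inj_onD[where x="1/2"])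
    then have "P (1/2) \<noteq> a" "P (1/2) \<noteq> b"
      using ends unfolding pathstart_def pathfinish_def by auto
    ultimately show ?thesis using inn by blast
  qed
  obtain s: "inside(path_image A \<union> path_image P) \<inter> inside(path_image B \<union> path_image P) = {}"
       "inside(path_image A \<union> path_image P) \<union> inside(path_image B \<union> path_image P) \<union>
           (path_image P - {a,b}) = inside(path_image A \<union> path_image B)"
    using split_inside_simple_closed_curve[OF sp(1) ends(1,2) sp(2) ends(3,4) sp(3) ends(5,6) ab AB AP BP inP] by metis
  have lAP: "simple_path (A +++ reversepath P)" "pathfinish (A +++ reversepath P) = pathstart (A +++ reversepath P)"
      "path_image (A +++ reversepath P) = path_image A \<union> path_image P"
    using arcs ends AP by (auto simp: simple_path_join_loop_eq arc_simple_path simple_path_reversepath path_image_join)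
  have lBP: "simple_path (B +++ reversepath P)" "pathfinish (B +++ reversepath P) = pathstart (B +++ reversepath P)"
      "path_image (B +++ reversepath P) = path_image B \<union> path_image P"
    using arcs ends BP by (auto simp: simple_path_join_loop_eq arc_simple_path simple_path_reversepath path_image_join)
  note JA = Jordan_inside_outside[OF lAP(1,2), unfolded lAP(3)]
  note JB = Jordan_inside_outside[OF lBP(1,2), unfolded lBP(3)]
  have nI: "inside (path_image A \<union> path_image B) \<inter> (path_image A \<union> path_image B) = {}"
    by (rule inside_no_overlap)
  have "inside(path_image A \<union> path_image P) \<union> inside(path_image B \<union> path_image P)
      = inside (path_image A \<union> path_image B) - path_image P"
  proof -
    have "inside(path_image A \<union> path_image P) \<inter> path_image P = {}" "inside(path_image B \<union> path_image P) \<inter> path_image P = {}"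
      using inside_no_overlap by blast+
    moreover have "inside (path_image A \<union> path_image B) \<inter> {a,b} = {}" using nI AB by blast
    ultimately show ?thesis using s(2) by blast
  qed
  with JA JB s(1) show thesis by (intro that[of "inside(path_image A \<union> path_image P)" "inside(path_image B \<union> path_image P)"]) auto
qed

lemma open_imp_infinite: "open (S :: complex set) \<Longrightarrow> S \<noteq> {} \<Longrightarrow> infinite S"
  using clopen[of S] finite_imp_closed[of S] infinite_UNIV_char_0 by metis

definition hinv :: "complex \<Rightarrow> complex \<Rightarrow> complex" where "hinv q z = inverse (z - q)"

text \<open>The unbounded domain reduces to the bounded one by an inversion at a point \<open>q\<close> of the inside. It maps
the outside of the curve onto the inside of the image curve, except that the point at infinity
becomes \<open>0\<close>. Hence the two pieces found there are pulled back without \<open>0\<close>, and removing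
this one point from an open set harms neither its connectedness nor its frontier elsewhere.\<close>

lemma crosscut_outside:
  fixes A B P :: "real \<Rightarrow> complex"
  assumes arcs: "arc A" "arc B" "arc P"
    and ends: "pathstart A = a" "pathfinish A = b" "pathstart B = a" "pathfinish B = b"
      "pathstart P = a" "pathfinish P = b"
    and AB: "path_image A \<inter> path_image B = {a,b}"
    and AP: "path_image A \<inter> path_image P = {a,b}"
    and BP: "path_image B \<inter> path_image P = {a,b}"
    and inn: "path_image P - {a,b} \<subseteq> outside (path_image A \<union> path_image B)"
  obtains f1 f2 where "open f1" "open f2" "connected f1" "connected f2" "f1 \<noteq> {}" "f2 \<noteq> {}"
    "f1 \<inter> f2 = {}" "f1 \<union> f2 = outside (path_image A \<union> path_image B) - path_image P"
    "frontier f1 = path_image A \<union> path_image P" "frontier f2 = path_image B \<union> path_image P"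
proof -
  define C where "C = path_image A \<union> path_image B"
  have lAB: "simple_path (A +++ reversepath B)" "pathfinish (A +++ reversepath B) = pathstart (A +++ reversepath B)"
      "path_image (A +++ reversepath B) = C"
    using arcs ends AB by (auto simp: simple_path_join_loop_eq arc_simple_path simple_path_reversepath path_image_join C_def)
  note J = Jordan_inside_outside[OF lAB(1,2), unfolded lAB(3)]
  have Jd: "inside C \<inter> outside C = {}" and Ju: "inside C \<union> outside C = - C" using J by simp_all
  have iC: "inside C \<inter> C = {}" and oC: "outside C \<inter> C = {}" using Ju by blast+
  obtain q where q: "q \<in> inside C" using J by auto
  then obtain r where r: "r > 0" "ball q r \<subseteq> inside C" using J by (meson open_contains_ball)
  have qn: "q \<notin> C" "q \<notin> outside C" using q J by blast+
  have qP: "q \<notin> path_image P" proof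
    assume "q \<in> path_image P"
    moreover have "a \<in> C" "b \<in> C" using pathstart_in_path_image[of A] pathfinish_in_path_image[of A]
      by (simp_all only: C_def ends Un_iff simp_thms)
    ultimately show False using inn qn unfolding C_def by blast
  qed
  define h where "h = hinv q"
  define k where "k = (\<lambda>w::complex. q + inverse w)"
  have kh: "k (h z) = z" if "z \<noteq> q" for z using that by (simp add: k_def h_def hinv_def)
  have hk: "h (k w) = w" if "w \<noteq> 0" for w using that by (simp add: k_def h_def hinv_def)
  have h0: "h z \<noteq> 0" if "z \<noteq> q" for z using that by (simp add: h_def hinv_def)
  have kq: "k w \<noteq> q" if "w \<noteq> 0" for w using that by (simp add: k_def)
  have hcont: "continuous_on X h" if "q \<notin> X" for X unfolding h_def hinv_def
    by (intro continuous_intros) (use that in auto)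
  have kcont: "continuous_on X k" if "0 \<notin> X" for X unfolding k_def
    by (intro continuous_intros) (use that in auto)
  have hinj: "inj_on h X" if "q \<notin> X" for X by (rule inj_onI) (metis kh that)
  have harc: "arc (h \<circ> X)" if "arc X" "q \<notin> path_image X" for X
  proof -
    have "path (h \<circ> X)" using that by (intro path_continuous_image hcont) (auto simp: arc_imp_path)
    moreover have "inj_on (h \<circ> X) {0..1}"
      using that(1) hinj[OF that(2)] unfolding arc_def path_image_def by (auto intro: comp_inj_on)
    ultimately show ?thesis by (simp add: arc_def)
  qed
  have qA: "q \<notin> path_image A" "q \<notin> path_image B" using qn C_def by auto
  have hint: "h ` X \<inter> h ` Y = h ` (X \<inter> Y)" if "q \<notin> X" "q \<notin> Y" for X Y
    using hinj[of "X \<union> Y"] that by (metis Un_iff inj_on_image_Int Un_upper1 Un_upper2)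
  let ?A = "h \<circ> A" and ?B = "h \<circ> B" and ?P = "h \<circ> P"
  have ends': "pathstart ?A = h a" "pathfinish ?A = h b" "pathstart ?B = h a" "pathfinish ?B = h b"
      "pathstart ?P = h a" "pathfinish ?P = h b"
    using ends by (auto simp: pathstart_compose pathfinish_compose)
  have int': "path_image ?A \<inter> path_image ?B = {h a, h b}" "path_image ?A \<inter> path_image ?P = {h a, h b}"
    "path_image ?B \<inter> path_image ?P = {h a, h b}"
    using AB AP BP hint qA qP by (simp_all add: path_image_compose)
  have arcs': "arc ?A" "arc ?B" "arc ?P" using arcs qA qP harc by auto
  define C' where "C' = path_image ?A \<union> path_image ?B"
  have C': "C' = h ` C" unfolding C_def C'_def by (simp add: path_image_compose image_Un)
  have lAB': "simple_path (?A +++ reversepath ?B)" "pathfinish (?A +++ reversepath ?B) = pathstart (?A +++ reversepath ?B)"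
      "path_image (?A +++ reversepath ?B) = C'"
    using arcs' ends' int' by (auto simp: simple_path_join_loop_eq arc_simple_path simple_path_reversepath path_image_join C'_def)
  note J' = Jordan_inside_outside[OF lAB'(1,2), unfolded lAB'(3)]
  have Jd': "inside C' \<inter> outside C' = {}" and Ju': "inside C' \<union> outside C' = - C'" using J' by simp_all
  have side: "X \<subseteq> inside C' \<or> X \<subseteq> outside C'" if "connected X" "X \<inter> C' = {}" for X
  proof -
    have "X \<subseteq> inside C' \<union> outside C'" using that Ju' by blast
    moreover have "open (inside C')" "open (outside C')" using J' by simp_all
    ultimately show ?thesis using connectedD[OF that(1), of "inside C'" "outside C'"] Jd' by blast
  qed
  have disj: "h ` X \<inter> C' = {}" if "X \<inter> C = {}" "q \<notin> X" for X
    unfolding C' using hint[of X C] that qn by auto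
  have co: "connected (h ` outside C)"
    using J qn by (intro connected_continuous_image hcont) auto
  have ci: "connected (h ` (inside C - {q}))"
    using J qn q by (intro connected_continuous_image hcont connected_open_delete) auto
  \<comment> \<open>near \<open>q\<close> the inversion is unbounded, so the punctured inside cannot land in a bounded set\<close>
  have "h ` (inside C - {q}) \<subseteq> outside C'"
  proof (rule ccontr)
    assume "\<not> ?thesis"
    then have "h ` (inside C - {q}) \<subseteq> inside C'"
      using side[OF ci] disj[of "inside C - {q}"] iC by blast
    then have "bounded (h ` (inside C - {q}))" using J' bounded_subset by metis
    then obtain M where M: "\<And>z. z \<in> inside C - {q} \<Longrightarrow> norm (h z) \<le> M" unfolding bounded_iff by blast
    define s where "s = min (r/2) (inverse (\<bar>M\<bar> + 1))"
    have s: "s > 0" "s < r" "s \<le> inverse (\<bar>M\<bar>+1)" using r by (auto simp: s_def)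
    have "q + of_real s \<in> inside C - {q}" using r s by (auto simp: subset_iff dist_norm)
    then have "norm (h (q + of_real s)) \<le> M" using M by blast
    moreover have "norm (h (q + of_real s)) = inverse s" using s by (simp add: h_def hinv_def norm_inverse)
    moreover have "inverse s \<ge> \<bar>M\<bar> + 1" using s
      by (metis inverse_inverse_eq le_imp_inverse_le)
    ultimately show False by linarith
  qed
  then have hin: "h ` (inside C - {q}) \<inter> inside C' = {}" using Jd' by blast
  have cov: "w \<in> h ` outside C" if "w \<in> inside C'" "w \<noteq> 0" for w
  proof -
    have "k w \<notin> C" using that hk C' Ju' by (metis imageI Un_iff ComplD)
    moreover have "k w \<noteq> q" using kq that by auto
    moreover have "k w \<notin> inside C" using hin that hk[of w] \<open>k w \<noteq> q\<close>
      by (metis (no_types, lifting) DiffI IntI emptyE imageI singletonD)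
    ultimately have "k w \<in> outside C" using Ju by blast
    then show ?thesis using hk that by (metis imageI)
  qed
  have ho: "h ` outside C \<subseteq> inside C'"
  proof -
    have "\<exists>w. w \<in> inside C' \<and> w \<noteq> 0"
    proof (rule ccontr)
      assume "\<not> ?thesis"
      then have "inside C' \<subseteq> {0}" by auto
      then have "finite (inside C')" by (meson finite.emptyI finite_insert finite_subset)
      then show False using J' open_imp_infinite by metis
    qed
    then obtain w where "w \<in> inside C'" "w \<in> h ` outside C" using cov by blast
    then show ?thesis using side[OF co] disj[of "outside C"] oC Jd' qn by blast
  qed
  have inn': "path_image ?P - {h a, h b} \<subseteq> inside (path_image ?A \<union> path_image ?B)"
  proof
    fix w assume w: "w \<in> path_image ?P - {h a, h b}"
    then obtain z where "z \<in> path_image P" "w = h z" by (auto simp: path_image_compose)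
    with w have "z \<in> outside C" using inn C_def by auto
    then show "w \<in> inside (path_image ?A \<union> path_image ?B)" using ho \<open>w = h z\<close> C'_def by auto
  qed
  obtain g1 g2 where g: "open g1" "open g2" "connected g1" "connected g2" "g1 \<noteq> {}" "g2 \<noteq> {}"
    "g1 \<inter> g2 = {}" "g1 \<union> g2 = inside C' - path_image ?P"
    "frontier g1 = path_image ?A \<union> path_image ?P" "frontier g2 = path_image ?B \<union> path_image ?P"
    using crosscut_inside[OF arcs' ends' int' inn'] unfolding C'_def by metis
  define pull where "pull = (\<lambda>g. {z. z \<noteq> q \<and> h z \<in> g})"
  have pull_im: "pull g = k ` (g - {0})" for g
  proof (rule set_eqI, rule iffI)
    fix z assume "z \<in> pull g"
    then have "z \<noteq> q" "h z \<in> g - {0}" using h0 by (auto simp: pull_def)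
    then show "z \<in> k ` (g - {0})" using kh by (metis imageI)
  next
    fix z assume "z \<in> k ` (g - {0})"
    then obtain w where w: "z = k w" "w \<in> g" "w \<noteq> 0" by blast
    then show "z \<in> pull g" using hk[OF w(3)] kq[OF w(3)] by (simp add: pull_def)
  qed
  have pull_open: "open (pull g)" if "open g" for g
  proof -
    have "pull g = (- {q}) \<inter> h -` g" by (auto simp: pull_def)
    then show ?thesis using continuous_open_preimage[OF hcont[of "-{q}"]] that by (simp add: open_Compl)
  qed
  have pull_conn: "connected (pull g)" if "open g" "connected g" for g
    unfolding pull_im using that by (intro connected_continuous_image kcont connected_open_delete) auto
  have pull_ne: "pull g \<noteq> {}" if "open g" "g \<noteq> {}" for g
  proof -
    have "\<not> g \<subseteq> {0}" using that open_imp_infinite[of g] by (meson finite.emptyI finite_insert finite_subset)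
    then show ?thesis unfolding pull_im by auto
  qed
  have pull_sub: "pull g \<subseteq> outside C" if "g \<subseteq> inside C'" for g
  proof
    fix z assume "z \<in> pull g"
    then have z: "z \<noteq> q" "h z \<in> inside C'" using that by (auto simp: pull_def)
    then obtain y where "y \<in> outside C" "h z = h y" using cov[of "h z"] h0 by auto
    then show "z \<in> outside C" using kh z qn by metis
  qed
  have pull_fr: "frontier (pull (g::complex set)) = D"
    if "open g" "g \<subseteq> inside C'" "frontier g = h ` D" "q \<notin> D" for g D
  proof -
    have o: "open (pull g)" using pull_open that by auto
    have qc: "q \<notin> closure (pull g)"
    proof -
      have "pull g \<inter> ball q r = {}" using pull_sub[OF that(2)] r Jd by blast
      then have "closure (pull g) \<inter> ball q r = {}" by (simp add: open_Int_closure_eq_empty inf_commute)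
      then show ?thesis using r by auto
    qed
    have 1: "h z \<in> closure g" if z: "z \<in> closure (pull g)" "z \<noteq> q" for z
    proof -
      have "continuous_on (closure (pull g)) h" using qc by (rule hcont)
      then have "h ` closure (pull g) \<subseteq> closure (h ` pull g)"
        by (rule image_closure_subset) (auto intro: closure_subset[THEN subsetD])
      moreover have "h ` pull g \<subseteq> g" by (auto simp: pull_def)
      ultimately show ?thesis using z closure_mono by blast
    qed
    have 2: "z \<in> closure (pull g)" if z: "z \<noteq> q" "h z \<in> closure g" for z
    proof -
      have "h z \<in> closure (g - {0})"
      proof -
        have "open (- {0::complex})" by (simp add: open_Compl)
        then have "(- {0}) \<inter> closure g \<subseteq> closure ((- {0}) \<inter> g)" by (rule open_Int_closure_subset)
        moreover have "(- {0}) \<inter> g = g - {0}" by blast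
        ultimately show ?thesis using z h0[OF z(1)] by auto
      qed
      moreover have "isCont k (h z)" unfolding k_def by (intro continuous_intros) (use h0 z in auto)
      moreover obtain x where x: "\<And>n. x n \<in> g - {0}" "x \<longlonglongrightarrow> h z" using calculation(1) closure_sequential by blast
      ultimately have "(\<lambda>n. k (x n)) \<longlonglongrightarrow> k (h z)" by (simp add: isCont_tendsto_compose)
      moreover have "k (x n) \<in> pull g" for n unfolding pull_im using x(1) by blast
      ultimately show ?thesis using kh[OF z(1)] closure_sequential by metis
    qed
    have "frontier (pull g) = closure (pull g) - pull g" using o by (simp add: frontier_def interior_open)
    also have "\<dots> = {z. z \<noteq> q \<and> h z \<in> closure g - g}"
    proof (rule set_eqI, rule iffI)
      fix z assume z: "z \<in> closure (pull g) - pull g"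
      then have "z \<noteq> q" using qc by blast
      then show "z \<in> {z. z \<noteq> q \<and> h z \<in> closure g - g}" using 1[of z] z by (simp add: pull_def)
    next
      fix z assume "z \<in> {z. z \<noteq> q \<and> h z \<in> closure g - g}"
      then show "z \<in> closure (pull g) - pull g" using 2[of z] by (simp add: pull_def)
    qed
    also have "closure g - g = h ` D" using that by (simp add: frontier_def interior_open)
    also have "{z. z \<noteq> q \<and> h z \<in> h ` D} = D"
    proof (rule set_eqI, rule iffI)
      fix z assume "z \<in> {z. z \<noteq> q \<and> h z \<in> h ` D}"
      then obtain y where y: "z \<noteq> q" "y \<in> D" "h z = h y" by blast
      then have "y \<noteq> q" using that(4) by blast
      then show "z \<in> D" using kh y by metis
    next
      fix z assume "z \<in> D"
      then show "z \<in> {z. z \<noteq> q \<and> h z \<in> h ` D}" using that(4) by blast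
    qed
    finally show ?thesis .
  qed
  have gs: "g1 \<subseteq> inside C'" "g2 \<subseteq> inside C'" using g(8) by auto
  show thesis
  proof (rule that[of "pull g1" "pull g2"])
    show "pull g1 \<inter> pull g2 = {}" using g by (auto simp: pull_def)
    have "pull g1 \<union> pull g2 = {z. z \<noteq> q \<and> h z \<in> inside C' - path_image ?P}" using g(8) by (auto simp: pull_def)
    also have "\<dots> = outside C - path_image P"
    proof (rule set_eqI, rule iffI)
      fix z assume z: "z \<in> {z. z \<noteq> q \<and> h z \<in> inside C' - path_image ?P}"
      then have "z \<in> pull (inside C')" by (simp add: pull_def)
      then have "z \<in> outside C" using pull_sub[of "inside C'"] by blast
      moreover have "z \<notin> path_image P" using z by (auto simp: path_image_compose)
      ultimately show "z \<in> outside C - path_image P" by blast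
    next
      fix z assume z: "z \<in> outside C - path_image P"
      then have zq: "z \<noteq> q" "h z \<in> inside C'" using ho qn by blast+
      have "h z \<notin> path_image ?P"
      proof
        assume "h z \<in> path_image ?P"
        then obtain y where y: "y \<in> path_image P" "h z = h y" by (auto simp: path_image_compose)
        have "y \<noteq> q" proof assume "y = q" with y(1) qP show False by simp qed
        have "z = k (h z)" by (rule kh[OF zq(1), symmetric])
        also have "\<dots> = k (h y)" by (simp only: y(2))
        also have "\<dots> = y" by (rule kh[OF \<open>y \<noteq> q\<close>])
        finally have "z = y" .
        with y(1) z show False by simp
      qed
      then show "z \<in> {z. z \<noteq> q \<and> h z \<in> inside C' - path_image ?P}" using zq by blast
    qed
    finally show "pull g1 \<union> pull g2 = outside (path_image A \<union> path_image B) - path_image P" by (simp add: C_def)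
    show "frontier (pull g1) = path_image A \<union> path_image P"
      using g(9) qA qP by (intro pull_fr[OF g(1) gs(1)]) (auto simp: path_image_compose image_Un)
    show "frontier (pull g2) = path_image B \<union> path_image P"
      using g(10) qA qP by (intro pull_fr[OF g(2) gs(2)]) (auto simp: path_image_compose image_Un)
  qed (use g(1-6) pull_open pull_conn pull_ne in blast)+
qed

section \<open>Paths, cycles and their edges\<close>

fun pedges :: "'a list \<Rightarrow> 'a set set" where
  "pedges (x # y # zs) = insert {x, y} (pedges (y # zs))"
| "pedges _ = {}"

definition cedges :: "'a list \<Rightarrow> 'a set set" where
  "cedges vs = pedges (vs @ [hd vs])"

lemma pedges_append: "pedges (xs @ y # ys) = pedges (xs @ [y]) \<union> pedges (y # ys)"
  by (induction xs rule: pedges.induct) auto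

lemma pedges_snoc2: "pedges (xs @ [x, y]) = insert {x, y} (pedges (xs @ [x]))"
  by (subst pedges_append) auto

lemma pedges_rev: "pedges (rev xs) = pedges xs"
proof (induction xs rule: pedges.induct)
  case (1 x y zs)
  then show ?case using pedges_snoc2[of "rev zs" y x] by (simp add: insert_commute)
qed auto

lemma pedges_sub: "e \<in> pedges xs \<Longrightarrow> e \<subseteq> set xs"
  by (induction xs rule: pedges.induct) auto

lemma pedges_two: "e \<in> pedges xs \<Longrightarrow> distinct xs \<Longrightarrow> \<exists>u v. e = {u, v} \<and> u \<noteq> v"
  by (induction xs rule: pedges.induct) auto

lemma finite_pedges [simp]: "finite (pedges xs)"
  by (induction xs rule: pedges.induct) auto

lemma pedges_edge: "e \<in> pedges xs \<Longrightarrow> successively R xs \<Longrightarrow> \<exists>u v. e = {u, v} \<and> R u v"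
  by (induction xs rule: pedges.induct) auto

lemma Union_pedges: "length xs \<ge> 2 \<Longrightarrow> \<Union> (pedges xs) = set xs"
proof (induction xs rule: pedges.induct)
  case (1 x y zs)
  then show ?case by (cases zs) auto
qed auto

lemma card_pedges: "distinct xs \<Longrightarrow> card (pedges xs) = length xs - 1"
proof (induction xs rule: pedges.induct)
  case (1 x y zs)
  have "{x,y} \<notin> pedges (y # zs)" using pedges_sub[of "{x,y}" "y # zs"] 1(2) by auto
  then show ?case using 1 by simp
qed auto

lemma pedges_ends: "{a, b} \<in> pedges (a # A @ [b]) \<Longrightarrow> distinct (a # A @ [b]) \<Longrightarrow> A = []"
proof (cases A)
  case (Cons x xs)
  assume "{a, b} \<in> pedges (a # A @ [b])" "distinct (a # A @ [b])"
  then have "{a,b} \<in> pedges (x # xs @ [b])" using Cons by (auto simp: doubleton_eq_iff)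
  then have "a \<in> set (x # xs @ [b])" using pedges_sub by fastforce
  with \<open>distinct _\<close> Cons show ?thesis by auto
qed

lemma cedges_rot: "cedges (p @ a # s) = cedges (a # s @ p)"
proof (cases p)
  case Nil then show ?thesis by simp
next
  case (Cons x p')
  have "cedges (p @ a # s) = pedges (p @ a # s @ [x])" by (simp add: cedges_def Cons)
  also have "\<dots> = pedges (p @ [a]) \<union> pedges ((a # s) @ [x])" by (subst pedges_append) simp
  also have "\<dots> = pedges ((a # s) @ x # p' @ [a])"
    using pedges_append[of "a # s" x "p' @ [a]"] Cons by auto
  also have "\<dots> = cedges (a # s @ p)" by (simp add: cedges_def Cons)
  finally show ?thesis .
qed

lemma cedges_two: "cedges (a # A @ b # B) = pedges (a # A @ [b]) \<union> pedges (b # B @ [a])"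
  unfolding cedges_def using pedges_append[of "a # A" b "B @ [a]"] by simp

text \<open>A cycle is given by the list of its distinct vertices, the first of which is not repeated at the end.\<close>

definition cyc :: "('a \<Rightarrow> 'a \<Rightarrow> bool) \<Rightarrow> 'a list \<Rightarrow> bool" where
  "cyc R vs \<longleftrightarrow> length vs \<ge> 3 \<and> distinct vs \<and> successively R (vs @ [hd vs])"

lemma successively_rot:
  "successively R ((p @ a # s) @ [hd (p @ a # s)]) \<longleftrightarrow> successively R ((a # s @ p) @ [a])"
  by (cases p; cases s) (auto simp: successively_append_iff successively_Cons hd_append)

lemma cyc_rot: "cyc R (p @ a # s) \<longleftrightarrow> cyc R (a # s @ p)"
  unfolding cyc_def using successively_rot[of R p a s] by auto

text \<open>An ear attaches to a face at two vertices \<open>a\<close>, \<open>b\<close>; rotating the facial cycle displays its two halves between them.\<close>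

lemma cyc_split:
  assumes "cyc R vs" "a \<in> set vs" "b \<in> set vs" "a \<noteq> b"
  obtains A B where "cyc R (a # A @ b # B)" "cedges vs = cedges (a # A @ b # B)" "set vs = set (a # A @ b # B)"
proof -
  obtain p s where 1: "vs = p @ a # s" using assms(2) by (meson split_list)
  then have "b \<in> set (s @ p)" using assms by auto
  then obtain A B where 2: "s @ p = A @ b # B" by (meson split_list)
  have "set vs = set (a # s @ p)" using 1 by auto
  then show thesis using that[of A B] 1 2 cyc_rot[of R p a s] cedges_rot[of p a s] assms by auto
qed

lemma cyc_parts:
  assumes "cyc R (a # A @ b # B)"
  shows "successively R (a # A @ [b])" "successively R (b # B @ [a])" "distinct (a # A @ [b])" "distinct (b # B @ [a])"
    "pedges (a # A @ [b]) \<inter> pedges (b # B @ [a]) = {}"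
proof -
  show 1: "successively R (a # A @ [b])" "successively R (b # B @ [a])"
    using assms unfolding cyc_def by (auto simp: successively_append_iff successively_Cons hd_append)
  show 2: "distinct (a # A @ [b])" "distinct (b # B @ [a])" using assms by (auto simp: cyc_def)
  show "pedges (a # A @ [b]) \<inter> pedges (b # B @ [a]) = {}"
  proof (rule ccontr)
    assume "\<not> ?thesis"
    then obtain e where e: "e \<in> pedges (a # A @ [b])" "e \<in> pedges (b # B @ [a])" by auto
    then have "e \<subseteq> {a, b}" using pedges_sub[OF e(1)] pedges_sub[OF e(2)] assms by (auto simp: cyc_def)
    moreover obtain u v where "e = {u, v}" "u \<noteq> v" using pedges_two e(1) 2 by blast
    ultimately have "e = {a, b}" by auto
    then have "A = []" "B = []" using pedges_ends e 2 by (metis, metis insert_commute)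
    then show False using assms by (simp add: cyc_def)
  qed
qed

lemma card_cedges:
  assumes "cyc R vs" shows "card (cedges vs) = length vs" "\<Union> (cedges vs) = set vs"
proof -
  obtain a b B where v: "vs = a # b # B" using assms by (cases vs; cases "tl vs") (auto simp: cyc_def)
  have c: "cyc R (a # [] @ b # B)" using assms v by simp
  have "cedges vs = pedges (a # [] @ [b]) \<union> pedges (b # B @ [a])" using v cedges_two[of a "[]" b B] by simp
  moreover have "card (pedges (a # [] @ [b]) \<union> pedges (b # B @ [a])) = 1 + (length B + 1)"
    using cyc_parts[OF c] card_pedges[of "b # B @ [a]"] by (subst card_Un_disjoint) auto
  ultimately show "card (cedges vs) = length vs" "\<Union> (cedges vs) = set vs"
    using v Union_pedges[of "b # B @ [a]"] by auto
qed

lemma finite_cedges [simp]: "finite (cedges vs)" by (simp add: cedges_def)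

lemma cedges_edge: "cyc R vs \<Longrightarrow> e \<in> cedges vs \<Longrightarrow> \<exists>u v. e = {u, v} \<and> R u v"
  unfolding cyc_def cedges_def using pedges_edge by blast

section \<open>Plane graphs and their faces\<close>

locale plane_graph =
  fixes V :: "'a set" and adj :: "'a \<Rightarrow> 'a \<Rightarrow> bool" and pos :: "'a \<Rightarrow> complex" and \<gamma> :: "'a \<times> 'a \<Rightarrow> real \<Rightarrow> complex"
  assumes sym: "adj x y \<Longrightarrow> adj y x" and irr: "\<not> adj x x"
    and adjV: "adj x y \<Longrightarrow> x \<in> V"
    and pos_inj: "inj_on pos V"
    and g_arc: "adj x y \<Longrightarrow> arc (\<gamma> (x, y))"
    and g_ends: "adj x y \<Longrightarrow> pathstart (\<gamma> (x, y)) = pos x" "adj x y \<Longrightarrow> pathfinish (\<gamma> (x, y)) = pos y"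
    and g_rev: "adj x y \<Longrightarrow> \<gamma> (y, x) = reversepath (\<gamma> (x, y))"
    and g_vert: "adj x y \<Longrightarrow> w \<in> V \<Longrightarrow> pos w \<in> path_image (\<gamma> (x, y)) \<Longrightarrow> w = x \<or> w = y"
    and g_cross: "adj x y \<Longrightarrow> adj u v \<Longrightarrow> {x, y} \<noteq> {u, v} \<Longrightarrow>
      path_image (\<gamma> (x, y)) \<inter> path_image (\<gamma> (u, v)) \<subseteq> pos ` ({x, y} \<inter> {u, v})"
begin

text \<open>The drawing of an edge and of a set of edges is taken over unordered pairs, since both orientations have the same image.\<close>

definition edg :: "'a set set" where "edg = {{u, v} |u v. adj u v}"

definition eimg :: "'a set \<Rightarrow> complex set" where
  "eimg e = \<Union> {path_image (\<gamma> (u, v)) |u v. e = {u, v} \<and> adj u v}"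

definition dimg :: "'a set set \<Rightarrow> complex set" where "dimg D = \<Union> (eimg ` D)"

lemma eimg_eq: assumes "adj u v" shows "eimg {u, v} = path_image (\<gamma> (u, v))"
proof -
  have "path_image (\<gamma> (x, y)) = path_image (\<gamma> (u, v))" if "{u, v} = {x, y}" "adj x y" for x y
    using that g_rev[OF assms] by (auto simp: doubleton_eq_iff)
  then show ?thesis unfolding eimg_def using assms by blast
qed

lemma edgE: assumes "e \<in> edg" obtains u v where "e = {u, v}" "adj u v" "u \<noteq> v" "u \<in> V" "v \<in> V"
proof -
  obtain u v where "e = {u, v}" "adj u v" using assms by (auto simp: edg_def)
  then show thesis using that[of u v] irr adjV sym by metis
qed

lemma edgV: "e \<in> edg \<Longrightarrow> e \<subseteq> V" by (auto elim!: edgE)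

lemma eimg_vert: assumes "e \<in> edg" "w \<in> V" "pos w \<in> eimg e" shows "w \<in> e"
proof -
  obtain u v where e: "e = {u, v}" "adj u v" using assms by (auto elim: edgE)
  then show ?thesis using assms eimg_eq[OF e(2)] g_vert[OF e(2)] by auto
qed

lemma eimg_ends: assumes "e \<in> edg" "w \<in> e" shows "pos w \<in> eimg e"
proof -
  obtain u v where e: "e = {u, v}" "adj u v" using assms by (auto elim: edgE)
  then show ?thesis using assms eimg_eq[OF e(2)] g_ends[OF e(2)] pathstart_in_path_image pathfinish_in_path_image
    by (metis insertE singletonD)
qed

lemma eimg_cross: assumes "e \<in> edg" "e' \<in> edg" "e \<noteq> e'" shows "eimg e \<inter> eimg e' \<subseteq> pos ` (e \<inter> e')"
proof -
  obtain u v where e: "e = {u, v}" "adj u v" using edgE[OF assms(1)] by metis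
  obtain x y where e': "e' = {x, y}" "adj x y" using edgE[OF assms(2)] by metis
  show ?thesis using g_cross[OF e(2) e'(2)] assms e e' eimg_eq by metis
qed

lemma dimg_cross:
  assumes "D \<subseteq> edg" "D' \<subseteq> edg" "D \<inter> D' = {}"
  shows "dimg D \<inter> dimg D' \<subseteq> pos ` (\<Union> D \<inter> \<Union> D')"
proof
  fix z assume "z \<in> dimg D \<inter> dimg D'"
  then obtain e e' where e: "e \<in> D" "e' \<in> D'" "z \<in> eimg e" "z \<in> eimg e'" by (auto simp: dimg_def)
  then have "e \<noteq> e'" using assms(3) by blast
  then have "z \<in> pos ` (e \<inter> e')" using eimg_cross[of e e'] e assms by blast
  then show "z \<in> pos ` (\<Union> D \<inter> \<Union> D')" using e by blast
qed

lemma dimg_vert: assumes "D \<subseteq> edg" "w \<in> V" shows "pos w \<in> dimg D \<longleftrightarrow> w \<in> \<Union> D"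
  using assms eimg_vert eimg_ends unfolding dimg_def by blast

lemma dimg_Un: "dimg (D \<union> D') = dimg D \<union> dimg D'" by (auto simp: dimg_def)

lemma pedges_edg: "successively adj xs \<Longrightarrow> pedges xs \<subseteq> edg"
  using pedges_edge[of _ xs adj] by (auto simp: edg_def)

lemma cedges_edg: "cyc adj xs \<Longrightarrow> cedges xs \<subseteq> edg"
  using cedges_edge[of adj xs] by (auto simp: edg_def)

lemma path_arc:
  assumes "successively adj xs" "distinct xs" "length xs \<ge> 2"
  shows "\<exists>p. arc p \<and> pathstart p = pos (hd xs) \<and> pathfinish p = pos (last xs) \<and> path_image p = dimg (pedges xs)"
  using assms
proof (induction xs rule: pedges.induct)
  case (1 x y zs)
  have xy: "adj x y" using 1(2) by simp
  show ?case
  proof (cases zs)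
    case Nil
    then show ?thesis using xy g_arc g_ends eimg_eq by (intro exI[of _ "\<gamma> (x, y)"]) (auto simp: dimg_def)
  next
    case (Cons z zs')
    then obtain p where p: "arc p" "pathstart p = pos y" "pathfinish p = pos (last zs)" "path_image p = dimg (pedges (y # zs))"
      using 1 by auto
    have D: "pedges (y # zs) \<subseteq> edg" "{{x,y}} \<subseteq> edg" using 1(2) pedges_edg[of "y # zs"] xy by (auto simp: edg_def)
    have "{{x,y}} \<inter> pedges (y # zs) = {}" using pedges_sub[of "{x,y}" "y # zs"] 1(3) by auto
    then have "dimg {{x,y}} \<inter> dimg (pedges (y # zs)) \<subseteq> pos ` (\<Union> {{x,y}} \<inter> \<Union> (pedges (y # zs)))"
      using dimg_cross[OF D(2,1)] by simp
    also have "\<Union> (pedges (y # zs)) = set (y # zs)" using Cons by (intro Union_pedges) simp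
    finally have "dimg {{x,y}} \<inter> dimg (pedges (y # zs)) \<subseteq> {pos y}" using 1(3) by auto
    then have int: "path_image (\<gamma> (x,y)) \<inter> path_image p \<subseteq> {pos y}" using p eimg_eq[OF xy] by (simp add: dimg_def)
    have "arc (\<gamma> (x, y) +++ p)" using p g_arc[OF xy] g_ends[OF xy] int by (intro arc_join) auto
    moreover have "path_image (\<gamma> (x, y) +++ p) = dimg (pedges (x # y # zs))"
      using p g_ends[OF xy] eimg_eq[OF xy] by (subst path_image_join) (auto simp: dimg_def)
    ultimately show ?thesis using p g_ends[OF xy] Cons by (intro exI[of _ "\<gamma> (x, y) +++ p"]) auto
  qed
qed auto

text \<open>\<open>F\<close> is the set of faces of the drawing of the edge set \<open>D\<close>, and every face \<open>f\<close> is bounded by the cycle \<open>bd f\<close>.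
The three combinatorial clauses are what the counting argument uses: every edge lies on two faces, Euler's formula,
and the statement that the faces around a vertex \<open>x\<close> form a single cyclic sequence. The
last one says that any splitting of the edges at \<open>x\<close> into two nonempty parts is bridged by a face with
consecutive boundary edges from both.\<close>

definition face_sys :: "'a set set \<Rightarrow> complex set set \<Rightarrow> (complex set \<Rightarrow> 'a list) \<Rightarrow> bool" where
  "face_sys D F bd \<longleftrightarrow> finite D \<and> D \<subseteq> edg \<and> finite F \<and>
    (\<forall>f\<in>F. open f \<and> connected f \<and> f \<noteq> {}) \<and> disjoint F \<and> \<Union> F = - dimg D \<and>
    (\<forall>f\<in>F. cyc adj (bd f) \<and> cedges (bd f) \<subseteq> D \<and> frontier f = dimg (cedges (bd f))) \<and>
    (\<forall>e\<in>D. card {f\<in>F. e \<in> cedges (bd f)} = 2) \<and>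
    card F + card (\<Union> D) = card D + 2 \<and>
    (\<forall>x X. X \<subseteq> {e\<in>D. x \<in> e} \<and> X \<noteq> {} \<and> X \<noteq> {e\<in>D. x \<in> e} \<longrightarrow>
       (\<exists>f\<in>F. \<exists>e\<in>X. \<exists>e'\<in>D - X. x \<in> e' \<and> e \<in> cedges (bd f) \<and> e' \<in> cedges (bd f)))"

lemma face_sysI:
  assumes "finite D" "D \<subseteq> edg" "finite F"
    "\<And>f. f \<in> F \<Longrightarrow> open f" "\<And>f. f \<in> F \<Longrightarrow> connected f" "\<And>f. f \<in> F \<Longrightarrow> f \<noteq> {}"
    "disjoint F" "\<Union> F = - dimg D"
    "\<And>f. f \<in> F \<Longrightarrow> cyc adj (bd f)" "\<And>f. f \<in> F \<Longrightarrow> cedges (bd f) \<subseteq> D"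
    "\<And>f. f \<in> F \<Longrightarrow> frontier f = dimg (cedges (bd f))"
    "\<And>e. e \<in> D \<Longrightarrow> card {f\<in>F. e \<in> cedges (bd f)} = 2"
    "card F + card (\<Union> D) = card D + 2"
    "\<And>x X. X \<subseteq> {e\<in>D. x \<in> e} \<Longrightarrow> X \<noteq> {} \<Longrightarrow> X \<noteq> {e\<in>D. x \<in> e} \<Longrightarrow>
       \<exists>f\<in>F. \<exists>e\<in>X. \<exists>e'\<in>D - X. x \<in> e' \<and> e \<in> cedges (bd f) \<and> e' \<in> cedges (bd f)"
  shows "face_sys D F bd"
  unfolding face_sys_def
  apply (intro conjI ballI allI impI)
               apply (fact assms(1) assms(2) assms(3) assms(7) assms(8) assms(13) | erule assms)+
  apply (elim conjE)
  apply (rule assms(14); assumption)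
  done

lemma cyc_arcs:
  assumes "cyc adj (a # A @ b # B)"
  obtains p q where "arc p" "arc q" "pathstart p = pos a" "pathfinish p = pos b" "pathstart q = pos a" "pathfinish q = pos b"
    "path_image p = dimg (pedges (a # A @ [b]))" "path_image q = dimg (pedges (b # B @ [a]))"
    "path_image p \<inter> path_image q = {pos a, pos b}"
proof -
  note c = cyc_parts[OF assms]
  obtain p where p: "arc p" "pathstart p = pos a" "pathfinish p = pos b" "path_image p = dimg (pedges (a # A @ [b]))"
    using path_arc[OF c(1) c(3)] by auto
  have "successively adj (a # rev B @ [b])"
    using c(2) sym successively_rev[of adj "b # B @ [a]"] by (auto elim: successively_mono)
  then obtain q where q: "arc q" "pathstart q = pos a" "pathfinish q = pos b" "path_image q = dimg (pedges (a # rev B @ [b]))"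
    using path_arc[of "a # rev B @ [b]"] c(4) by auto
  have q': "path_image q = dimg (pedges (b # B @ [a]))" using q(4) pedges_rev[of "b # B @ [a]"] by simp
  have "path_image p \<inter> path_image q \<subseteq> pos ` (set (a # A @ [b]) \<inter> set (b # B @ [a]))"
    using dimg_cross[OF pedges_edg[OF c(1)] pedges_edg[OF c(2)] c(5)] Union_pedges[of "a # A @ [b]"] Union_pedges[of "b # B @ [a]"] p q' by simp
  then have "path_image p \<inter> path_image q \<subseteq> {pos a, pos b}" using assms by (auto simp: cyc_def)
  moreover have "pos a \<in> path_image p" "pos b \<in> path_image p" "pos a \<in> path_image q" "pos b \<in> path_image q"
    using p q by (metis pathfinish_in_path_image pathstart_in_path_image)+
  ultimately show thesis using that[OF p(1) q(1) p(2,3) q(2,3) p(4) q'] by blast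
qed

lemma cyc_loop:
  assumes "cyc adj vs"
  obtains c where "simple_path c" "pathfinish c = pathstart c" "path_image c = dimg (cedges vs)"
proof -
  obtain a b B where v: "vs = a # [] @ b # B" using assms by (cases vs; cases "tl vs") (auto simp: cyc_def)
  obtain p q where pq: "arc p" "arc q" "pathstart p = pos a" "pathfinish p = pos b" "pathstart q = pos a" "pathfinish q = pos b"
    "path_image p = dimg (pedges (a # [] @ [b]))" "path_image q = dimg (pedges (b # B @ [a]))"
    "path_image p \<inter> path_image q = {pos a, pos b}" using cyc_arcs[of a "[]" b B] assms v by metis
  have "simple_path (p +++ reversepath q)"
  proof (rule simple_path_join_loop)
    show "path_image p \<inter> path_image (reversepath q) \<subseteq> {pathstart p, pathstart (reversepath q)}"
      unfolding path_image_reversepath pq(9) pathstart_reversepath pq(3,6) by (rule subset_refl)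
  qed (simp_all only: pq arc_reversepath pathstart_reversepath pathfinish_reversepath)
  moreover have "path_image (p +++ reversepath q) = dimg (cedges vs)"
    unfolding v cedges_two dimg_Un pq(7,8)[symmetric]
    by (subst path_image_join) (simp_all only: pq pathstart_reversepath path_image_reversepath)
  moreover have "pathfinish (p +++ reversepath q) = pathstart (p +++ reversepath q)"
    by (simp only: pathstart_join pathfinish_join pathfinish_reversepath pq)
  ultimately show thesis by (intro that)
qed

lemma face_sys_cycle:
  assumes "cyc adj vs"
  shows "\<exists>F bd. face_sys (cedges vs) F bd"
proof -
  obtain c where c: "simple_path c" "pathfinish c = pathstart c" "path_image c = dimg (cedges vs)"
    using cyc_loop[OF assms] .
  note J = Jordan_inside_outside[OF c(1,2), unfolded c(3)]
  define i where "i = inside (dimg (cedges vs))"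
  define u where "u = outside (dimg (cedges vs))"
  have J1: "i \<noteq> {}" "open i" "connected i" "u \<noteq> {}" "open u" "connected u" "i \<inter> u = {}"
    "i \<union> u = - dimg (cedges vs)" "frontier i = dimg (cedges vs)" "frontier u = dimg (cedges vs)"
    using J unfolding i_def u_def by simp_all
  have ne: "i \<noteq> u" using J1(1,7) by (metis Int_absorb)
  have sel: "f = i \<or> f = u" if "f \<in> {i, u}" for f using that by blast
  show ?thesis
  proof (intro exI[of _ "{i, u}"] exI[of _ "\<lambda>_. vs"] face_sysI)
    show "finite (cedges vs)" "finite {i, u}" by simp_all
    show "cedges vs \<subseteq> edg" using cedges_edg[OF assms] .
    show "open f" if "f \<in> {i, u}" for f using sel[OF that] J1(2,5) by (elim disjE; simp)
    show "connected f" if "f \<in> {i, u}" for f using sel[OF that] J1(3,6) by (elim disjE; simp)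
    show "f \<noteq> {}" if "f \<in> {i, u}" for f using sel[OF that] J1(1,4) by (elim disjE; simp)
    show "frontier f = dimg (cedges vs)" if "f \<in> {i, u}" for f using sel[OF that] J1(9,10) by (elim disjE; simp)
    show "disjoint {i, u}" using J1(7) by (simp add: pairwise_insert disjnt_def Int_commute)
    show "\<Union> {i, u} = - dimg (cedges vs)" using J1(8) by simp
    show "cyc adj vs" by (rule assms)
    show "cedges vs \<subseteq> cedges vs" ..
    show "card {f \<in> {i, u}. e \<in> cedges vs} = 2" if "e \<in> cedges vs" for e
    proof -
      have "{f \<in> {i, u}. e \<in> cedges vs} = {i, u}" using that by (intro set_eqI) simp
      then show ?thesis using ne by simp
    qed
    have "card (\<Union> (cedges vs)) = card (cedges vs)"
      using card_cedges[OF assms] assms by (simp add: cyc_def distinct_card)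
    then show "card {i, u} + card (\<Union> (cedges vs)) = card (cedges vs) + 2" using ne by simp
    show "\<exists>f\<in>{i, u}. \<exists>e\<in>X. \<exists>e'\<in>cedges vs - X. x \<in> e' \<and> e \<in> cedges vs \<and> e' \<in> cedges vs"
      if X: "X \<subseteq> {e\<in>cedges vs. x \<in> e}" "X \<noteq> {}" "X \<noteq> {e\<in>cedges vs. x \<in> e}" for x X
    proof -
      obtain e where e: "e \<in> X" using X(2) by blast
      have "\<exists>e'. e' \<in> {e\<in>cedges vs. x \<in> e} - X" using X(1,3) by (metis Diff_eq_empty_iff all_not_in_conv subset_antisym)
      then obtain e' where e': "e' \<in> cedges vs - X" "x \<in> e'" by fast
      have "e \<in> cedges vs" using subsetD[OF X(1) e] by simp
      then show ?thesis using e e' by (intro bexI[of _ i] bexI[of _ e] bexI[of _ e'] conjI) simp_all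
    qed
  qed
qed

text \<open>A connected open set whose frontier is the whole curve cannot be a proper part of one side, since that
side is connected and would meet the frontier.\<close>

lemma face_inside_outside:
  assumes "cyc adj vs" "open f" "connected f" "f \<noteq> {}" "frontier f = dimg (cedges vs)"
  shows "f = inside (dimg (cedges vs)) \<or> f = outside (dimg (cedges vs))"
proof -
  obtain c where c: "simple_path c" "pathfinish c = pathstart c" "path_image c = dimg (cedges vs)"
    using cyc_loop[OF assms(1)] .
  note J = Jordan_inside_outside[OF c(1,2), unfolded c(3)]
  define C where "C = dimg (cedges vs)"
  have J1: "open (inside C)" "connected (inside C)" "open (outside C)" "connected (outside C)"
    "inside C \<inter> outside C = {}" "inside C \<union> outside C = - C" using J unfolding C_def by simp_all
  have "f \<inter> frontier f = {}" using assms(2) by (simp add: frontier_def interior_open)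
  then have fC: "f \<inter> C = {}" using assms(5) C_def by simp
  have fside: "f \<subseteq> inside C \<or> f \<subseteq> outside C"
  proof -
    have "f \<subseteq> inside C \<union> outside C" using J1(6) fC by auto
    then have "inside C \<inter> f = {} \<or> outside C \<inter> f = {}"
      using connectedD[OF assms(3) J1(1,3)] J1(5) by (metis Int_empty_left)
    then show ?thesis
    proof
      assume "inside C \<inter> f = {}"
      show ?thesis
      proof (rule disjI2, rule subsetI)
        fix z assume "z \<in> f"
        moreover from this have "z \<notin> inside C" using \<open>inside C \<inter> f = {}\<close> by (metis IntI emptyE)
        ultimately show "z \<in> outside C" using \<open>f \<subseteq> inside C \<union> outside C\<close> by (metis UnE subsetD)
      qed
    next
      assume "outside C \<inter> f = {}"
      show ?thesis
      proof (rule disjI1, rule subsetI)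
        fix z assume "z \<in> f"
        moreover from this have "z \<notin> outside C" using \<open>outside C \<inter> f = {}\<close> by (metis IntI emptyE)
        ultimately show "z \<in> inside C" using \<open>f \<subseteq> inside C \<union> outside C\<close> by (metis UnE subsetD)
      qed
    qed
  qed
  have sub: "g = f" if g: "f \<subseteq> g" "connected g" "g \<inter> C = {}" for g
  proof (rule ccontr)
    assume "g \<noteq> f"
    then have "g - f \<noteq> {}" using g(1) by (metis Diff_eq_empty_iff subset_antisym)
    moreover have "g \<inter> f \<noteq> {}" using g(1) assms(4) by (simp add: Int_absorb1)
    ultimately have "g \<inter> frontier f \<noteq> {}" by (intro connected_Int_frontier[OF g(2)])
    then show False using g(3) assms(5) C_def by simp
  qed
  have n: "inside C \<inter> C = {}" "outside C \<inter> C = {}" by (rule inside_no_overlap, rule outside_no_overlap)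
  from fside have "f = inside C \<or> f = outside C"
  proof
    assume "f \<subseteq> inside C"
    from sub[OF this J1(2) n(1)] show ?thesis by simp
  next
    assume "f \<subseteq> outside C"
    from sub[OF this J1(4) n(2)] show ?thesis by simp
  qed
  then show ?thesis by (simp only: C_def)
qed

lemma face_split:
  assumes c: "cyc adj (a # A @ b # B)"
    and f: "open f" "connected f" "f \<noteq> {}" "frontier f = dimg (cedges (a # A @ b # B))"
    and p: "arc p" "pathstart p = pos a" "pathfinish p = pos b" "path_image p - {pos a, pos b} \<subseteq> f"
      "path_image p \<inter> dimg (cedges (a # A @ b # B)) = {pos a, pos b}"
  obtains f1 f2 where "open f1" "open f2" "connected f1" "connected f2" "f1 \<noteq> {}" "f2 \<noteq> {}"
    "f1 \<inter> f2 = {}" "f1 \<union> f2 = f - path_image p"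
    "frontier f1 = dimg (pedges (a # A @ [b])) \<union> path_image p"
    "frontier f2 = dimg (pedges (b # B @ [a])) \<union> path_image p"
proof -
  obtain P Q where PQ: "arc P" "arc Q" "pathstart P = pos a" "pathfinish P = pos b" "pathstart Q = pos a" "pathfinish Q = pos b"
    and im: "path_image P = dimg (pedges (a # A @ [b]))" "path_image Q = dimg (pedges (b # B @ [a]))"
    and int: "path_image P \<inter> path_image Q = {pos a, pos b}"
    by (rule cyc_arcs[OF c])
  have C: "dimg (cedges (a # A @ b # B)) = path_image P \<union> path_image Q"
    by (simp only: im cedges_two dimg_Un)
  have mem: "{pos a, pos b} \<subseteq> path_image P" "{pos a, pos b} \<subseteq> path_image Q" using int by blast+
  have int2: "path_image P \<inter> path_image p = {pos a, pos b}" "path_image Q \<inter> path_image p = {pos a, pos b}"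
    using p(5) mem unfolding C by blast+
  from face_inside_outside[OF c f] show thesis
  proof
    assume "f = inside (dimg (cedges (a # A @ b # B)))"
    then have e: "inside (path_image P \<union> path_image Q) = f" by (simp only: C)
    from p(4) have io: "path_image p - {pos a, pos b} \<subseteq> inside (path_image P \<union> path_image Q)" by (simp only: e)
    show thesis
      by (rule crosscut_inside[OF PQ(1,2) p(1) PQ(3-6) p(2,3) int int2 io, unfolded e]) (rule that[unfolded im[symmetric]]; assumption)
  next
    assume "f = outside (dimg (cedges (a # A @ b # B)))"
    then have e: "outside (path_image P \<union> path_image Q) = f" by (simp only: C)
    from p(4) have io: "path_image p - {pos a, pos b} \<subseteq> outside (path_image P \<union> path_image Q)" by (simp only: e)
    show thesis
      by (rule crosscut_outside[OF PQ(1,2) p(1) PQ(3-6) p(2,3) int int2 io, unfolded e]) (rule that[unfolded im[symmetric]]; assumption)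
  qed
qed

text \<open>An ear running through a face ends on the frontier of this face, because its ends are limits of its inner points.\<close>

lemma arc_end_closure:
  fixes p :: "real \<Rightarrow> complex"
  assumes "arc p"
  shows "pathstart p \<in> closure (path_image p - {pathstart p, pathfinish p})"
    "pathfinish p \<in> closure (path_image p - {pathstart p, pathfinish p})"
proof -
  have *: "pathstart q \<in> closure (path_image q - {pathstart q, pathfinish q})" if "arc q" for q :: "real \<Rightarrow> complex"
  proof -
    have cont: "continuous_on {0..1} q" and inj: "inj_on q {0..1}" using that by (auto simp: arc_def path_def)
    define x where "x = (\<lambda>n. q (inverse (real (Suc (Suc n)))))"
    have r: "inverse (real (Suc (Suc n))) \<in> {0<..<1}" for n by (auto simp: field_simps)
    have "x n \<in> path_image q - {pathstart q, pathfinish q}" for n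
    proof -
      have t: "inverse (real (Suc (Suc n))) \<in> {0..1}" "inverse (real (Suc (Suc n))) \<noteq> 0" "inverse (real (Suc (Suc n))) \<noteq> 1"
        using r[of n] by auto
      have "x n \<noteq> q 0" "x n \<noteq> q 1"
        using inj_on_eq_iff[OF inj t(1), of 0] inj_on_eq_iff[OF inj t(1), of 1] t(2,3) by (auto simp: x_def)
      then show ?thesis using t(1) by (auto simp: x_def path_image_def pathstart_def pathfinish_def)
    qed
    moreover have "x \<longlonglongrightarrow> pathstart q"
    proof -
      have "(\<lambda>n. inverse (real (Suc (Suc n)))) \<longlonglongrightarrow> 0" using LIMSEQ_inverse_real_of_nat LIMSEQ_Suc by blast
      moreover have "\<forall>n. inverse (real (Suc (Suc n))) \<in> {0..1}" using r by (metis greaterThanLessThan_iff atLeastAtMost_iff less_imp_le)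
      ultimately show ?thesis using cont unfolding x_def pathstart_def continuous_on_sequentially comp_def by auto
    qed
    ultimately show ?thesis using closure_sequential by blast
  qed
  show "pathstart p \<in> closure (path_image p - {pathstart p, pathfinish p})" using *[OF assms] .
  show "pathfinish p \<in> closure (path_image p - {pathstart p, pathfinish p})"
    using *[OF arc_reversepath[OF assms]] by (simp add: insert_commute)
qed

end

context plane_graph begin

lemma face_sysD:
  assumes "face_sys D F bd"
  shows "finite D" "D \<subseteq> edg" "finite F"
    "f \<in> F \<Longrightarrow> open f" "f \<in> F \<Longrightarrow> connected f" "f \<in> F \<Longrightarrow> f \<noteq> {}"
    "disjoint F" "\<Union> F = - dimg D"
    "f \<in> F \<Longrightarrow> cyc adj (bd f)" "f \<in> F \<Longrightarrow> cedges (bd f) \<subseteq> D"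
    "f \<in> F \<Longrightarrow> frontier f = dimg (cedges (bd f))"
    "e \<in> D \<Longrightarrow> card {f\<in>F. e \<in> cedges (bd f)} = 2"
    "card F + card (\<Union> D) = card D + 2"
    "X \<subseteq> {e\<in>D. x \<in> e} \<Longrightarrow> X \<noteq> {} \<Longrightarrow> X \<noteq> {e\<in>D. x \<in> e} \<Longrightarrow>
       \<exists>f\<in>F. \<exists>e\<in>X. \<exists>e'\<in>D - X. x \<in> e' \<and> e \<in> cedges (bd f) \<and> e' \<in> cedges (bd f)"
  using assms unfolding face_sys_def by simp_all

text \<open>The inner points of an ear form a connected set that avoids the drawing, so they lie in one face, and both ends lie on the cycle of that face.\<close>

lemma ear_in_face:
  assumes fs: "face_sys D F bd"
    and xs: "successively adj (a # I @ [b])" "distinct (a # I @ [b])"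
    and ends: "a \<in> \<Union> D" "b \<in> \<Union> D" and I: "set I \<inter> \<Union> D = {}"
    and new: "pedges (a # I @ [b]) \<inter> D = {}"
  obtains p f where "arc p" "pathstart p = pos a" "pathfinish p = pos b"
    "path_image p = dimg (pedges (a # I @ [b]))" "path_image p \<inter> dimg D = {pos a, pos b}"
    "f \<in> F" "path_image p - {pos a, pos b} \<subseteq> f" "path_image p - {pos a, pos b} \<noteq> {}"
    "a \<in> set (bd f)" "b \<in> set (bd f)"
proof -
  note FS = face_sysD[OF fs]
  obtain p where p: "arc p" "pathstart p = pos a" "pathfinish p = pos b" "path_image p = dimg (pedges (a # I @ [b]))"
    using path_arc[OF xs] by auto
  let ?P = "path_image p - {pos a, pos b}"
  have abV: "a \<in> V" "b \<in> V" using ends FS(2) edgV by blast+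
  have memD: "pos a \<in> dimg D" "pos b \<in> dimg D" using dimg_vert[OF FS(2)] abV ends by simp_all
  have int: "path_image p \<inter> dimg D = {pos a, pos b}"
  proof
    have "path_image p \<inter> dimg D \<subseteq> pos ` (\<Union> (pedges (a # I @ [b])) \<inter> \<Union> D)"
      unfolding p(4) by (rule dimg_cross[OF pedges_edg[OF xs(1)] FS(2) new])
    also have "\<Union> (pedges (a # I @ [b])) = set (a # I @ [b])" by (rule Union_pedges) simp
    also have "set (a # I @ [b]) \<inter> \<Union> D \<subseteq> {a, b}" using I by auto
    finally show "path_image p \<inter> dimg D \<subseteq> {pos a, pos b}" by auto
    show "{pos a, pos b} \<subseteq> path_image p \<inter> dimg D"
      using memD p(2,3) pathstart_in_path_image[of p] pathfinish_in_path_image[of p] by simp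
  qed
  have con: "connected ?P" using connected_simple_path_endless[OF arc_imp_simple_path[OF p(1)]] p(2,3) by simp
  have cl: "pos a \<in> closure ?P" "pos b \<in> closure ?P" using arc_end_closure[OF p(1)] p(2,3) by simp_all
  then have ne: "?P \<noteq> {}" by (metis closure_empty empty_iff)
  have sub: "?P \<subseteq> \<Union> F" unfolding FS(8) using int by blast
  obtain z where z: "z \<in> ?P" using ne by (metis ex_in_conv)
  then obtain f where f: "f \<in> F" "z \<in> f" using sub by blast
  have Pf: "?P \<subseteq> f"
  proof -
    let ?R = "\<Union> (F - {f})"
    have "open ?R" using FS(4) by (intro open_Union) blast
    moreover have "f \<inter> ?R = {}" using FS(7) f(1) by (auto simp: pairwise_def disjnt_def)
    moreover have "?P \<subseteq> f \<union> ?R" using sub by blast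
    ultimately have "f \<inter> ?P = {} \<or> ?R \<inter> ?P = {}"
      using connectedD[OF con FS(4)[OF f(1)], of ?R] by (metis Int_empty_left)
    moreover have "f \<inter> ?P \<noteq> {}" using z f(2) by (metis IntI emptyE)
    ultimately show ?thesis using \<open>?P \<subseteq> f \<union> ?R\<close> by blast
  qed
  have fD: "f \<inter> dimg D = {}" using FS(8) f(1) by blast
  have on: "x \<in> set (bd f)" if "x \<in> V" "pos x \<in> closure ?P" "pos x \<in> dimg D" for x
  proof -
    have "pos x \<in> closure f" using that(2) closure_mono[OF Pf] by blast
    moreover have "pos x \<notin> f" using that(3) fD by blast
    ultimately have "pos x \<in> frontier f" using FS(4)[OF f(1)] by (simp add: frontier_def interior_open)
    then have "pos x \<in> dimg (cedges (bd f))" using FS(11)[OF f(1)] by simp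
    then have "x \<in> \<Union> (cedges (bd f))" using dimg_vert[OF cedges_edg[OF FS(9)[OF f(1)]] that(1)] by simp
    then show ?thesis using card_cedges(2)[OF FS(9)[OF f(1)]] by simp
  qed
  show thesis
    by (rule that[OF p int f(1) Pf ne on[OF abV(1) cl(1) memD(1)] on[OF abV(2) cl(2) memD(2)]])
qed

text \<open>The ear cuts the face that contains it into two faces, one for each half of the facial cycle; all other faces
stay. Edges of the old facial cycle move from the old face to one of the new ones, edges of the ear lie on both new faces, and Euler's
formula gains one face and one more edge than vertices. For the cyclic structure at an end of the
ear, a splitting that no new face bridges would put all edges of the cut face on the side of the ear, and then
another old face already bridges it.\<close>

lemma face_sys_ear:
  assumes fs: "face_sys D F bd"
    and xs: "successively adj (a # I @ [b])" "distinct (a # I @ [b])"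
    and ends: "a \<in> \<Union> D" "b \<in> \<Union> D" and I: "set I \<inter> \<Union> D = {}"
    and new: "pedges (a # I @ [b]) \<inter> D = {}"
  shows "\<exists>F bd. face_sys (D \<union> pedges (a # I @ [b])) F bd"
proof -
  note FS = face_sysD[OF fs]
  obtain p f where p: "arc p" "pathstart p = pos a" "pathfinish p = pos b"
    "path_image p = dimg (pedges (a # I @ [b]))" "path_image p \<inter> dimg D = {pos a, pos b}"
    and f: "f \<in> F" "path_image p - {pos a, pos b} \<subseteq> f" "path_image p - {pos a, pos b} \<noteq> {}"
    "a \<in> set (bd f)" "b \<in> set (bd f)"
    by (rule ear_in_face[OF assms])
  have ab: "a \<noteq> b" using xs(2) by simp
  obtain A B where AB: "cyc adj (a # A @ b # B)" "cedges (bd f) = cedges (a # A @ b # B)" "set (bd f) = set (a # A @ b # B)"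
    by (rule cyc_split[OF FS(9)[OF f(1)] f(4,5) ab])
  define EA where "EA = pedges (a # A @ [b])"
  define EB where "EB = pedges (b # B @ [a])"
  define EP where "EP = pedges (a # I @ [b])"
  note parts = cyc_parts[OF AB(1)]
  have bdf: "cedges (bd f) = EA \<union> EB" using AB(2) cedges_two[of a A b B] by (simp add: EA_def EB_def)
  have EAB: "EA \<inter> EB = {}" using parts(5) by (simp add: EA_def EB_def)
  have EABD: "EA \<subseteq> D" "EB \<subseteq> D" using FS(10)[OF f(1)] bdf by simp_all
  have EPD: "EP \<inter> D = {}" using new by (simp add: EP_def)
  have EPe: "EP \<subseteq> edg" unfolding EP_def by (rule pedges_edg[OF xs(1)])
  have UA: "\<Union> EA = set (a # A @ [b])" and UB: "\<Union> EB = set (b # B @ [a])" and UP: "\<Union> EP = set (a # I @ [b])"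
    unfolding EA_def EB_def EP_def by (intro Union_pedges; simp)+
  have pint: "path_image p \<inter> dimg (cedges (a # A @ b # B)) = {pos a, pos b}"
  proof
    have "dimg (cedges (a # A @ b # B)) \<subseteq> dimg D" using FS(10)[OF f(1)] AB(2) by (auto simp: dimg_def)
    then show "path_image p \<inter> dimg (cedges (a # A @ b # B)) \<subseteq> {pos a, pos b}" using p(5) by blast
    have "cedges (a # A @ b # B) \<subseteq> edg" by (rule cedges_edg[OF AB(1)])
    moreover have "a \<in> V" "b \<in> V" using ends FS(2) edgV by blast+
    ultimately have "pos a \<in> dimg (cedges (a # A @ b # B))" "pos b \<in> dimg (cedges (a # A @ b # B))"
      unfolding dimg_vert card_cedges(2)[OF AB(1)] by (simp_all add: dimg_vert card_cedges(2)[OF AB(1)] del: Union_iff)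
    moreover have "{pos a, pos b} \<subseteq> path_image p" using p(5) by blast
    ultimately show "{pos a, pos b} \<subseteq> path_image p \<inter> dimg (cedges (a # A @ b # B))" by simp
  qed
  have ffr: "frontier f = dimg (cedges (a # A @ b # B))" using FS(11)[OF f(1)] AB(2) by simp
  obtain f1 f2 where g: "open f1" "open f2" "connected f1" "connected f2" "f1 \<noteq> {}" "f2 \<noteq> {}"
    "f1 \<inter> f2 = {}" "f1 \<union> f2 = f - path_image p"
    "frontier f1 = dimg (pedges (a # A @ [b])) \<union> path_image p"
    "frontier f2 = dimg (pedges (b # B @ [a])) \<union> path_image p"
    by (rule face_split[OF AB(1) FS(4)[OF f(1)] FS(5)[OF f(1)] FS(6)[OF f(1)] ffr p(1-3) f(2) pint])
  have f12: "f1 \<noteq> f2" using g(5,7) by (metis Int_absorb)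
  have notF: "g' \<notin> F" if "g' \<subseteq> f - path_image p" "g' \<noteq> {}" for g'
  proof
    assume "g' \<in> F"
    moreover have "g' \<noteq> f" using that(1) f(2,3) by blast
    ultimately have "g' \<inter> f = {}" using FS(7) f(1) by (auto simp: pairwise_def disjnt_def)
    then show False using that by blast
  qed
  have f1F: "f1 \<notin> F" and f2F: "f2 \<notin> F" using notF g(5,6,8) by (metis Un_upper1, metis Un_upper2)
  define F' where "F' = insert f1 (insert f2 (F - {f}))"
  define bd' where "bd' = bd(f1 := a # A @ b # rev I, f2 := b # B @ a # I)"
  have bd1: "bd' f1 = a # A @ b # rev I" and bd2: "bd' f2 = b # B @ a # I" using f12 by (simp_all add: bd'_def)
  have bdo: "bd' h = bd h" if "h \<in> F - {f}" for h using that f1F f2F by (auto simp: bd'_def)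
  have ce1: "cedges (bd' f1) = EA \<union> EP"
    unfolding bd1 cedges_two EA_def EP_def using pedges_rev[of "a # I @ [b]"] by simp
  have ce2: "cedges (bd' f2) = EB \<union> EP" unfolding bd2 cedges_two EB_def EP_def by simp
  have selF': "h = f1 \<or> h = f2 \<or> h \<in> F - {f}" if "h \<in> F'" for h using that by (simp add: F'_def)
  have dA: "distinct (a # A @ b # B)" using AB(1) by (simp add: cyc_def)
  have sets: "set A \<inter> set I = {}" "set B \<inter> set I = {}"
  proof -
    have "set A \<subseteq> \<Union> D" "set B \<subseteq> \<Union> D" using Union_mono[OF EABD(1)] Union_mono[OF EABD(2)] unfolding UA UB by auto
    then show "set A \<inter> set I = {}" "set B \<inter> set I = {}" using I by blast+
  qed
  have nonempty: "A \<noteq> [] \<or> I \<noteq> []" "B \<noteq> [] \<or> I \<noteq> []"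
  proof -
    show "A \<noteq> [] \<or> I \<noteq> []"
    proof (rule ccontr)
      assume "\<not> ?thesis"
      then have "{a,b} \<in> EA" "{a,b} \<in> EP" by (simp_all add: EA_def EP_def)
      then show False using EPD EABD by blast
    qed
    show "B \<noteq> [] \<or> I \<noteq> []"
    proof (rule ccontr)
      assume "\<not> ?thesis"
      then have "{a,b} \<in> EB" "{a,b} \<in> EP" by (simp_all add: EB_def EP_def insert_commute)
      then show False using EPD EABD by blast
    qed
  qed
  have revI: "successively adj (b # rev I @ [a])"
    using xs(1) sym successively_rev[of adj "a # I @ [b]"] by (auto elim: successively_mono)
  have c1: "cyc adj (a # A @ b # rev I)"
    unfolding cyc_def
  proof (intro conjI)
    show "3 \<le> length (a # A @ b # rev I)" using nonempty(1) by (cases A; cases I) auto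
    show "distinct (a # A @ b # rev I)" using dA xs(2) sets by auto
    have "successively adj ((a # A) @ b # (rev I @ [a]))"
      using parts(1) revI by (auto simp: successively_append_iff successively_Cons hd_append)
    then show "successively adj ((a # A @ b # rev I) @ [hd (a # A @ b # rev I)])" by simp
  qed
  have c2: "cyc adj (b # B @ a # I)"
    unfolding cyc_def
  proof (intro conjI)
    show "3 \<le> length (b # B @ a # I)" using nonempty(2) by (cases B; cases I) auto
    show "distinct (b # B @ a # I)" using dA xs(2) sets by auto
    have "successively adj ((b # B) @ a # (I @ [b]))"
      using parts(2) xs(1) by (auto simp: successively_append_iff successively_Cons hd_append)
    then show "successively adj ((b # B @ a # I) @ [hd (b # B @ a # I)])" by simp
  qed
  have crossing: "\<exists>h\<in>F'. \<exists>e\<in>X. \<exists>e'\<in>(D \<union> EP) - X. x \<in> e' \<and> e \<in> cedges (bd' h) \<and> e' \<in> cedges (bd' h)"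
    if X: "X \<subseteq> {e\<in>D \<union> EP. x \<in> e}" "X \<noteq> {}" "X \<noteq> {e\<in>D \<union> EP. x \<in> e}" for x X
  proof -
    have w1: ?thesis if "e \<in> X" "e' \<notin> X" "x \<in> e'" "e \<in> EA \<union> EP" "e' \<in> EA \<union> EP" for e e'
      using that EABD ce1 by (intro bexI[of _ f1] bexI[of _ e] bexI[of _ e']) (auto simp: F'_def)
    have w2: ?thesis if "e \<in> X" "e' \<notin> X" "x \<in> e'" "e \<in> EB \<union> EP" "e' \<in> EB \<union> EP" for e e'
      using that EABD ce2 by (intro bexI[of _ f2] bexI[of _ e] bexI[of _ e']) (auto simp: F'_def)
    have Xx: "x \<in> e" if "e \<in> X" for e using X(1) that by blast
    obtain e0 where e0: "e0 \<in> X" using X(2) by blast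
    have "\<exists>e1. e1 \<in> {e\<in>D \<union> EP. x \<in> e} - X" using X(1,3) by (metis Diff_eq_empty_iff all_not_in_conv subset_antisym)
    then obtain e1 where e1: "e1 \<in> D \<union> EP" "x \<in> e1" "e1 \<notin> X" by fast
    consider "x \<in> set I" | "x = a \<or> x = b" | "x \<notin> set (a # I @ [b])" by auto
    then show ?thesis
    proof cases
      case 1
      then have "x \<notin> \<Union> D" using I by blast
      then have "e0 \<in> EP" "e1 \<in> EP" using X(1) e0 e1 by blast+
      then show ?thesis using w1[OF e0 e1(3,2)] by simp
    next
      case 2
      obtain ea eb ep where E: "ea \<in> EA" "x \<in> ea" "eb \<in> EB" "x \<in> eb" "ep \<in> EP" "x \<in> ep"
      proof -
        have "x \<in> \<Union> EA" "x \<in> \<Union> EB" "x \<in> \<Union> EP" unfolding UA UB UP using 2 by auto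
        then show thesis using that by blast
      qed
      show ?thesis
      proof (rule ccontr)
        assume no: "\<not> ?thesis"
        \<comment> \<open>no face crosses \<open>X\<close>, so all boundary edges of the two new faces at \<open>x\<close> lie on the side of \<open>ep\<close>\<close>
        have same: "e \<in> X \<longleftrightarrow> ep \<in> X" if "e \<in> EA \<union> EB \<union> EP" "x \<in> e" for e
          using w1[of e ep] w1[of ep e] w2[of e ep] w2[of ep e] no that E by blast
        have "X \<inter> D \<noteq> {}"
        proof
          assume "X \<inter> D = {}"
          then have "e0 \<in> EP" "ea \<notin> X" using e0 X(1) E EABD by blast+
          then show False using same[of e0] same[of ea] e0 Xx E by blast
        qed
        moreover have "X \<inter> D \<noteq> {e\<in>D. x \<in> e}"
        proof
          assume XD: "X \<inter> D = {e\<in>D. x \<in> e}"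
          then have "e1 \<in> EP" "ea \<in> X" using e1 E EABD by blast+
          then show False using same[of e1] same[of ea] e1 E by blast
        qed
        moreover have "X \<inter> D \<subseteq> {e\<in>D. x \<in> e}" using Xx by blast
        ultimately obtain h e e' where h: "h \<in> F" "e \<in> X \<inter> D" "e' \<in> D - X \<inter> D" "x \<in> e'" "e \<in> cedges (bd h)" "e' \<in> cedges (bd h)"
          using FS(14)[of "X \<inter> D" x] by blast
        show False
        proof (cases "h = f")
          case True
          then show False using same[of e] same[of e'] h bdf Xx by blast
        next
          case False
          then have "h \<in> F'" "bd' h = bd h" using h(1) bdo[of h] by (simp_all add: F'_def)
          then show False using no h by (metis Diff_iff IntD1 IntD2 IntI UnI1)
        qed
      qed
    next
      case 3
      then have nx: "e \<notin> EP" if "x \<in> e" for e using UP that by blast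
      then have XD: "X \<subseteq> {e\<in>D. x \<in> e}" "X \<noteq> {e\<in>D. x \<in> e}" using X(1) e1 by blast+
      from FS(14)[OF XD(1) X(2) XD(2)] obtain h e e' where h: "h \<in> F" "e \<in> X" "e' \<in> D - X" "x \<in> e'" "e \<in> cedges (bd h)" "e' \<in> cedges (bd h)" by blast
      show ?thesis
      proof (cases "h = f")
        case True
        then have e: "e \<in> EA \<union> EB" "e' \<in> EA \<union> EB" using h bdf by auto
        have "\<not> (x \<in> set A \<and> x \<in> set B)" using dA by auto
        then have "e \<in> EA \<and> e' \<in> EA \<or> e \<in> EB \<and> e' \<in> EB"
          using e h(4) Xx[OF h(2)] UA UB 3 by auto
        then show ?thesis using w1[of e e'] w2[of e e'] h by auto
      next
        case False
        then show ?thesis using h bdo[of h] by (intro bexI[of _ h] bexI[of _ e] bexI[of _ e']) (auto simp: F'_def)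
      qed
    qed
  qed
  show ?thesis unfolding EP_def[symmetric]
  proof (intro exI[of _ F'] exI[of _ bd'] face_sysI)
    show "finite (D \<union> EP)" using FS(1) by (simp add: EP_def)
    show "D \<union> EP \<subseteq> edg" using FS(2) EPe by simp
    show "finite F'" using FS(3) by (simp add: F'_def)
    show "open h" if "h \<in> F'" for h using selF'[OF that] g(1,2) FS(4)[of h] by (elim disjE) simp_all
    show "connected h" if "h \<in> F'" for h using selF'[OF that] g(3,4) FS(5)[of h] by (elim disjE) simp_all
    show "h \<noteq> {}" if "h \<in> F'" for h using selF'[OF that] g(5,6) FS(6)[of h] by (elim disjE) simp_all
    have sub12: "f1 \<subseteq> f" "f2 \<subseteq> f" using g(8) by (metis Diff_subset Un_upper1 Un_upper2 order_trans)+
    have dj: "h \<inter> f = {}" if "h \<in> F - {f}" for h using FS(7) f(1) that by (auto simp: pairwise_def disjnt_def)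
    show "disjoint F'"
    proof (rule pairwiseI)
      fix h h' assume h: "h \<in> F'" "h' \<in> F'" "h \<noteq> h'"
      have d1: "k \<inter> f1 = {}" "k \<inter> f2 = {}" if "k \<in> F - {f}" for k using dj[OF that] sub12 by blast+
      have "h \<inter> h' = {}"
        using selF'[OF h(1)]
      proof (elim disjE)
        assume 1: "h = f1"
        show ?thesis using selF'[OF h(2)] h(3) g(7) d1[of h'] unfolding 1 by (elim disjE) (simp_all add: Int_commute)
      next
        assume 1: "h = f2"
        show ?thesis using selF'[OF h(2)] h(3) g(7) d1[of h'] unfolding 1 by (elim disjE) (simp_all add: Int_commute)
      next
        assume 1: "h \<in> F - {f}"
        show ?thesis using selF'[OF h(2)]
        proof (elim disjE)
          assume "h' \<in> F - {f}"
          then show ?thesis using 1 h(3) FS(7) by (auto simp: pairwise_def disjnt_def)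
        qed (use d1[OF 1] in simp_all)
      qed
      then show "disjnt h h'" by (simp add: disjnt_def)
    qed
    show "\<Union> F' = - dimg (D \<union> EP)"
    proof -
      have "\<Union> F' = (f - path_image p) \<union> \<Union> (F - {f})" unfolding F'_def using g(8) by auto
      also have "\<dots> = \<Union> F - path_image p"
      proof -
        have "\<Union> (F - {f}) \<inter> path_image p = {}"
        proof -
          have "\<Union> (F - {f}) \<inter> f = {}" using dj by blast
          moreover have "\<Union> (F - {f}) \<inter> dimg D = {}" using FS(8) by blast
          moreover have "path_image p \<subseteq> f \<union> dimg D" using f(2) p(5) by blast
          ultimately show ?thesis by blast
        qed
        then show ?thesis using f(1) by blast
      qed
      also have "\<dots> = - dimg (D \<union> EP)" unfolding FS(8) dimg_Un p(4) EP_def by blast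
      finally show ?thesis .
    qed
    show "cyc adj (bd' h)" if "h \<in> F'" for h
      using selF'[OF that] c1 c2 bd1 bd2 bdo[of h] FS(9)[of h] by (elim disjE) simp_all
    show "cedges (bd' h) \<subseteq> D \<union> EP" if "h \<in> F'" for h
      using selF'[OF that]
    proof (elim disjE)
      assume "h \<in> F - {f}" then show ?thesis using FS(10)[of h] bdo[of h] by auto
    qed (use ce1 ce2 EABD in auto)
    show "frontier h = dimg (cedges (bd' h))" if "h \<in> F'" for h
      using selF'[OF that]
    proof (elim disjE)
      assume "h = f1" then show ?thesis using g(9) p(4) by (simp only: ce1 dimg_Un EA_def EP_def)
    next
      assume "h = f2" then show ?thesis using g(10) p(4) by (simp only: ce2 dimg_Un EB_def EP_def)
    next
      assume "h \<in> F - {f}" then show ?thesis using FS(11)[of h] bdo[of h] by simp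
    qed
    show "card {h \<in> F'. e \<in> cedges (bd' h)} = 2" if e: "e \<in> D \<union> EP" for e
    proof -
      define R where "R = {h \<in> F - {f}. e \<in> cedges (bd h)}"
      have Rf: "finite R" "f \<notin> R" "f1 \<notin> R" "f2 \<notin> R" using FS(3) f1F f2F by (auto simp: R_def)
      have new: "{h \<in> F'. e \<in> cedges (bd' h)} = R \<union> (if e \<in> EA \<union> EP then {f1} else {}) \<union> (if e \<in> EB \<union> EP then {f2} else {})"
        (is "?l = ?r")
      proof (rule set_eqI)
        fix h
        consider "h = f1" | "h = f2" | "h \<noteq> f1" "h \<noteq> f2" "h \<in> F - {f}" | "h \<notin> F'" by (auto simp: F'_def)
        then show "h \<in> ?l \<longleftrightarrow> h \<in> ?r"
        proof cases
          case 1
          have "f1 \<in> F'" by (simp add: F'_def)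
          then show ?thesis unfolding 1 using ce1 Rf f12 by simp
        next
          case 2
          have "f2 \<in> F'" by (simp add: F'_def)
          then show ?thesis unfolding 2 using ce2 Rf f12 by simp
        next
          case 3
          have "h \<in> F'" using 3 by (simp add: F'_def)
          moreover have "h \<in> R \<longleftrightarrow> e \<in> cedges (bd' h)" using 3(3) bdo[OF 3(3)] by (simp add: R_def)
          ultimately show ?thesis using 3(1,2) by simp
        next
          case 4
          then have "h \<notin> R" "h \<noteq> f1" "h \<noteq> f2" by (auto simp: F'_def R_def)
          then show ?thesis using 4 by simp
        qed
      qed
      show ?thesis
      proof (cases "e \<in> EP")
        case True
        then have "R = {}" using FS(10) EPD unfolding R_def by blast
        then show ?thesis using new True f12 by simp
      next
        case False
        then have eD: "e \<in> D" using e by simp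
        have old: "{h \<in> F. e \<in> cedges (bd h)} = R \<union> (if e \<in> EA \<union> EB then {f} else {})"
          using f(1) bdf by (auto simp: R_def)
        show ?thesis using FS(12)[OF eD] old new False EAB Rf
          by (auto split: if_splits)
      qed
    qed
    show "card F' + card (\<Union> (D \<union> EP)) = card (D \<union> EP) + 2"
    proof -
      have "card F' = card F + 1" unfolding F'_def using FS(3) f(1) f1F f2F f12
        by (simp add: card_Diff_singleton) (metis Suc_pred card_gt_0_iff empty_iff)
      moreover have "card (D \<union> EP) = card D + (length I + 1)"
        using FS(1) EPD card_pedges[OF xs(2)] by (subst card_Un_disjoint) (auto simp: EP_def Int_commute)
      moreover have "card (\<Union> (D \<union> EP)) = card (\<Union> D) + length I"
      proof -
        have "\<Union> (D \<union> EP) = \<Union> D \<union> set I" using UP ends by auto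
        moreover have "finite (\<Union> D)"
        proof -
          have "finite e" if "e \<in> D" for e using that FS(2) edgE[of e] by (metis finite.emptyI finite_insert subsetD)
          then show ?thesis using FS(1) by blast
        qed
        moreover have "card (set I) = length I" using xs(2) by (simp add: distinct_card)
        ultimately show ?thesis using I by (simp add: card_Un_disjoint Int_commute)
      qed
      ultimately show ?thesis using FS(13) by linarith
    qed
    show "\<exists>h\<in>F'. \<exists>e\<in>X. \<exists>e'\<in>(D \<union> EP) - X. x \<in> e' \<and> e \<in> cedges (bd' h) \<and> e' \<in> cedges (bd' h)"
      if "X \<subseteq> {e\<in>D \<union> EP. x \<in> e}" "X \<noteq> {}" "X \<noteq> {e\<in>D \<union> EP. x \<in> e}" for x X
      by (rule crossing[OF that])
  qed
qed

end

section \<open>Ear decomposition of a 2-connected plane graph\<close>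

definition conn :: "('a \<Rightarrow> 'a \<Rightarrow> bool) \<Rightarrow> 'a set \<Rightarrow> bool" where
  "conn R A \<longleftrightarrow> (\<forall>B\<subseteq>A. B \<noteq> {} \<and> B \<noteq> A \<longrightarrow> (\<exists>x\<in>B. \<exists>y\<in>A - B. R x y))"

definition twoconn :: "('a \<Rightarrow> 'a \<Rightarrow> bool) \<Rightarrow> 'a set \<Rightarrow> bool" where
  "twoconn R A \<longleftrightarrow> finite A \<and> card A \<ge> 3 \<and> conn R A \<and> (\<forall>x\<in>A. conn R (A - {x}))"

definition edges :: "('a \<Rightarrow> 'a \<Rightarrow> bool) \<Rightarrow> 'a set \<Rightarrow> 'a set set" where
  "edges R U = {{x, y} |x y. x \<in> U \<and> y \<in> U \<and> R x y}"

lemma connD: "conn R A \<Longrightarrow> B \<subseteq> A \<Longrightarrow> B \<noteq> {} \<Longrightarrow> B \<noteq> A \<Longrightarrow> \<exists>x\<in>B. \<exists>y\<in>A - B. R x y"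
  unfolding conn_def by blast

text \<open>The set of vertices that \<open>a\<close> reaches outside \<open>B\<close> can only stop growing by an edge into \<open>B\<close>.\<close>

lemma path_to:
  assumes "conn R A" "a \<in> A" "a \<notin> B" "A \<inter> B \<noteq> {}"
  obtains xs w where "successively R (a # xs @ [w])" "distinct (a # xs)" "set (a # xs) \<subseteq> A - B" "w \<in> A \<inter> B"
proof -
  define W where "W = {last ys |ys. ys \<noteq> [] \<and> hd ys = a \<and> successively R ys \<and> distinct ys \<and> set ys \<subseteq> A - B}"
  have aW: "a \<in> W" unfolding W_def using assms by (intro CollectI exI[of _ "[a]"]) auto
  have WA: "W \<subseteq> A - B" unfolding W_def by (auto dest: last_in_set)
  have "W \<noteq> A" using WA assms(4) by blast
  then obtain v w where vw: "v \<in> W" "w \<in> A - W" "R v w" using connD[OF assms(1), of W] WA aW by blast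
  then obtain ys where ys: "v = last ys" "ys \<noteq> []" "hd ys = a" "successively R ys" "distinct ys" "set ys \<subseteq> A - B"
    by (auto simp: W_def)
  have suc: "successively R (ys @ [w])" using ys vw by (simp add: successively_append_iff)
  have "w \<notin> set ys"
  proof
    assume "w \<in> set ys"
    then obtain p s where ps: "ys = (p @ [w]) @ s" using split_list[of w ys] by auto
    have "successively R (p @ [w])" using ys(4) unfolding ps successively_append_iff by simp
    moreover have "distinct (p @ [w])" "set (p @ [w]) \<subseteq> A - B" using ys(5,6) unfolding ps by auto
    moreover have "hd (p @ [w]) = a" using ys(3) unfolding ps by (cases p) auto
    ultimately have "w \<in> W" unfolding W_def by (intro CollectI exI[of _ "p @ [w]"]) simp
    then show False using vw by simp
  qed
  have "w \<in> B"
  proof (rule ccontr)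
    assume "w \<notin> B"
    then have "w \<in> W" unfolding W_def using suc ys vw \<open>w \<notin> set ys\<close> by (intro CollectI exI[of _ "ys @ [w]"]) auto
    then show False using vw by simp
  qed
  then show thesis using that[of "tl ys" w] suc ys vw by (cases ys) auto
qed

lemma Union_edges:
  assumes "conn R A" "card A \<ge> 2" "\<And>x y. R x y \<Longrightarrow> R y x"
  shows "\<Union> (edges R A) = A"
proof
  show "\<Union> (edges R A) \<subseteq> A" by (auto simp: edges_def)
  show "A \<subseteq> \<Union> (edges R A)"
  proof
    fix x assume "x \<in> A"
    moreover have "{x} \<noteq> A" using assms(2) by auto
    ultimately show "x \<in> \<Union> (edges R A)" using connD[OF assms(1), of "{x}"] by (auto simp: edges_def)
  qed
qed

text \<open>Delete a vertex \<open>u\<close>: any two neighbours of \<open>u\<close> are still joined by a path, which \<open>u\<close> closes up.\<close>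

lemma twoconn_cycle:
  assumes tc: "twoconn R U" and sym: "\<And>x y. R x y \<Longrightarrow> R y x" and irr: "\<And>x. \<not> R x x"
  obtains vs where "cyc R vs" "set vs \<subseteq> U"
proof -
  have c: "card U \<ge> 3" "finite U" "conn R U" "\<And>x. x \<in> U \<Longrightarrow> conn R (U - {x})" using tc by (auto simp: twoconn_def)
  obtain u where u: "u \<in> U" using c(1) by fastforce
  have "{u} \<noteq> U" using c(1) by auto
  then obtain v where v: "v \<in> U" "v \<noteq> u" "R u v" using connD[OF c(3), of "{u}"] u by auto
  have "U - {v} \<noteq> {u}"
  proof
    assume "U - {v} = {u}"
    then have "U = {u, v}" using u v by blast
    then show False using c(1) by (metis card_2_iff le_numeral_extra(4) not_numeral_le_zero numeral_le_iff semiring_norm(72) Suc_1 eval_nat_numeral(3) not_less_eq_eq v(2))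
  qed
  then obtain w where w: "w \<in> U" "w \<noteq> v" "w \<noteq> u" "R u w" using connD[OF c(4)[OF v(1)], of "{u}"] u v by auto
  obtain xs z where xs: "successively R (w # xs @ [z])" "distinct (w # xs)" "set (w # xs) \<subseteq> U - {u} - {v}" "z \<in> (U - {u}) \<inter> {v}"
    using path_to[OF c(4)[OF u], of w "{v}"] w v by auto
  have "cyc R (u # w # xs @ [v])"
    unfolding cyc_def using xs w v u sym[OF v(3)] by (auto simp: successively_append_iff successively_Cons hd_append)
  moreover have "set (u # w # xs @ [v]) \<subseteq> U" using u v xs by auto
  ultimately show thesis using that by blast
qed

context plane_graph begin

text \<open>If a missing edge joins two vertices of \<open>D\<close>, it is an ear. Otherwise some edge leaves the vertices of \<open>D\<close> at \<open>x\<close>; as \<open>x\<close> is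
not a cut vertex, its other end is joined to \<open>D\<close> by a path that avoids \<open>x\<close>.\<close>

lemma ear_exists:
  assumes tc: "twoconn adj U" and D: "D \<subseteq> edges adj U" "D \<noteq> edges adj U" and c3: "card (\<Union> D) \<ge> 3"
  obtains a I b where "successively adj (a # I @ [b])" "distinct (a # I @ [b])" "a \<in> \<Union> D" "b \<in> \<Union> D"
    "set I \<inter> \<Union> D = {}" "pedges (a # I @ [b]) \<inter> D = {}" "set (a # I @ [b]) \<subseteq> U"
proof -
  define X where "X = \<Union> D"
  have c: "finite U" "conn adj U" "\<And>x. x \<in> U \<Longrightarrow> conn adj (U - {x})" using tc by (auto simp: twoconn_def)
  have XU: "X \<subseteq> U" using D(1) by (auto simp: X_def edges_def)
  show thesis
  proof (cases "\<exists>u v. u \<in> X \<and> v \<in> X \<and> adj u v \<and> {u, v} \<notin> D")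
    case True
    then obtain u v where uv: "u \<in> X" "v \<in> X" "adj u v" "{u, v} \<notin> D" by blast
    moreover have "u \<noteq> v" using uv irr by auto
    ultimately show thesis using that[of u "[]" v] XU by (auto simp: X_def)
  next
    case False
    have "X \<noteq> U"
    proof
      assume "X = U"
      then have "edges adj U \<subseteq> D" using False by (auto simp: edges_def)
      then show False using D by blast
    qed
    moreover have "X \<noteq> {}" using c3 unfolding X_def by (metis card.empty not_numeral_le_zero)
    ultimately obtain x y where xy: "x \<in> X" "y \<in> U - X" "adj x y" using connD[OF c(2) XU] by blast
    have "X - {x} \<noteq> {}"
    proof
      assume "X - {x} = {}"
      then have "X = {x}" using xy(1) by blast
      then show False using c3 by (simp add: X_def)
    qed
    then have ne: "(U - {x}) \<inter> (X - {x}) \<noteq> {}" using XU by blast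
    have xU: "x \<in> U" using xy XU by blast
    obtain xs w where p: "successively adj (y # xs @ [w])" "distinct (y # xs)" "set (y # xs) \<subseteq> (U - {x}) - (X - {x})" "w \<in> (U - {x}) \<inter> (X - {x})"
      using path_to[OF c(3)[OF xU] _ _ ne, of y] xy by blast
    let ?I = "y # xs"
    have 1: "successively adj (x # ?I @ [w])" using p(1) xy(3) by simp
    have 2: "distinct (x # ?I @ [w])" using p by auto
    have 3: "set ?I \<inter> X = {}" using p(3) by auto
    have 4: "pedges (x # ?I @ [w]) \<inter> D = {}"
    proof (rule ccontr)
      assume "\<not> ?thesis"
      then obtain e where e: "e \<in> pedges (x # ?I @ [w])" "e \<in> D" by blast
      then have "e \<subseteq> X" "e \<subseteq> set (x # ?I @ [w])" using pedges_sub[OF e(1)] by (auto simp: X_def)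
      then have "e \<subseteq> {x, w}" using 3 by auto
      moreover obtain u v where "e = {u, v}" "u \<noteq> v" using pedges_two[OF e(1) 2] by blast
      ultimately have "e = {x, w}" by auto
      then show False using pedges_ends[of x w ?I] e(1) 2 by simp
    qed
    have "set (x # ?I @ [w]) \<subseteq> U" using xU p by auto
    then show thesis using that[OF 1 2] 3 4 xy(1) p(4) by (auto simp: X_def)
  qed
qed

lemma face_sys_exists:
  assumes tc: "twoconn adj U"
  shows "\<exists>F bd. face_sys (edges adj U) F bd"
proof -
  obtain vs where vs: "cyc adj vs" "set vs \<subseteq> U" using twoconn_cycle[OF tc sym irr] by blast
  define ok where "ok = (\<lambda>D. D \<subseteq> edges adj U \<and> card (\<Union> D) \<ge> 3 \<and> (\<exists>F bd. face_sys D F bd))"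
  have fU: "finite U" using tc by (simp add: twoconn_def)
  have fin: "finite (edges adj U)" by (rule finite_subset[of _ "Pow U"]) (auto simp: edges_def fU)
  have sub: "e \<in> edges adj U" if "e \<subseteq> U" "e = {u, v}" "adj u v" for e u v
    using that by (auto simp: edges_def)
  have "ok (cedges vs)"
  proof -
    have "cedges vs \<subseteq> edges adj U"
    proof
      fix e assume e: "e \<in> cedges vs"
      then have "e \<subseteq> U" using card_cedges(2)[OF vs(1)] vs(2) by blast
      then show "e \<in> edges adj U" using cedges_edge[OF vs(1) e] sub by blast
    qed
    then show ?thesis unfolding ok_def using face_sys_cycle[OF vs(1)] card_cedges(2)[OF vs(1)] vs(1)
      by (simp add: cyc_def distinct_card)
  qed
  moreover have "\<forall>D. ok D \<longrightarrow> card D \<le> card (edges adj U)" using fin by (auto simp: ok_def card_mono)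
  ultimately obtain D where D: "ok D" "\<And>D'. ok D' \<Longrightarrow> card D' \<le> card D"
    using ex_has_greatest_nat[of ok "cedges vs" card "Suc (card (edges adj U))"] by (auto simp: less_Suc_eq_le)
  have "D = edges adj U"
  proof (rule ccontr)
    assume ne: "D \<noteq> edges adj U"
    obtain F bd where fs: "face_sys D F bd" using D(1) by (auto simp: ok_def)
    obtain a I b where ear: "successively adj (a # I @ [b])" "distinct (a # I @ [b])" "a \<in> \<Union> D" "b \<in> \<Union> D"
      "set I \<inter> \<Union> D = {}" "pedges (a # I @ [b]) \<inter> D = {}" "set (a # I @ [b]) \<subseteq> U"
      by (rule ear_exists[OF tc _ ne]) (use D(1) in \<open>auto simp: ok_def\<close>)
    let ?E = "pedges (a # I @ [b])"
    have E: "?E \<subseteq> edges adj U"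
    proof
      fix e assume e: "e \<in> ?E"
      then have "e \<subseteq> U" using pedges_sub ear(7) by blast
      then show "e \<in> edges adj U" using pedges_edge[OF e ear(1)] sub by blast
    qed
    have finD: "finite (D \<union> ?E)" using finite_subset[OF _ fin] D(1) E by (auto simp: ok_def)
    have "\<Union> (D \<union> ?E) \<subseteq> U" using D(1) E by (auto simp: ok_def edges_def)
    then have "card (\<Union> D) \<le> card (\<Union> (D \<union> ?E))" by (intro card_mono finite_subset[OF _ fU]) auto
    then have "ok (D \<union> ?E)" using D(1) E face_sys_ear[OF fs ear(1-6)] by (auto simp: ok_def)
    then have "card (D \<union> ?E) \<le> card D" by (rule D(2))
    moreover have "card (D \<union> ?E) = card D + card ?E"
      using finD ear(6) by (intro card_Un_disjoint) (auto simp: Int_commute)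
    moreover have "card ?E = length I + 1" using card_pedges[OF ear(2)] by simp
    ultimately show False by simp
  qed
  then show ?thesis using D(1) by (auto simp: ok_def)
qed

end

section \<open>Telling vertices which colours to avoid\<close>

lemma hall_marriage:
  fixes A :: "'i \<Rightarrow> 'v set"
  assumes "finite I" "\<And>i. i \<in> I \<Longrightarrow> finite (A i)" "\<And>J. J \<subseteq> I \<Longrightarrow> card J \<le> card (\<Union> (A ` J))"
  shows "\<exists>f. inj_on f I \<and> (\<forall>i\<in>I. f i \<in> A i)"
  using assms
proof (induction "card I" arbitrary: I A rule: less_induct)
  case less
  note fin = less.prems(1,2) and cond = less.prems(3)
  have finU: "finite (\<Union> (A ` J))" if "J \<subseteq> I" for J
    using that fin finite_subset[OF that fin(1)] by blast
  show ?case
  proof (cases "I = {}")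
    case False
    show ?thesis
    proof (cases "\<forall>J. J \<subseteq> I \<and> J \<noteq> {} \<and> J \<noteq> I \<longrightarrow> card J < card (\<Union> (A ` J))")
      case True
      obtain i where i: "i \<in> I" using False by blast
      have "A i \<noteq> {}" using cond[of "{i}"] i by auto
      then obtain x where x: "x \<in> A i" by blast
      have "\<exists>f. inj_on f (I - {i}) \<and> (\<forall>j\<in>I - {i}. f j \<in> A j - {x})"
      proof (rule less.hyps)
        show "card (I - {i}) < card I" using i fin(1) by (meson card_Diff1_less)
        show "finite (I - {i})" using fin(1) by simp
        show "finite (A j - {x})" if "j \<in> I - {i}" for j using fin(2) that by simp
        fix J assume J: "J \<subseteq> I - {i}"
        show "card J \<le> card (\<Union>j\<in>J. A j - {x})"
        proof (cases "J = {}")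
          case False
          then have "card J < card (\<Union> (A ` J))" using True J i by blast
          moreover have "(\<Union>j\<in>J. A j - {x}) = \<Union> (A ` J) - {x}" by blast
          moreover have "card (\<Union> (A ` J)) - 1 \<le> card (\<Union> (A ` J) - {x})"
            using finU[of J] J by (simp add: card_Diff_singleton_if)
          ultimately show ?thesis by simp
        qed simp
      qed
      then obtain f where "inj_on f (I - {i})" "\<forall>j\<in>I - {i}. f j \<in> A j - {x}" by blast
      then show ?thesis using i x
        by (intro exI[of _ "f(i := x)"]) (auto simp: inj_on_def)
    next
      case False
      then obtain J where J: "J \<subseteq> I" "J \<noteq> {}" "J \<noteq> I" "card (\<Union> (A ` J)) \<le> card J" by (auto simp: not_less)
      have finJ: "finite J" using J fin finite_subset by blast
      have cJ: "card J < card I" using J fin by (meson psubset_card_mono psubsetI)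
      have "\<exists>f. inj_on f J \<and> (\<forall>i\<in>J. f i \<in> A i)"
      proof (rule less.hyps[OF cJ finJ])
        show "finite (A i)" if "i \<in> J" for i using fin(2) J(1) that by blast
        show "card K \<le> card (\<Union> (A ` K))" if "K \<subseteq> J" for K using cond[of K] J(1) that by blast
      qed
      then obtain f where f: "inj_on f J" "\<forall>i\<in>J. f i \<in> A i" by blast
      have "\<exists>g. inj_on g (I - J) \<and> (\<forall>i\<in>I - J. g i \<in> A i - \<Union> (A ` J))"
      proof (rule less.hyps)
        show "card (I - J) < card I" by (rule psubset_card_mono) (use J fin in auto)
        show "finite (I - J)" using fin by simp
        show "finite (A i - \<Union> (A ` J))" if "i \<in> I - J" for i using fin(2) that by simp
        fix K assume K: "K \<subseteq> I - J"
        have "card (K \<union> J) \<le> card (\<Union> (A ` (K \<union> J)))" using K J by (intro cond) blast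
        moreover have "card (K \<union> J) = card K + card J"
          using K finJ finite_subset[OF K] fin(1) by (intro card_Un_disjoint) auto
        moreover have "card (\<Union> (A ` (K \<union> J))) \<le> card (\<Union>i\<in>K. A i - \<Union> (A ` J)) + card (\<Union> (A ` J))"
        proof -
          have "\<Union> (A ` (K \<union> J)) = (\<Union>i\<in>K. A i - \<Union> (A ` J)) \<union> \<Union> (A ` J)" by blast
          then show ?thesis by (simp only: card_Un_le)
        qed
        ultimately show "card K \<le> card (\<Union>i\<in>K. A i - \<Union> (A ` J))" using J(4) by linarith
      qed
      then obtain g where g: "inj_on g (I - J)" "\<forall>i\<in>I - J. g i \<in> A i - \<Union> (A ` J)" by blast
      have "inj_on (\<lambda>i. if i \<in> J then f i else g i) I"
        using f g unfolding inj_on_def by (smt (verit, best) DiffE DiffI UN_I)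
      then show ?thesis using f g by (intro exI[of _ "\<lambda>i. if i \<in> J then f i else g i"]) auto
    qed
  qed simp
qed

text \<open>Each \<open>T\<close> tells each \<open>v \<in> N T\<close> at most one colour \<open>t \<sigma> T v\<close> to avoid, depending on an orientation \<open>\<sigma>\<close>; the sets \<open>s v\<close> are
avoided in any case. With at most two forbidden colours at every vertex a colouring \<open>\<phi>\<close> exists for any choice
of orientations; what must be excluded is that all vertices of some \<open>N T\<close> take their colour in \<open>\<delta> T\<close>.

Choose the orientations so that the total number of available colours is maximal. If every vertex of \<open>N T\<close> with
a single available colour has it in \<open>\<delta> T\<close>, then \<open>N T\<close> has at least two loose vertices, with two or more available
colours: reversing \<open>T\<close> releases at each vertex the colour told so far and forbids another one, so that each tight
vertex would gain a colour while each loose one loses at most one. A vertex is in at most two of the sets \<open>N T\<close>, so by Hall's theorem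
each such \<open>T\<close> gets a loose vertex of its own, which escapes from \<open>\<delta> T\<close>.\<close>

lemma orient_tells:
  fixes N :: "'t \<Rightarrow> 'v set" and L s :: "'v \<Rightarrow> 'c set" and t :: "bool \<Rightarrow> 't \<Rightarrow> 'v \<Rightarrow> 'c set" and \<delta> :: "'t \<Rightarrow> 'v \<Rightarrow> 'c set"
  assumes fin: "finite \<T>" "finite W"
    and N: "\<And>T. T \<in> \<T> \<Longrightarrow> N T \<subseteq> W" "\<And>T. T \<in> \<T> \<Longrightarrow> N T \<noteq> {}"
    and L: "\<And>v. v \<in> W \<Longrightarrow> card (L v) = 3"
    and s: "\<And>v. v \<in> W \<Longrightarrow> finite (s v)" "\<And>v. v \<in> W \<Longrightarrow> card (s v) + card {T\<in>\<T>. v \<in> N T} \<le> 2"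
    and t: "\<And>\<sigma> T v. T \<in> \<T> \<Longrightarrow> v \<in> N T \<Longrightarrow> finite (t \<sigma> T v) \<and> card (t \<sigma> T v) \<le> 1"
    and d: "\<And>T v. T \<in> \<T> \<Longrightarrow> v \<in> N T \<Longrightarrow> finite (\<delta> T v) \<and> card (\<delta> T v) \<le> 1"
    and flex: "\<And>T. T \<in> \<T> \<Longrightarrow> (\<forall>v\<in>N T. \<delta> T v = {}) \<or>
      card (N T) = 3 \<and> (\<forall>v\<in>N T. L v = t False T v \<union> t True T v \<union> \<delta> T v)"
  shows "\<exists>\<sigma> \<phi>. (\<forall>v\<in>W. \<phi> v \<in> L v \<and> \<phi> v \<notin> s v \<and> (\<forall>T\<in>\<T>. v \<in> N T \<longrightarrow> \<phi> v \<notin> t (\<sigma> T) T v)) \<and>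
    (\<forall>T\<in>\<T>. \<exists>v\<in>N T. \<phi> v \<notin> \<delta> T v)"
proof -
  define Av where "Av = (\<lambda>\<sigma> v. L v - s v - (\<Union>T\<in>{T\<in>\<T>. v \<in> N T}. t (\<sigma> T) T v))"
  have finL: "finite (L v)" if "v \<in> W" for v using L[OF that] by (metis card.infinite zero_neq_numeral)
  have finAv: "finite (Av \<sigma> v)" if "v \<in> W" for \<sigma> v using finL[OF that] by (simp add: Av_def)
  have told: "finite (\<Union>T\<in>R. t (\<sigma> T) T v)" "card (\<Union>T\<in>R. t (\<sigma> T) T v) \<le> card R"
    if "R \<subseteq> {T\<in>\<T>. v \<in> N T}" for R \<sigma> v
  proof -
    have R: "finite R" using that fin(1) finite_subset by fastforce
    show "finite (\<Union>T\<in>R. t (\<sigma> T) T v)" using R that t by blast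
    have "card (\<Union>T\<in>R. t (\<sigma> T) T v) \<le> (\<Sum>T\<in>R. card (t (\<sigma> T) T v))" using R by (rule card_UN_le)
    also have "\<dots> \<le> (\<Sum>T\<in>R. 1)" using that t by (intro sum_mono) blast
    finally show "card (\<Union>T\<in>R. t (\<sigma> T) T v) \<le> card R" by simp
  qed
  have Av1: "card (Av \<sigma> v) \<ge> 1" if v: "v \<in> W" for \<sigma> v
  proof -
    let ?R = "{T\<in>\<T>. v \<in> N T}"
    have "card (s v \<union> (\<Union>T\<in>?R. t (\<sigma> T) T v)) \<le> 2"
      using card_Un_le[of "s v" "\<Union>T\<in>?R. t (\<sigma> T) T v"] told(2)[of ?R v \<sigma>] s(2)[OF v] by simp
    moreover have "Av \<sigma> v = L v - (s v \<union> (\<Union>T\<in>?R. t (\<sigma> T) T v))" by (auto simp: Av_def)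
    moreover have "finite (s v \<union> (\<Union>T\<in>?R. t (\<sigma> T) T v))" using s(1)[OF v] told(1)[of ?R v \<sigma>] by simp
    ultimately have "card (L v) - card (s v \<union> (\<Union>T\<in>?R. t (\<sigma> T) T v)) \<le> card (Av \<sigma> v)"
      using diff_card_le_card_Diff[of "s v \<union> (\<Union>T\<in>?R. t (\<sigma> T) T v)" "L v"] by (simp only:)
    then show ?thesis using \<open>card (s v \<union> _) \<le> 2\<close> L[OF v] by linarith
  qed
  define total where "total = (\<lambda>\<sigma>. \<Sum>v\<in>W. card (Av \<sigma> v))"
  have "total \<sigma> \<le> 3 * card W" for \<sigma>
  proof -
    have "total \<sigma> \<le> (\<Sum>v\<in>W. 3)" unfolding total_def
    proof (rule sum_mono)
      fix v assume v: "v \<in> W"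
      have "card (Av \<sigma> v) \<le> card (L v)" by (rule card_mono[OF finL[OF v]]) (simp add: Av_def Diff_subset subset_iff)
      then show "card (Av \<sigma> v) \<le> 3" using L[OF v] by simp
    qed
    then show ?thesis by simp
  qed
  then obtain \<sigma> where \<sigma>: "\<And>\<sigma>'. total \<sigma>' \<le> total \<sigma>"
    using ex_has_greatest_nat[of "\<lambda>_. True" undefined total "Suc (3 * card W)"] by (auto simp: less_Suc_eq_le)
  define loose where "loose = (\<lambda>v. card (Av \<sigma> v) \<ge> 2)"
  define \<B> where "\<B> = {T\<in>\<T>. (\<exists>v\<in>N T. \<delta> T v \<noteq> {}) \<and> (\<forall>v\<in>N T. \<not> loose v \<longrightarrow> Av \<sigma> v \<subseteq> \<delta> T v)}"
  define A where "A = (\<lambda>T. {v\<in>N T. loose v})"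
  have finB: "finite \<B>" using fin(1) by (simp add: \<B>_def)
  have finN: "finite (N T)" if "T \<in> \<T>" for T using N(1)[OF that] fin(2) finite_subset by blast
  have many: "card (A T) \<ge> 2" if T: "T \<in> \<B>" for T
    \<comment> \<open>otherwise reversing the orientation of \<open>T\<close> would leave more available colours\<close>
  proof (rule ccontr)
    assume few: "\<not> card (A T) \<ge> 2"
    have TT: "T \<in> \<T>" using T by (simp add: \<B>_def)
    have tight: "Av \<sigma> v \<subseteq> \<delta> T v" if "v \<in> N T" "\<not> loose v" for v using T that by (auto simp: \<B>_def)
    show False
    proof -
      have "\<not> (\<forall>v\<in>N T. \<delta> T v = {})" using T by (auto simp: \<B>_def)
      then have c3: "card (N T) = 3" and Lv: "\<And>v. v \<in> N T \<Longrightarrow> L v = t False T v \<union> t True T v \<union> \<delta> T v"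
        using flex[OF TT] by auto
      define \<sigma>' where "\<sigma>' = \<sigma>(T := \<not> \<sigma> T)"
      have other: "Av \<sigma>' v = Av \<sigma> v" if "v \<in> W - N T" for v
      proof -
        have "t (\<sigma>' T') T' v = t (\<sigma> T') T' v" if "T' \<in> {T'\<in>\<T>. v \<in> N T'}" for T'
          using that \<open>v \<in> W - N T\<close> by (cases "T' = T") (simp_all add: \<sigma>'_def)
        then show ?thesis by (simp add: Av_def)
      qed
      have gain: "int (card (Av \<sigma>' v)) - int (card (Av \<sigma> v)) \<ge> (if loose v then - 1 else 1)" if v: "v \<in> N T" for v
      proof -
        have vW: "v \<in> W" using v N(1)[OF TT] by blast
        define R where "R = {T'\<in>\<T>. v \<in> N T'} - {T}"
        define O' where "O' = s v \<union> (\<Union>T'\<in>R. t (\<sigma> T') T' v)"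
        have RT: "{T'\<in>\<T>. v \<in> N T'} = insert T R" using TT v by (auto simp: R_def)
        have cR: "card {T'\<in>\<T>. v \<in> N T'} = Suc (card R)"
          unfolding RT using fin(1) by (subst card_insert_disjoint) (auto simp: R_def)
        have O1: "finite O'" "card O' \<le> 1"
          unfolding O'_def using told[of R v \<sigma>] s[OF vW] cR card_Un_le[of "s v" "\<Union>T'\<in>R. t (\<sigma> T') T' v"]
          by (auto simp: R_def)
        have a: "Av \<sigma> v = L v - O' - t (\<sigma> T) T v" unfolding Av_def RT O'_def by auto
        have "(\<Union>T'\<in>R. t (\<sigma>' T') T' v) = (\<Union>T'\<in>R. t (\<sigma> T') T' v)" by (auto simp: R_def \<sigma>'_def)
        then have a': "Av \<sigma>' v = L v - O' - t (\<not> \<sigma> T) T v" unfolding Av_def RT O'_def by (auto simp: \<sigma>'_def)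
        have ft: "finite (t \<tau> T v)" "card (t \<tau> T v) \<le> 1" for \<tau> using t[OF TT v] by auto
        have fd: "finite (\<delta> T v)" "card (\<delta> T v) \<le> 1" using d[OF TT v] by auto
        have L3: "L v = t (\<sigma> T) T v \<union> t (\<not> \<sigma> T) T v \<union> \<delta> T v" using Lv[OF v] by (cases "\<sigma> T") auto
        have c: "card (L v) = 3" using L[OF vW] .
        have u1: "card (L v) \<le> card (t (\<sigma> T) T v \<union> t (\<not> \<sigma> T) T v) + card (\<delta> T v)" unfolding L3 by (rule card_Un_le)
        have u2: "card (t (\<sigma> T) T v \<union> t (\<not> \<sigma> T) T v) \<le> card (t (\<sigma> T) T v) + card (t (\<not> \<sigma> T) T v)" by (rule card_Un_le)
        have one: "card (t (\<sigma> T) T v) = 1" "card (t (\<not> \<sigma> T) T v) = 1" "card (\<delta> T v) = 1"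
          using u1 u2 c ft[of "\<sigma> T"] ft[of "\<not> \<sigma> T"] fd by linarith+
        then obtain x y z where xyz: "t (\<sigma> T) T v = {x}" "t (\<not> \<sigma> T) T v = {y}" "\<delta> T v = {z}"
          by (auto simp: card_1_singleton_iff)
        have dist: "x \<noteq> y" "x \<noteq> z" "y \<noteq> z" using c unfolding L3 xyz by (auto simp: card_insert_if split: if_splits)
        have Lxyz: "L v = {x, y, z}" using L3 xyz by auto
        show ?thesis
        proof (cases "loose v")
          case True
          have "card (Av \<sigma> v) \<le> card ({y, z})" unfolding a xyz Lxyz by (intro card_mono) auto
          then have "card (Av \<sigma> v) \<le> 2" using dist by simp
          moreover have "card (Av \<sigma>' v) \<ge> 1" by (rule Av1[OF vW])
          ultimately show ?thesis using True by simp
        next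
          case False
          then have "L v - O' - {x} \<subseteq> {z}" using tight[OF v] a xyz by auto
          then have "y \<in> O'" using dist Lxyz by auto
          then have "O' = {y}" using O1 by (metis card_1_singletonE card_0_eq empty_iff le_SucE le_zero_eq One_nat_def singletonD)
          then have "Av \<sigma> v = {z}" "Av \<sigma>' v = {x, z}" unfolding a a' xyz Lxyz using dist by auto
          then show ?thesis using False dist by simp
        qed
      qed
      have sub: "N T \<subseteq> W" using N(1)[OF TT] .
      have eq1: "int (total \<sigma>') - int (total \<sigma>) = (\<Sum>v\<in>W. int (card (Av \<sigma>' v)) - int (card (Av \<sigma> v)))"
        by (simp add: total_def sum_subtractf)
      have eq2: "(\<Sum>v\<in>W. int (card (Av \<sigma>' v)) - int (card (Av \<sigma> v))) = (\<Sum>v\<in>N T. int (card (Av \<sigma>' v)) - int (card (Av \<sigma> v)))"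
        using other fin(2) sub by (intro sum.mono_neutral_right) auto
      have "(\<Sum>v\<in>N T. int (card (Av \<sigma>' v)) - int (card (Av \<sigma> v))) \<ge> (\<Sum>v\<in>N T. if loose v then - 1 else 1)"
        by (intro sum_mono gain)
      moreover have "(\<Sum>v\<in>N T. if loose v then - 1 else (1::int)) = int (card (N T - A T)) - int (card (A T))"
      proof -
        have "(\<Sum>v\<in>N T. if loose v then - 1 else (1::int)) = (\<Sum>v\<in>N T \<inter> {v. loose v}. - 1) + (\<Sum>v\<in>N T \<inter> - {v. loose v}. 1)"
          using sum.If_cases[OF finN[OF TT], of loose "\<lambda>_. - 1 :: int" "\<lambda>_. 1"] by simp
        moreover have "N T \<inter> {v. loose v} = A T" "N T \<inter> - {v. loose v} = N T - A T" by (auto simp: A_def)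
        ultimately show ?thesis by simp
      qed
      moreover have "card (N T - A T) + card (A T) = 3"
        using c3 finN[OF TT] by (metis A_def add.commute card_Diff_subset card_mono finite_subset le_add_diff_inverse mem_Collect_eq subsetI)
      ultimately have "int (total \<sigma>') > int (total \<sigma>)" using few eq1 eq2 by linarith
      then show False using \<sigma>[of \<sigma>'] by simp
    qed
  qed
  have "\<exists>f. inj_on f \<B> \<and> (\<forall>T\<in>\<B>. f T \<in> A T)"
  proof (rule hall_marriage[OF finB])
    show "finite (A T)" if "T \<in> \<B>" for T using that finN by (auto simp: A_def \<B>_def)
    fix X assume X: "X \<subseteq> \<B>"
    have finX: "finite X" using X finB finite_subset by blast
    have finA: "finite (A T)" if "T \<in> X" for T using that X finN by (auto simp: A_def \<B>_def)
    have "2 * card X = (\<Sum>T\<in>X. 2)" by simp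
    also have "\<dots> \<le> (\<Sum>T\<in>X. card (A T))" using X many by (intro sum_mono) blast
    also have "\<dots> = card (Sigma X A)" using finX finA by (simp add: card_SigmaI)
    also have "\<dots> = card (\<Union>v\<in>\<Union> (A ` X). {T\<in>X. v \<in> A T} \<times> {v})" by (rule arg_cong[of _ _ card]) auto
    also have "\<dots> \<le> (\<Sum>v\<in>\<Union> (A ` X). card ({T\<in>X. v \<in> A T} \<times> {v}))" using finX finA by (intro card_UN_le) blast
    also have "\<dots> \<le> (\<Sum>v\<in>\<Union> (A ` X). 2)"
    proof (rule sum_mono)
      fix v assume "v \<in> \<Union> (A ` X)"
      then obtain T where "T \<in> X" "v \<in> N T" by (auto simp: A_def)
      moreover from this have "T \<in> \<T>" using X by (auto simp: \<B>_def)
      ultimately have "v \<in> W" using N(1) by blast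
      have "card {T\<in>X. v \<in> A T} \<le> card {T\<in>\<T>. v \<in> N T}"
        using X fin(1) by (intro card_mono) (auto simp: A_def \<B>_def)
      then show "card ({T\<in>X. v \<in> A T} \<times> {v}) \<le> 2" using s(2)[OF \<open>v \<in> W\<close>] by (simp add: card_cartesian_product)
    qed
    finally show "card X \<le> card (\<Union> (A ` X))" by simp
  qed
  then obtain f where f: "inj_on f \<B>" "\<And>T. T \<in> \<B> \<Longrightarrow> f T \<in> A T" by blast
  have "\<exists>x. x \<in> Av \<sigma> v \<and> (\<forall>T\<in>\<B>. f T = v \<longrightarrow> x \<notin> \<delta> T v)" if v: "v \<in> W" for v
  proof (cases "\<exists>T\<in>\<B>. f T = v")
    case True
    then obtain T where T: "T \<in> \<B>" "f T = v" by blast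
    then have "v \<in> N T" "card (Av \<sigma> v) \<ge> 2" using f(2)[OF T(1)] by (auto simp: A_def loose_def)
    then have "card (\<delta> T v) < card (Av \<sigma> v)" "finite (\<delta> T v)" using d[of T v] T by (auto simp: \<B>_def)
    then have "\<not> Av \<sigma> v \<subseteq> \<delta> T v" using card_mono leD by blast
    then obtain x where "x \<in> Av \<sigma> v" "x \<notin> \<delta> T v" by blast
    moreover have "T' = T" if "T' \<in> \<B>" "f T' = v" for T' using that T f(1) by (auto dest: inj_onD)
    ultimately show ?thesis by blast
  next
    case False
    have "Av \<sigma> v \<noteq> {}" using Av1[OF v, of \<sigma>] by auto
    then show ?thesis using False by blast
  qed
  then obtain \<phi> where \<phi>: "\<And>v. v \<in> W \<Longrightarrow> \<phi> v \<in> Av \<sigma> v \<and> (\<forall>T\<in>\<B>. f T = v \<longrightarrow> \<phi> v \<notin> \<delta> T v)" by metis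
  have "\<exists>v\<in>N T. \<phi> v \<notin> \<delta> T v" if T: "T \<in> \<T>" for T
  proof (cases "T \<in> \<B>")
    case True
    then have "f T \<in> N T" using f(2) by (auto simp: A_def)
    then show ?thesis using \<phi>[of "f T"] N(1)[OF T] True by blast
  next
    case False
    show ?thesis
    proof (cases "\<forall>v\<in>N T. \<delta> T v = {}")
      case True
      then show ?thesis using N(2)[OF T] by blast
    next
      case ne: False
      obtain v where v: "v \<in> N T" "\<not> loose v" "\<not> Av \<sigma> v \<subseteq> \<delta> T v" using T False ne by (auto simp: \<B>_def)
    then have vW: "v \<in> W" using N(1)[OF T] by blast
    have "card (Av \<sigma> v) = 1" using v(2) Av1[OF vW, of \<sigma>] by (simp add: loose_def)
    then obtain x where "Av \<sigma> v = {x}" by (auto simp: card_1_singleton_iff)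
    then show ?thesis using v \<phi>[OF vW] by auto
    qed
  qed
  moreover have "\<forall>v\<in>W. \<phi> v \<in> L v \<and> \<phi> v \<notin> s v \<and> (\<forall>T\<in>\<T>. v \<in> N T \<longrightarrow> \<phi> v \<notin> t (\<sigma> T) T v)"
    using \<phi> by (auto simp: Av_def)
  ultimately show ?thesis by blast
qed

lemma card_le_1_eq: "finite X \<Longrightarrow> card X \<le> 1 \<Longrightarrow> x \<in> X \<Longrightarrow> y \<in> X \<Longrightarrow> x = y"
  by (auto simp: card_le_Suc0_iff_eq)

lemma card3_ex:
  assumes "card X = 3" "p \<notin> X \<or> p = q \<or> p = r \<or> q = r"
  shows "\<exists>x\<in>X. x \<noteq> p \<and> x \<noteq> q \<and> x \<noteq> r"
proof (rule ccontr)
  assume "\<not> ?thesis"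
  then have s: "X \<subseteq> {p, q, r}" by blast
  have "card X \<le> 2"
    using assms(2)
  proof (elim disjE)
    assume "p \<notin> X" then have "X \<subseteq> {q, r}" using s by blast
    then have "card X \<le> card {q, r}" by (intro card_mono) auto
    then show ?thesis using card_insert_le_m1[of 2 "{r}" q] by (simp add: card_insert_if split: if_splits)
  next
    assume "p = q" then have "card X \<le> card {q, r}" using s by (intro card_mono) auto
    then show ?thesis by (simp add: card_insert_if split: if_splits)
  next
    assume "p = r" then have "card X \<le> card {q, r}" using s by (intro card_mono) auto
    then show ?thesis by (simp add: card_insert_if split: if_splits)
  next
    assume "q = r" then have "card X \<le> card {p, q}" using s by (intro card_mono) auto
    then show ?thesis by (simp add: card_insert_if split: if_splits)
  qed
  then show False using assms(1) by simp
qed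

lemma card3_eqI: "card X = 3 \<Longrightarrow> a \<in> X \<Longrightarrow> b \<in> X \<Longrightarrow> c \<in> X \<Longrightarrow> a \<noteq> b \<Longrightarrow> a \<noteq> c \<Longrightarrow> b \<noteq> c \<Longrightarrow> X = {a, b, c}"
  by (rule card_seteq[symmetric]) (auto simp: card_ge_0_finite)

text \<open>Although a \<open>K\<^sub>4\<close> on \<open>a, b, c, d\<close> has six edges, it is enough that \<open>a\<close>, \<open>b\<close>, \<open>c\<close> avoid one colour each and that \<open>d\<close> is
coloured last. If the lists of \<open>a, b, c\<close> have a common colour, or two of them are disjoint, the
triangle needs less than three avoided colours, and the spare one protects \<open>d\<close>. Otherwise the three common colours of the
triangle are avoided cyclically, in one of two orientations, and \<open>d\<close> is blocked only if its
list consists of one colour from each of the three lists and these are the colours taken, which is recorded in \<open>\<delta>\<close>.\<close>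

lemma K4_tells:
  fixes L :: "'v \<Rightarrow> 'c set"
  assumes dist: "a \<noteq> b" "a \<noteq> c" "b \<noteq> c"
    and L: "card (L a) = 3" "card (L b) = 3" "card (L c) = 3" "card (L d) = 3"
    and m: "card (L a \<inter> L b) \<le> 1" "card (L a \<inter> L c) \<le> 1" "card (L b \<inter> L c) \<le> 1"
      "card (L a \<inter> L d) \<le> 1" "card (L b \<inter> L d) \<le> 1" "card (L c \<inter> L d) \<le> 1"
  shows "\<exists>t \<delta>. (\<forall>\<sigma>. \<forall>v\<in>{a,b,c}. finite (t \<sigma> v) \<and> card (t \<sigma> v) \<le> 1) \<and> (\<forall>v\<in>{a,b,c}. finite (\<delta> v) \<and> card (\<delta> v) \<le> 1) \<and>
    ((\<forall>v\<in>{a,b,c}. \<delta> v = {}) \<or> (\<forall>v\<in>{a,b,c}. L v = t False v \<union> t True v \<union> \<delta> v)) \<and>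
    (\<forall>\<sigma> \<phi>. (\<forall>v\<in>{a,b,c}. \<phi> v \<in> L v \<and> \<phi> v \<notin> t \<sigma> v) \<longrightarrow> \<phi> a \<noteq> \<phi> b \<and> \<phi> a \<noteq> \<phi> c \<and> \<phi> b \<noteq> \<phi> c \<and>
       ((\<exists>v\<in>{a,b,c}. \<phi> v \<notin> \<delta> v) \<longrightarrow> (\<exists>x\<in>L d. x \<noteq> \<phi> a \<and> x \<noteq> \<phi> b \<and> x \<noteq> \<phi> c)))"
    (is "\<exists>t \<delta>. ?P t \<delta>")
proof -
  have f: "finite (L a)" "finite (L b)" "finite (L c)" "finite (L d)" using L by (simp_all add: card_ge_0_finite)
  note one = card_le_1_eq[rotated]
  have ab: "x = y" if "x \<in> L a" "x \<in> L b" "y \<in> L a" "y \<in> L b" for x y using card_le_1_eq[OF _ m(1), of x y] f that by auto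
  have ac: "x = y" if "x \<in> L a" "x \<in> L c" "y \<in> L a" "y \<in> L c" for x y using card_le_1_eq[OF _ m(2), of x y] f that by auto
  have bc: "x = y" if "x \<in> L b" "x \<in> L c" "y \<in> L b" "y \<in> L c" for x y using card_le_1_eq[OF _ m(3), of x y] f that by auto
  have ad: "x = y" if "x \<in> L a" "x \<in> L d" "y \<in> L a" "y \<in> L d" for x y using card_le_1_eq[OF _ m(4), of x y] f that by auto
  have bd: "x = y" if "x \<in> L b" "x \<in> L d" "y \<in> L b" "y \<in> L d" for x y using card_le_1_eq[OF _ m(5), of x y] f that by auto
  have cd: "x = y" if "x \<in> L c" "x \<in> L d" "y \<in> L c" "y \<in> L d" for x y using card_le_1_eq[OF _ m(6), of x y] f that by auto
  have static: "\<exists>t \<delta>. ?P t \<delta>"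
    if t: "finite ta" "card ta \<le> 1" "finite tb" "card tb \<le> 1" "finite tc" "card tc \<le> 1"
      and p: "\<And>x y z. x \<in> L a - ta \<Longrightarrow> y \<in> L b - tb \<Longrightarrow> z \<in> L c - tc \<Longrightarrow> x \<noteq> y \<and> x \<noteq> z \<and> y \<noteq> z \<and>
        (\<exists>w\<in>L d. w \<noteq> x \<and> w \<noteq> y \<and> w \<noteq> z)" for ta tb tc
  proof (intro exI[of _ "\<lambda>(\<sigma>::bool) v. if v = a then ta else if v = b then tb else tc"] exI[of _ "\<lambda>_. {}"] conjI allI impI)
    fix \<sigma> :: bool and \<phi>
    assume "\<forall>v\<in>{a, b, c}. \<phi> v \<in> L v \<and> \<phi> v \<notin> (if v = a then ta else if v = b then tb else tc)"
    then have "\<phi> a \<in> L a - ta" "\<phi> b \<in> L b - tb" "\<phi> c \<in> L c - tc" using dist by auto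
    from p[OF this] show "\<phi> a \<noteq> \<phi> b" "\<phi> a \<noteq> \<phi> c" "\<phi> b \<noteq> \<phi> c" "\<exists>x\<in>L d. x \<noteq> \<phi> a \<and> x \<noteq> \<phi> b \<and> x \<noteq> \<phi> c" by blast+
  qed (use t in auto)
  consider (mono) "\<exists>x. x \<in> L a \<and> x \<in> L b \<and> x \<in> L c" | (nab) "L a \<inter> L b = {}" | (nac) "L a \<inter> L c = {}" | (nbc) "L b \<inter> L c = {}"
    | (rainbow) "\<not> (\<exists>x. x \<in> L a \<and> x \<in> L b \<and> x \<in> L c)" "L a \<inter> L b \<noteq> {}" "L a \<inter> L c \<noteq> {}" "L b \<inter> L c \<noteq> {}" by blast
  then show ?thesis
  proof cases
    case mono
    then obtain x where x: "x \<in> L a" "x \<in> L b" "x \<in> L c" by blast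
    show ?thesis
    proof (rule static[of "{x}" "{x}" "L c \<inter> L d"])
      fix u v w assume "u \<in> L a - {x}" "v \<in> L b - {x}" "w \<in> L c - L c \<inter> L d"
      then show "u \<noteq> v \<and> u \<noteq> w \<and> v \<noteq> w \<and> (\<exists>y\<in>L d. y \<noteq> u \<and> y \<noteq> v \<and> y \<noteq> w)"
        using ab[of u x] ac[of u x] bc[of v x] x card3_ex[OF L(4), of w u v] by auto
    qed (use f m in auto)
  next
    case nab
    show ?thesis
    proof (rule static[of "L a \<inter> L d" "L b \<inter> L c" "L a \<inter> L c"])
      fix u v w assume "u \<in> L a - L a \<inter> L d" "v \<in> L b - L b \<inter> L c" "w \<in> L c - L a \<inter> L c"
      then show "u \<noteq> v \<and> u \<noteq> w \<and> v \<noteq> w \<and> (\<exists>y\<in>L d. y \<noteq> u \<and> y \<noteq> v \<and> y \<noteq> w)"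
        using nab card3_ex[OF L(4), of u v w] by auto
    qed (use f m in auto)
  next
    case nac
    show ?thesis
    proof (rule static[of "L a \<inter> L b" "L b \<inter> L c" "L c \<inter> L d"])
      fix u v w assume "u \<in> L a - L a \<inter> L b" "v \<in> L b - L b \<inter> L c" "w \<in> L c - L c \<inter> L d"
      then show "u \<noteq> v \<and> u \<noteq> w \<and> v \<noteq> w \<and> (\<exists>y\<in>L d. y \<noteq> u \<and> y \<noteq> v \<and> y \<noteq> w)"
        using nac card3_ex[OF L(4), of w u v] by auto
    qed (use f m in auto)
  next
    case nbc
    show ?thesis
    proof (rule static[of "L a \<inter> L b" "L b \<inter> L d" "L a \<inter> L c"])
      fix u v w assume "u \<in> L a - L a \<inter> L b" "v \<in> L b - L b \<inter> L d" "w \<in> L c - L a \<inter> L c"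
      then show "u \<noteq> v \<and> u \<noteq> w \<and> v \<noteq> w \<and> (\<exists>y\<in>L d. y \<noteq> u \<and> y \<noteq> v \<and> y \<noteq> w)"
        using nbc card3_ex[OF L(4), of v u w] by auto
    qed (use f m in auto)
  next
    case rainbow
    then obtain p q r where pqr: "p \<in> L a" "p \<in> L b" "q \<in> L b" "q \<in> L c" "r \<in> L a" "r \<in> L c" by blast
    have pd: "p \<notin> L c" "q \<notin> L a" "r \<notin> L b" "p \<noteq> q" "p \<noteq> r" "q \<noteq> r" using rainbow pqr by auto
    show ?thesis
    proof (cases "\<exists>\<alpha> \<beta> \<gamma>. \<alpha> \<in> L a \<and> \<beta> \<in> L b \<and> \<gamma> \<in> L c \<and> L d = {\<alpha>, \<beta>, \<gamma>} \<and> \<alpha> \<noteq> \<beta> \<and> \<alpha> \<noteq> \<gamma> \<and> \<beta> \<noteq> \<gamma>")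
      case False
      show ?thesis
      proof (rule static[of "{p}" "{q}" "{r}"])
        fix u v w assume "u \<in> L a - {p}" "v \<in> L b - {q}" "w \<in> L c - {r}"
        then have 1: "u \<in> L a" "v \<in> L b" "w \<in> L c" "u \<noteq> v" "u \<noteq> w" "v \<noteq> w"
          using ab[of u p] ac[of w r] bc[of v q] pqr by auto
        have "\<exists>y\<in>L d. y \<noteq> u \<and> y \<noteq> v \<and> y \<noteq> w"
        proof (rule ccontr)
          assume no: "\<not> ?thesis"
          then have "L d \<subseteq> {u, v, w}" by blast
          then have "L d = {u, v, w}" using L(4) 1 by (intro card_seteq) auto
          then show False using False 1 by blast
        qed
        then show "u \<noteq> v \<and> u \<noteq> w \<and> v \<noteq> w \<and> (\<exists>y\<in>L d. y \<noteq> u \<and> y \<noteq> v \<and> y \<noteq> w)" using 1 by blast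
      qed auto
    next
      case True
      then obtain \<alpha> \<beta> \<gamma> where g: "\<alpha> \<in> L a" "\<beta> \<in> L b" "\<gamma> \<in> L c" "L d = {\<alpha>, \<beta>, \<gamma>}" "\<alpha> \<noteq> \<beta>" "\<alpha> \<noteq> \<gamma>" "\<beta> \<noteq> \<gamma>" by blast
      have x: "\<alpha> \<notin> L b" "\<alpha> \<notin> L c" "\<beta> \<notin> L a" "\<beta> \<notin> L c" "\<gamma> \<notin> L a" "\<gamma> \<notin> L b"
        using bd[of \<alpha> \<beta>] cd[of \<alpha> \<gamma>] ad[of \<alpha> \<beta>] cd[of \<beta> \<gamma>] ad[of \<alpha> \<gamma>] bd[of \<beta> \<gamma>] g by auto
      have La: "L a = {p, r, \<alpha>}" and Lb: "L b = {p, q, \<beta>}" and Lc: "L c = {q, r, \<gamma>}"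
        using pqr pd g x L by (intro card3_eqI; auto)+
      define t where "t = (\<lambda>\<sigma> v. if v = a then {if \<sigma> then r else p} else if v = b then {if \<sigma> then p else q} else {if \<sigma> then q else r})"
      define \<delta> where "\<delta> = (\<lambda>v. if v = a then {\<alpha>} else if v = b then {\<beta>} else {\<gamma>})"
      show ?thesis
      proof (intro exI[of _ t] exI[of _ \<delta>] conjI allI impI)
        show "(\<forall>v\<in>{a, b, c}. \<delta> v = {}) \<or> (\<forall>v\<in>{a, b, c}. L v = t False v \<union> t True v \<union> \<delta> v)"
          using dist La Lb Lc by (auto simp: t_def \<delta>_def)
        fix \<sigma> \<phi>
        assume h: "\<forall>v\<in>{a, b, c}. \<phi> v \<in> L v \<and> \<phi> v \<notin> t \<sigma> v"
        show "\<phi> a \<noteq> \<phi> b" "\<phi> a \<noteq> \<phi> c" "\<phi> b \<noteq> \<phi> c"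
          using h dist La Lb Lc pd x g pqr by (auto simp: t_def split: if_splits)
        assume "\<exists>v\<in>{a, b, c}. \<phi> v \<notin> \<delta> v"
        then have "\<phi> a \<noteq> \<alpha> \<or> \<phi> b \<noteq> \<beta> \<or> \<phi> c \<noteq> \<gamma>" using dist by (auto simp: \<delta>_def)
        moreover have "\<phi> a \<in> L a" "\<phi> b \<in> L b" "\<phi> c \<in> L c" using h by auto
        ultimately show "\<exists>y\<in>L d. y \<noteq> \<phi> a \<and> y \<noteq> \<phi> b \<and> y \<noteq> \<phi> c" using g(4) x by auto
      qed (auto simp: t_def \<delta>_def)
    qed
  qed
qed

text \<open>Here \<open>c\<close> and \<open>d\<close> are the last vertices of a \<open>K\<^sub>4\<close> and \<open>y\<close> is the colour of its second vertex. Both keep two colours outside \<open>L a\<close>, and as \<open>L c\<close> and \<open>L d\<close> share at most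
one colour these do not all collide.\<close>

lemma two_last:
  fixes L :: "'v \<Rightarrow> 'c set"
  assumes "card (L a) = 3" "card (L c) = 3" "card (L d) = 3" "card (L a \<inter> L c) \<le> 1" "card (L a \<inter> L d) \<le> 1" "card (L c \<inter> L d) \<le> 1"
  shows "\<exists>x\<in>L c - L a. \<exists>z\<in>L d - L a. x \<noteq> z \<and> x \<noteq> y \<and> z \<noteq> y"
proof -
  have f: "finite (L a)" "finite (L c)" "finite (L d)" using assms by (simp_all add: card_ge_0_finite)
  have c: "card (L c - L a) \<ge> 2" "card (L d - L a) \<ge> 2"
    using assms f card_Diff_subset_Int[of "L c" "L a"] card_Diff_subset_Int[of "L d" "L a"] by (simp_all add: Int_commute)
  have ne: "\<exists>x\<in>X. x \<noteq> u" if "card X \<ge> 2" for X :: "'c set" and u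
  proof (rule ccontr)
    assume "\<not> ?thesis"
    then have "X \<subseteq> {u}" by blast
    then show False using that card_mono[of "{u}" X] by simp
  qed
  show ?thesis
  proof (cases "y \<in> L c - L a")
    case False
    obtain z where z: "z \<in> L d - L a" "z \<noteq> y" using ne[OF c(2), of y] by (elim bexE)
    obtain x where x: "x \<in> L c - L a" "x \<noteq> z" using ne[OF c(1), of z] by (elim bexE)
    have "x \<noteq> y" using x False by metis
    then show ?thesis using x z by (intro bexI[of _ x] bexI[of _ z] conjI)
  next
    case True
    obtain x where x: "x \<in> L c - L a" "x \<noteq> y" using ne[OF c(1), of y] by (elim bexE)
    show ?thesis
    proof (cases "y \<in> L d")
      case False
      obtain z where z: "z \<in> L d - L a" "z \<noteq> x" using ne[OF c(2), of x] by (elim bexE)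
      have "z \<noteq> y" using z False by (metis DiffD1)
      then show ?thesis using x z by (intro bexI[of _ x] bexI[of _ z] conjI) simp_all
    next
      case yd: True
      obtain z where z: "z \<in> L d - L a" "z \<noteq> y" using ne[OF c(2), of y] by (elim bexE)
      have "x \<notin> L d"
      proof
        assume "x \<in> L d"
        then have "x = y" using card_le_1_eq[OF _ assms(6), of x y] f x yd True by simp
        then show False using x(2) by simp
      qed
      then have "x \<noteq> z" using z(1) by (metis DiffD1)
      then show ?thesis using x z by (intro bexI[of _ x] bexI[of _ z] conjI)
    qed
  qed
qed

section \<open>Extending a colouring along an assignment of edges\<close>

definition K4s :: "('a \<Rightarrow> 'a \<Rightarrow> bool) \<Rightarrow> 'a set \<Rightarrow> 'a set set" where
  "K4s R U = {T. T \<subseteq> U \<and> card T = 4 \<and> (\<forall>x\<in>T. \<forall>y\<in>T. x \<noteq> y \<longrightarrow> R x y)}"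

definition col :: "('a \<Rightarrow> 'a \<Rightarrow> bool) \<Rightarrow> ('a \<Rightarrow> 'c set) \<Rightarrow> 'a set \<Rightarrow> ('a \<Rightarrow> 'c) \<Rightarrow> bool" where
  "col R L U \<phi> \<longleftrightarrow> (\<forall>v\<in>U. \<phi> v \<in> L v) \<and> (\<forall>x\<in>U. \<forall>y\<in>U. R x y \<longrightarrow> \<phi> x \<noteq> \<phi> y)"

text \<open>The possible distributions of five edges of a \<open>K\<^sub>4\<close> over its vertices with at most two at each. A vertex with quota two receives no other edges and
can be coloured last.\<close>

lemma five_split:
  fixes q :: "'a \<Rightarrow> nat"
  assumes "card T = 4" "(\<Sum>v\<in>T. q v) = 5" "\<And>v. v \<in> T \<Longrightarrow> q v \<le> 2"
  shows "\<exists>a b c d. T = {a, b, c, d} \<and> distinct [a, b, c, d] \<and> q d = 2 \<and>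
    ((q c = 2 \<and> q b = 1 \<and> q a = 0) \<or> (q a = 1 \<and> q b = 1 \<and> q c = 1))"
proof -
  have fin: "finite T" using assms(1) by (simp add: card_ge_0_finite)
  have "\<exists>d\<in>T. q d = 2"
  proof (rule ccontr)
    assume "\<not> ?thesis"
    then have "\<And>v. v \<in> T \<Longrightarrow> q v \<le> 1" using assms(3) by (metis le_SucE numeral_2_eq_2 One_nat_def)
    then have "(\<Sum>v\<in>T. q v) \<le> (\<Sum>v\<in>T. 1)" by (rule sum_mono)
    then show False using assms(1,2) by simp
  qed
  then obtain d where d: "d \<in> T" "q d = 2" by blast
  have "card (T - {d}) = 3" using assms(1) d fin by simp
  then obtain x y z where xyz: "T - {d} = {x, y, z}" "x \<noteq> y" "x \<noteq> z" "y \<noteq> z" by (auto simp: card_3_iff)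
  have T: "T = {x, y, z, d}"
  proof -
    have "T = insert d (T - {d})" using d(1) by (rule insert_Diff[symmetric])
    then show ?thesis unfolding xyz(1) by (simp add: insert_commute)
  qed
  have dn: "d \<noteq> x" "d \<noteq> y" "d \<noteq> z" using xyz(1) by blast+
  have s: "q x + q y + q z = 3" using assms(2) d xyz dn unfolding T by simp
  have le: "q x \<le> 2" "q y \<le> 2" "q z \<le> 2" using assms(3) T by auto
  have e: "T = {a, b, c, d}" if "{a, b, c} = {x, y, z}" for a b c
  proof -
    have 1: "{a, b, c, d} = insert d {a, b, c}" by auto
    have 2: "insert d {x, y, z} = {x, y, z, d}" by auto
    show ?thesis unfolding 1 that 2 by (rule T)
  qed
  have fin: ?thesis if "{a, b, c} = {x, y, z}" "distinct [a, b, c, d]"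
    "(q c = 2 \<and> q b = 1 \<and> q a = 0) \<or> (q a = 1 \<and> q b = 1 \<and> q c = 1)" for a b c
    by (rule exI[of _ a], rule exI[of _ b], rule exI[of _ c], rule exI[of _ d])
      (rule conjI[OF e[OF that(1)] conjI[OF that(2) conjI[OF d(2) that(3)]]])
  consider "q x = 1" "q y = 1" "q z = 1" | "q x = 2" "q y = 1" "q z = 0" | "q x = 2" "q y = 0" "q z = 1"
    | "q y = 2" "q x = 1" "q z = 0" | "q y = 2" "q x = 0" "q z = 1" | "q z = 2" "q x = 1" "q y = 0" | "q z = 2" "q x = 0" "q y = 1"
  proof -
    have "q x = 0 \<or> q x = 1 \<or> q x = 2" "q y = 0 \<or> q y = 1 \<or> q y = 2" using le by linarith+
    moreover have "q z = 3 - q x - q y" using s by linarith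
    ultimately show thesis using that le(3) s by (elim disjE) simp_all
  qed
  then show ?thesis
  proof cases
    case 1 show ?thesis by (rule fin[of x y z]) (use 1 xyz(2-4) dn in auto)
  next
    case 2 show ?thesis by (rule fin[of z y x]) (use 2 xyz(2-4) dn in auto)
  next
    case 3 show ?thesis by (rule fin[of y z x]) (use 3 xyz(2-4) dn in auto)
  next
    case 4 show ?thesis by (rule fin[of z x y]) (use 4 xyz(2-4) dn in auto)
  next
    case 5 show ?thesis by (rule fin[of x z y]) (use 5 xyz(2-4) dn in auto)
  next
    case 6 show ?thesis by (rule fin[of y x z]) (use 6 xyz(2-4) dn in auto)
  next
    case 7 show ?thesis by (rule fin[of x y z]) (use 7 xyz(2-4) dn in auto)
  qed
qed

locale listed =
  fixes V :: "'a set" and adj :: "'a \<Rightarrow> 'a \<Rightarrow> bool" and L :: "'a \<Rightarrow> 'c set"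
  assumes finV: "finite V" and asym: "adj x y \<Longrightarrow> adj y x" and airr: "\<not> adj x x" and aV: "adj x y \<Longrightarrow> x \<in> V"
    and list3: "v \<in> V \<Longrightarrow> card (L v) = 3" and meet: "adj x y \<Longrightarrow> card (L x \<inter> L y) \<le> 1"
begin

lemma edgesE: assumes "e \<in> edges adj U"
  obtains x y where "e = {x, y}" "x \<noteq> y" "adj x y" "x \<in> U" "y \<in> U"
proof -
  from assms obtain x y where xy: "e = {x, y}" "x \<in> U" "y \<in> U" "adj x y" by (auto simp: edges_def)
  moreover from xy have "x \<noteq> y" using airr by auto
  ultimately show thesis using that by simp
qed

lemma edges_sub: "e \<in> edges adj U \<Longrightarrow> e \<subseteq> U" by (auto simp: edges_def)

lemma edges_mono: "A \<subseteq> B \<Longrightarrow> edges adj A \<subseteq> edges adj B" by (auto simp: edges_def)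

lemma finite_edges: "finite U \<Longrightarrow> finite (edges adj U)"
  by (rule finite_subset[of _ "Pow U"]) (auto simp: edges_def)

lemma edges_in: "e \<in> edges adj U \<Longrightarrow> e \<subseteq> T \<Longrightarrow> e \<in> edges adj T"
  by (auto simp: edges_def)

lemma edge_in_iff: "{x, y} \<in> edges adj U \<longleftrightarrow> x \<in> U \<and> y \<in> U \<and> adj x y"
  using asym by (auto simp: edges_def doubleton_eq_iff)

lemma card_edges_K4:
  assumes "T \<in> K4s adj U" shows "card (edges adj T) = 6"
proof -
  have T: "card T = 4" "finite T" "\<And>x y. x \<in> T \<Longrightarrow> y \<in> T \<Longrightarrow> x \<noteq> y \<Longrightarrow> adj x y"
    using assms card_ge_0_finite[of T] by (auto simp: K4s_def)
  have "edges adj T = {B. B \<subseteq> T \<and> card B = 2}"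
  proof (intro equalityI subsetI)
    fix e assume "e \<in> edges adj T"
    then show "e \<in> {B. B \<subseteq> T \<and> card B = 2}" by (auto elim!: edgesE)
  next
    fix e assume "e \<in> {B. B \<subseteq> T \<and> card B = 2}"
    then obtain x y where "e = {x, y}" "x \<noteq> y" "x \<in> T" "y \<in> T" by (auto simp: card_2_iff)
    then show "e \<in> edges adj T" using T(3) by (auto simp: edges_def)
  qed
  then show ?thesis using n_subsets[OF T(2), of 2] T(1) by (simp add: choose_two)
qed

text \<open>The edges outside \<open>S\<close> are assigned to one of their ends outside \<open>S\<close>, at most two to each vertex, except for those in \<open>Dr\<close>, at most one
in each \<open>K\<^sub>4\<close>. An edge outside the complete graphs with a dropped edge tells its assigned end to avoid the common
colour of the two lists. A complete graph with a dropped edge has five assigned edges. If they are distributed as \<open>2, 2, 1, 0\<close>, the vertex with one edge avoids the colours of the one with none, and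
the two with two edges are coloured last by \<open>two_last\<close>. If they are distributed as
\<open>2, 1, 1, 1\<close>, the three vertices with one edge are told what to avoid by \<open>K4_tells\<close>, and the fourth is coloured last.
All instructions to the remaining vertices are compatible by \<open>orient_tells\<close>, since they number at most two at each vertex.\<close>

lemma extend_by_assignment:
  assumes U: "U \<subseteq> V" and SU: "S \<subseteq> U" and col: "col adj L S \<phi>\<^sub>0"
    and DU: "Dr \<subseteq> edges adj U"
    and asg: "\<And>e. e \<in> edges adj U - edges adj S - Dr \<Longrightarrow> asg e \<in> e - S"
    and load: "\<And>v. v \<in> U - S \<Longrightarrow> card {e \<in> edges adj U - edges adj S - Dr. asg e = v} \<le> 2"
    and drop: "\<And>e. e \<in> Dr \<Longrightarrow> \<exists>T\<in>K4s adj U. e \<subseteq> T \<and> card (T \<inter> S) \<le> 1"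
    and once: "\<And>T e e'. T \<in> K4s adj U \<Longrightarrow> e \<in> Dr \<Longrightarrow> e' \<in> Dr \<Longrightarrow> e \<subseteq> T \<Longrightarrow> e' \<subseteq> T \<Longrightarrow> e = e'"
    and edj: "\<And>T T' e. T \<in> K4s adj U \<Longrightarrow> T' \<in> K4s adj U \<Longrightarrow> e \<in> edges adj U \<Longrightarrow> e \<subseteq> T \<Longrightarrow> e \<subseteq> T' \<Longrightarrow> T = T'"
  shows "\<exists>\<phi>. col adj L U \<phi> \<and> (\<forall>v\<in>S. \<phi> v = \<phi>\<^sub>0 v)"
proof -
  have finU: "finite U" using U finV finite_subset by blast
  define E where "E = edges adj U - edges adj S - Dr"
  have finE: "finite E" using finite_edges[OF finU] by (simp add: E_def)
  define \<T> where "\<T> = {T \<in> K4s adj U. \<exists>e\<in>Dr. e \<subseteq> T}"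
  have TK: "T \<in> K4s adj U" if "T \<in> \<T>" for T using that by (simp add: \<T>_def)
  have TU: "T \<subseteq> U" "card T = 4" "finite T" "\<And>x y. x \<in> T \<Longrightarrow> y \<in> T \<Longrightarrow> x \<noteq> y \<Longrightarrow> adj x y" if "T \<in> \<T>" for T
    using TK[OF that] card_ge_0_finite[of T] by (auto simp: K4s_def)
  have fin\<T>: "finite \<T>" by (rule finite_subset[of _ "Pow U"]) (use TU finU in auto)
  have TS: "card (T \<inter> S) \<le> 1" if T: "T \<in> \<T>" for T
  proof -
    obtain e where e: "e \<in> Dr" "e \<subseteq> T" using T by (auto simp: \<T>_def)
    then obtain T' where T': "T' \<in> K4s adj U" "e \<subseteq> T'" "card (T' \<inter> S) \<le> 1" using drop by blast
    then have "T = T'" using edj[OF TK[OF T] T'(1), of e] e DU by blast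
    then show ?thesis using T' by simp
  qed
  have disj: "T = T'" if "T \<in> \<T>" "T' \<in> \<T>" "e \<in> edges adj T" "e \<in> edges adj T'" for T T' e
  proof -
    have "e \<in> edges adj U" using that(3) edges_mono[OF TU(1)[OF that(1)]] by blast
    then show ?thesis using edj[OF TK[OF that(1)] TK[OF that(2)]] that edges_sub by blast
  qed
  have TE: "edges adj T - Dr \<subseteq> E" if T: "T \<in> \<T>" for T
  proof
    fix e assume e: "e \<in> edges adj T - Dr"
    have "e \<notin> edges adj S"
    proof
      assume "e \<in> edges adj S"
      then obtain x y where xy: "e = {x, y}" "x \<noteq> y" "x \<in> S" "y \<in> S" by (auto elim: edgesE)
      then have "{x, y} \<subseteq> T \<inter> S" using e edges_sub by blast
      then have "card {x, y} \<le> card (T \<inter> S)" using TU(3)[OF T] by (intro card_mono) auto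
      then show False using TS[OF T] xy by simp
    qed
    then show "e \<in> E" using e edges_mono[OF TU(1)[OF T]] by (auto simp: E_def)
  qed
  define a where "a = (\<lambda>T v. {e \<in> edges adj T - Dr. asg e = v})"
  define q where "q = (\<lambda>T v. card (a T v))"
  have asgE: "asg e \<in> e - S" if "e \<in> E" for e using asg that by (simp add: E_def)
  have loadE: "card {e \<in> E. asg e = v} \<le> 2" if "v \<in> U - S" for v using load that by (simp add: E_def)
  have fina: "finite (a T v)" if "T \<in> \<T>" for T v using finite_edges[OF TU(3)[OF that]] by (simp add: a_def)
  have aE: "a T v \<subseteq> {e \<in> E. asg e = v}" if "T \<in> \<T>" for T v using TE[OF that] by (auto simp: a_def)
  have qS: "q T v = 0" if "T \<in> \<T>" "v \<in> S" for T v
  proof -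
    have "a T v = {}" using aE[OF that(1), of v] asgE that(2) by blast
    then show ?thesis by (simp add: q_def)
  qed
  have q2: "q T v \<le> 2" if T: "T \<in> \<T>" and v: "v \<in> T" for T v
  proof (cases "v \<in> S")
    case False
    then have "card (a T v) \<le> card {e \<in> E. asg e = v}" using aE[OF T] finE by (intro card_mono) auto
    then show ?thesis using loadE[of v] False TU(1)[OF T] v by (auto simp: q_def)
  qed (use qS[OF T] in simp)
  have q5: "(\<Sum>v\<in>T. q T v) = 5" if T: "T \<in> \<T>" for T
  proof -
    obtain e where e: "e \<in> Dr" "e \<subseteq> T" using T by (auto simp: \<T>_def)
    have "e \<in> edges adj T" using e DU edges_in by blast
    moreover have "edges adj T \<inter> Dr = {e}"
      using once[OF TK[OF T] _ e(1) _ e(2)] e calculation edges_sub by blast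
    ultimately have "card (edges adj T - Dr) = 5"
      using card_edges_K4[OF TK[OF T]] finite_edges[OF TU(3)[OF T]] by (simp add: card_Diff_subset_Int)
    moreover have "(\<Sum>v\<in>T. \<Sum>e\<in>{e \<in> edges adj T - Dr. asg e = v}. 1::nat) = (\<Sum>e\<in>edges adj T - Dr. 1)"
    proof (rule sum.group)
      show "asg ` (edges adj T - Dr) \<subseteq> T" using asgE TE[OF T] edges_sub by blast
    qed (use TU(3)[OF T] finite_edges in auto)
    ultimately show ?thesis by (simp add: q_def a_def)
  qed
  have "\<forall>T\<in>\<T>. \<exists>a b c d. T = {a, b, c, d} \<and> distinct [a, b, c, d] \<and> q T d = 2 \<and>
    ((q T c = 2 \<and> q T b = 1 \<and> q T a = 0) \<or> (q T a = 1 \<and> q T b = 1 \<and> q T c = 1))"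
    using five_split[OF TU(2) q5 q2] by blast
  then obtain A B C D where ABCD: "\<And>T. T \<in> \<T> \<Longrightarrow> T = {A T, B T, C T, D T} \<and> distinct [A T, B T, C T, D T] \<and> q T (D T) = 2 \<and>
    ((q T (C T) = 2 \<and> q T (B T) = 1 \<and> q T (A T) = 0) \<or> (q T (A T) = 1 \<and> q T (B T) = 1 \<and> q T (C T) = 1))"
    by metis
  have mem: "A T \<in> T" "B T \<in> T" "C T \<in> T" "D T \<in> T" if "T \<in> \<T>" for T using ABCD[OF that] by blast+
  have dst: "A T \<noteq> B T" "A T \<noteq> C T" "A T \<noteq> D T" "B T \<noteq> C T" "B T \<noteq> D T" "C T \<noteq> D T" if "T \<in> \<T>" for T
    using ABCD[OF that] by auto
  have Teq: "T = {A T, B T, C T, D T}" if "T \<in> \<T>" for T using ABCD[OF that] by blast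
  \<comment> \<open>the complete graphs with quotas \<open>2, 2, 1, 0\<close>\<close>
  define \<T>1 where "\<T>1 = {T \<in> \<T>. q T (C T) = 2}"
  have t1: "q T (D T) = 2" "q T (C T) = 2" "q T (B T) = 1" "q T (A T) = 0" if "T \<in> \<T>1" for T
    using ABCD[of T] that by (auto simp: \<T>1_def)
  have t2: "q T (D T) = 2" "q T (C T) = 1" "q T (B T) = 1" "q T (A T) = 1" if "T \<in> \<T> - \<T>1" for T
    using ABCD[of T] that by (auto simp: \<T>1_def)
  have Ladj: "card (L x) = 3" "card (L x \<inter> L y) \<le> 1" if "T \<in> \<T>" "x \<in> T" "y \<in> T" "x \<noteq> y" for T x y
    using TU[OF that(1)] that U list3 meet by blast+
  have "\<forall>T\<in>\<T>. \<exists>t \<delta>. (\<forall>\<sigma>. \<forall>v\<in>{A T,B T,C T}. finite (t \<sigma> v) \<and> card (t \<sigma> v) \<le> 1) \<and> (\<forall>v\<in>{A T,B T,C T}. finite (\<delta> v) \<and> card (\<delta> v) \<le> 1) \<and>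
    ((\<forall>v\<in>{A T,B T,C T}. \<delta> v = {}) \<or> (\<forall>v\<in>{A T,B T,C T}. L v = t False v \<union> t True v \<union> \<delta> v)) \<and>
    (\<forall>\<sigma> \<phi>. (\<forall>v\<in>{A T,B T,C T}. \<phi> v \<in> L v \<and> \<phi> v \<notin> t \<sigma> v) \<longrightarrow> \<phi> (A T) \<noteq> \<phi> (B T) \<and> \<phi> (A T) \<noteq> \<phi> (C T) \<and> \<phi> (B T) \<noteq> \<phi> (C T) \<and>
       ((\<exists>v\<in>{A T,B T,C T}. \<phi> v \<notin> \<delta> v) \<longrightarrow> (\<exists>x\<in>L (D T). x \<noteq> \<phi> (A T) \<and> x \<noteq> \<phi> (B T) \<and> x \<noteq> \<phi> (C T))))"
  proof
    fix T assume T: "T \<in> \<T>"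
    note m = mem[OF T] and d = dst[OF T] and l = Ladj[OF T]
    show "\<exists>t \<delta>. (\<forall>\<sigma>. \<forall>v\<in>{A T,B T,C T}. finite (t \<sigma> v) \<and> card (t \<sigma> v) \<le> 1) \<and> (\<forall>v\<in>{A T,B T,C T}. finite (\<delta> v) \<and> card (\<delta> v) \<le> 1) \<and>
    ((\<forall>v\<in>{A T,B T,C T}. \<delta> v = {}) \<or> (\<forall>v\<in>{A T,B T,C T}. L v = t False v \<union> t True v \<union> \<delta> v)) \<and>
    (\<forall>\<sigma> \<phi>. (\<forall>v\<in>{A T,B T,C T}. \<phi> v \<in> L v \<and> \<phi> v \<notin> t \<sigma> v) \<longrightarrow> \<phi> (A T) \<noteq> \<phi> (B T) \<and> \<phi> (A T) \<noteq> \<phi> (C T) \<and> \<phi> (B T) \<noteq> \<phi> (C T) \<and>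
       ((\<exists>v\<in>{A T,B T,C T}. \<phi> v \<notin> \<delta> v) \<longrightarrow> (\<exists>x\<in>L (D T). x \<noteq> \<phi> (A T) \<and> x \<noteq> \<phi> (B T) \<and> x \<noteq> \<phi> (C T))))"
      by (rule K4_tells[OF d(1,2,4) l(1)[OF m(1,2) d(1)] l(1)[OF m(2,3) d(4)] l(1)[OF m(3,4) d(6)] l(1)[OF m(4,3) d(6)[symmetric]]
          l(2)[OF m(1,2) d(1)] l(2)[OF m(1,3) d(2)] l(2)[OF m(2,3) d(4)] l(2)[OF m(1,4) d(3)] l(2)[OF m(2,4) d(5)] l(2)[OF m(3,4) d(6)]])
  qed
  from bchoice[OF this] obtain t0 where "\<forall>T\<in>\<T>. \<exists>\<delta>. (\<forall>\<sigma>. \<forall>v\<in>{A T,B T,C T}. finite (t0 T \<sigma> v) \<and> card (t0 T \<sigma> v) \<le> 1) \<and> (\<forall>v\<in>{A T,B T,C T}. finite (\<delta> v) \<and> card (\<delta> v) \<le> 1) \<and>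
    ((\<forall>v\<in>{A T,B T,C T}. \<delta> v = {}) \<or> (\<forall>v\<in>{A T,B T,C T}. L v = t0 T False v \<union> t0 T True v \<union> \<delta> v)) \<and>
    (\<forall>\<sigma> \<phi>. (\<forall>v\<in>{A T,B T,C T}. \<phi> v \<in> L v \<and> \<phi> v \<notin> t0 T \<sigma> v) \<longrightarrow> \<phi> (A T) \<noteq> \<phi> (B T) \<and> \<phi> (A T) \<noteq> \<phi> (C T) \<and> \<phi> (B T) \<noteq> \<phi> (C T) \<and>
       ((\<exists>v\<in>{A T,B T,C T}. \<phi> v \<notin> \<delta> v) \<longrightarrow> (\<exists>x\<in>L (D T). x \<noteq> \<phi> (A T) \<and> x \<noteq> \<phi> (B T) \<and> x \<noteq> \<phi> (C T))))" ..
  from bchoice[OF this] obtain \<delta>0 where td: "\<forall>T\<in>\<T>. (\<forall>\<sigma>. \<forall>v\<in>{A T,B T,C T}. finite (t0 T \<sigma> v) \<and> card (t0 T \<sigma> v) \<le> 1) \<and> (\<forall>v\<in>{A T,B T,C T}. finite (\<delta>0 T v) \<and> card (\<delta>0 T v) \<le> 1) \<and>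
    ((\<forall>v\<in>{A T,B T,C T}. \<delta>0 T v = {}) \<or> (\<forall>v\<in>{A T,B T,C T}. L v = t0 T False v \<union> t0 T True v \<union> \<delta>0 T v)) \<and>
    (\<forall>\<sigma> \<phi>. (\<forall>v\<in>{A T,B T,C T}. \<phi> v \<in> L v \<and> \<phi> v \<notin> t0 T \<sigma> v) \<longrightarrow> \<phi> (A T) \<noteq> \<phi> (B T) \<and> \<phi> (A T) \<noteq> \<phi> (C T) \<and> \<phi> (B T) \<noteq> \<phi> (C T) \<and>
       ((\<exists>v\<in>{A T,B T,C T}. \<phi> v \<notin> \<delta>0 T v) \<longrightarrow> (\<exists>x\<in>L (D T). x \<noteq> \<phi> (A T) \<and> x \<noteq> \<phi> (B T) \<and> x \<noteq> \<phi> (C T))))" ..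
  have td1: "finite (t0 T \<sigma> v) \<and> card (t0 T \<sigma> v) \<le> 1" if "T \<in> \<T>" "v \<in> {A T,B T,C T}" for T \<sigma> v
    using bspec[OF td that(1), THEN conjunct1] that(2) by blast
  have td2: "finite (\<delta>0 T v) \<and> card (\<delta>0 T v) \<le> 1" if "T \<in> \<T>" "v \<in> {A T,B T,C T}" for T v
    using bspec[OF td that(1), THEN conjunct2, THEN conjunct1] that(2) by blast
  have td3: "(\<forall>v\<in>{A T,B T,C T}. \<delta>0 T v = {}) \<or> (\<forall>v\<in>{A T,B T,C T}. L v = t0 T False v \<union> t0 T True v \<union> \<delta>0 T v)" if "T \<in> \<T>" for T
    by (rule bspec[OF td that, THEN conjunct2, THEN conjunct2, THEN conjunct1])
  note td4 = bspec[OF td, THEN conjunct2, THEN conjunct2, THEN conjunct2, rule_format]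
  define N where "N = (\<lambda>T. if T \<in> \<T>1 then {B T} else {A T, B T, C T})"
  define t where "t = (\<lambda>\<sigma> T v. if T \<in> \<T>1 then L (A T) \<inter> L v else t0 T \<sigma> v)"
  define \<delta> where "\<delta> = (\<lambda>T v. if T \<in> \<T>1 then {} else \<delta>0 T v)"
  \<comment> \<open>the edges that give their instructions to \<open>v\<close> directly, not through a complete graph\<close>
  define St where "St = (\<lambda>v. {e \<in> E. asg e = v \<and> \<not> (\<exists>T\<in>\<T>. e \<subseteq> T)})"
  define s where "s = (\<lambda>v. \<Union>e\<in>St v. \<Inter>x\<in>e. L x)"
  have N1: "q T v = 1" if "T \<in> \<T>" "v \<in> N T" for T v
    using that t1[of T] t2[of T] by (auto simp: N_def split: if_splits)
  have NT: "N T \<subseteq> T" if "T \<in> \<T>" for T using mem[OF that] by (auto simp: N_def)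
  have NW: "N T \<subseteq> U - S" if "T \<in> \<T>" for T
    using NT[OF that] TU(1)[OF that] N1[OF that] qS[OF that] by force
  have NneB: "B T \<in> N T" for T by (auto simp: N_def)
  have edgeL: "finite (\<Inter>x\<in>e. L x) \<and> card (\<Inter>x\<in>e. L x) \<le> 1" if "e \<in> E" for e
  proof -
    have "e \<in> edges adj U" using that by (simp add: E_def)
    then obtain x y where xy: "e = {x, y}" "adj x y" "x \<in> U" by (rule edgesE) simp
    have "finite (L x)" using list3[of x] xy U card_ge_0_finite[of "L x"] by auto
    then show ?thesis using meet[OF xy(2)] xy by simp
  qed
  have finSt: "finite (St v)" for v using finE by (simp add: St_def)
  have sfin: "finite (s v)" for v using finSt edgeL by (auto simp: s_def St_def)
  have scard: "card (s v) \<le> card (St v)" for v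
  proof -
    have "card (s v) \<le> (\<Sum>e\<in>St v. card (\<Inter>x\<in>e. L x))" unfolding s_def by (rule card_UN_le[OF finSt])
    also have "\<dots> \<le> (\<Sum>e\<in>St v. 1)" using edgeL by (intro sum_mono) (auto simp: St_def)
    finally show ?thesis by simp
  qed
  have count: "card (St v) + card \<R> \<le> card {e \<in> E. asg e = v}" if R: "\<R> \<subseteq> \<T>" "\<And>T. T \<in> \<R> \<Longrightarrow> q T v \<ge> 1" for v \<R>
  proof -
    have "\<forall>T\<in>\<R>. \<exists>e. e \<in> a T v" using R(2) by (auto simp: q_def card_gt_0_iff Suc_le_eq)
    then obtain \<epsilon> where \<epsilon>: "\<And>T. T \<in> \<R> \<Longrightarrow> \<epsilon> T \<in> a T v" by metis
    have "inj_on \<epsilon> \<R>"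
    proof (rule inj_onI)
      fix T T' assume "T \<in> \<R>" "T' \<in> \<R>" "\<epsilon> T = \<epsilon> T'"
      then show "T = T'" using disj[of T T' "\<epsilon> T"] \<epsilon>[of T] \<epsilon>[of T'] R(1) by (auto simp: a_def)
    qed
    then have "card \<R> = card (\<epsilon> ` \<R>)" by (simp add: card_image)
    moreover have "St v \<inter> \<epsilon> ` \<R> = {}" using \<epsilon> R(1) edges_sub by (fastforce simp: St_def a_def)
    moreover have "St v \<union> \<epsilon> ` \<R> \<subseteq> {e \<in> E. asg e = v}"
    proof (rule Un_least)
      show "\<epsilon> ` \<R> \<subseteq> {e \<in> E. asg e = v}" using \<epsilon> aE R(1) by blast
    qed (auto simp: St_def)
    moreover have "finite (\<epsilon> ` \<R>)" using R(1) fin\<T> finite_subset by blast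
    ultimately show ?thesis using finSt[of v] finE card_mono[of "{e \<in> E. asg e = v}" "St v \<union> \<epsilon> ` \<R>"]
      by (simp add: card_Un_disjoint)
  qed
  have "\<exists>\<sigma> \<phi>. (\<forall>v\<in>U - S. \<phi> v \<in> L v \<and> \<phi> v \<notin> s v \<and> (\<forall>T\<in>\<T>. v \<in> N T \<longrightarrow> \<phi> v \<notin> t (\<sigma> T) T v)) \<and>
    (\<forall>T\<in>\<T>. \<exists>v\<in>N T. \<phi> v \<notin> \<delta> T v)"
  proof (rule orient_tells)
    show "finite \<T>" by (rule fin\<T>)
    show "finite (U - S)" using finU by simp
    show "N T \<subseteq> U - S" if "T \<in> \<T>" for T by (rule NW[OF that])
    show "N T \<noteq> {}" for T using NneB by blast
    show "card (L v) = 3" if "v \<in> U - S" for v using list3 U that by blast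
    show "finite (s v)" for v by (rule sfin)
    show "card (s v) + card {T \<in> \<T>. v \<in> N T} \<le> 2" if v: "v \<in> U - S" for v
      using count[of "{T \<in> \<T>. v \<in> N T}" v] N1 loadE[OF v] scard[of v] by fastforce
    show "finite (t \<sigma> T v) \<and> card (t \<sigma> T v) \<le> 1" if "T \<in> \<T>" "v \<in> N T" for \<sigma> T v
    proof (cases "T \<in> \<T>1")
      case True
      then have v: "v = B T" using that by (simp add: N_def)
      show ?thesis using Ladj[OF that(1) mem(1,2)[OF that(1)] dst(1)[OF that(1)]] True card_ge_0_finite[of "L (A T)"]
        by (simp add: t_def v)
    next
      case False
      then have "v \<in> {A T,B T,C T}" using that(2) by (simp only: N_def if_False)
      from td1[OF that(1) this] show ?thesis using False by (simp only: t_def if_False simp_thms)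
    qed
    show "finite (\<delta> T v) \<and> card (\<delta> T v) \<le> 1" if "T \<in> \<T>" "v \<in> N T" for T v
    proof (cases "T \<in> \<T>1")
      case False
      then have "v \<in> {A T,B T,C T}" using that(2) by (simp only: N_def if_False)
      from td2[OF that(1) this] show ?thesis using False by (simp only: \<delta>_def if_False simp_thms)
    qed (simp add: \<delta>_def)
    show "(\<forall>v\<in>N T. \<delta> T v = {}) \<or> card (N T) = 3 \<and> (\<forall>v\<in>N T. L v = t False T v \<union> t True T v \<union> \<delta> T v)" if "T \<in> \<T>" for T
    proof (cases "T \<in> \<T>1")
      case False
      have "card {A T, B T, C T} = 3" using dst[OF that] by simp
      then show ?thesis using td3[OF that] False by (simp only: \<delta>_def t_def N_def if_False simp_thms)
    qed (simp add: \<delta>_def)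
  qed
  then obtain \<sigma> \<phi>1 where p1: "\<And>v. v \<in> U - S \<Longrightarrow> \<phi>1 v \<in> L v" "\<And>v. v \<in> U - S \<Longrightarrow> \<phi>1 v \<notin> s v"
    "\<And>v T. v \<in> U - S \<Longrightarrow> T \<in> \<T> \<Longrightarrow> v \<in> N T \<Longrightarrow> \<phi>1 v \<notin> t (\<sigma> T) T v" "\<And>T. T \<in> \<T> \<Longrightarrow> \<exists>v\<in>N T. \<phi>1 v \<notin> \<delta> T v" by blast
  have last: "\<exists>x z. z \<in> L (D T) \<and> (T \<in> \<T>1 \<longrightarrow> x \<in> L (C T) - L (A T) \<and> z \<notin> L (A T) \<and> x \<noteq> z \<and> x \<noteq> \<phi>1 (B T) \<and> z \<noteq> \<phi>1 (B T)) \<and>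
      (T \<notin> \<T>1 \<longrightarrow> z \<noteq> \<phi>1 (A T) \<and> z \<noteq> \<phi>1 (B T) \<and> z \<noteq> \<phi>1 (C T))" if T: "T \<in> \<T>" for T
  proof (cases "T \<in> \<T>1")
    case True
    note m = mem[OF T] and d = dst[OF T] and l = Ladj[OF T]
    from two_last[of L "A T" "C T" "D T" "\<phi>1 (B T)", OF l(1)[OF m(1,2) d(1)] l(1)[OF m(3,4) d(6)] l(1)[OF m(4,3) d(6)[symmetric]]
          l(2)[OF m(1,3) d(2)] l(2)[OF m(1,4) d(3)] l(2)[OF m(3,4) d(6)]]
    obtain x z where "x \<in> L (C T) - L (A T)" "z \<in> L (D T) - L (A T)" "x \<noteq> z \<and> x \<noteq> \<phi>1 (B T) \<and> z \<noteq> \<phi>1 (B T)" by (elim bexE)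
    then show ?thesis using True by (intro exI[of _ x] exI[of _ z]) simp
  next
    case False
    have NT': "N T = {A T, B T, C T}" using False by (simp add: N_def)
    have "\<forall>v\<in>{A T,B T,C T}. \<phi>1 v \<in> L v \<and> \<phi>1 v \<notin> t0 T (\<sigma> T) v"
    proof
      fix v assume "v \<in> {A T,B T,C T}"
      then have "v \<in> N T" "v \<in> U - S" using NT' NW[OF T] by blast+
      then show "\<phi>1 v \<in> L v \<and> \<phi>1 v \<notin> t0 T (\<sigma> T) v" using p1(1)[of v] p1(3)[of v T] T False by (simp add: t_def)
    qed
    moreover have "\<exists>v\<in>{A T,B T,C T}. \<phi>1 v \<notin> \<delta>0 T v" using p1(4)[OF T] False by (simp only: NT' \<delta>_def if_False)
    ultimately have "\<exists>x\<in>L (D T). x \<noteq> \<phi>1 (A T) \<and> x \<noteq> \<phi>1 (B T) \<and> x \<noteq> \<phi>1 (C T)" using td4[OF T, of \<phi>1 "\<sigma> T"] by blast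
    then show ?thesis using False by blast
  qed
  then have "\<forall>T\<in>\<T>. \<exists>x z. z \<in> L (D T) \<and> (T \<in> \<T>1 \<longrightarrow> x \<in> L (C T) - L (A T) \<and> z \<notin> L (A T) \<and> x \<noteq> z \<and> x \<noteq> \<phi>1 (B T) \<and> z \<noteq> \<phi>1 (B T)) \<and>
      (T \<notin> \<T>1 \<longrightarrow> z \<noteq> \<phi>1 (A T) \<and> z \<noteq> \<phi>1 (B T) \<and> z \<noteq> \<phi>1 (C T))" by blast
  from bchoice[OF this] obtain gC where "\<forall>T\<in>\<T>. \<exists>z. z \<in> L (D T) \<and> (T \<in> \<T>1 \<longrightarrow> gC T \<in> L (C T) - L (A T) \<and> z \<notin> L (A T) \<and> gC T \<noteq> z \<and> gC T \<noteq> \<phi>1 (B T) \<and> z \<noteq> \<phi>1 (B T)) \<and>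
      (T \<notin> \<T>1 \<longrightarrow> z \<noteq> \<phi>1 (A T) \<and> z \<noteq> \<phi>1 (B T) \<and> z \<noteq> \<phi>1 (C T))" ..
  from bchoice[OF this] obtain gD where g: "\<And>T. T \<in> \<T> \<Longrightarrow> gD T \<in> L (D T) \<and> (T \<in> \<T>1 \<longrightarrow> gC T \<in> L (C T) - L (A T) \<and> gD T \<notin> L (A T) \<and> gC T \<noteq> gD T \<and> gC T \<noteq> \<phi>1 (B T) \<and> gD T \<noteq> \<phi>1 (B T)) \<and>
      (T \<notin> \<T>1 \<longrightarrow> gD T \<noteq> \<phi>1 (A T) \<and> gD T \<noteq> \<phi>1 (B T) \<and> gD T \<noteq> \<phi>1 (C T))" by blast
  have excl: "q T' v = 0" if T: "T \<in> \<T>" "q T v = 2" "T' \<in> \<T>" "T' \<noteq> T" for T T' v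
  proof -
    have vS: "v \<notin> S" using qS T by fastforce
    have "a T v \<noteq> {}" using T(2) by (auto simp: q_def)
    then obtain e where "e \<in> a T v" by blast
    then have "e \<in> E" "asg e = v" using aE[OF T(1)] by blast+
    then have vU: "v \<in> U - S" using asgE[of e] vS by (auto simp: E_def dest: edges_sub)
    have dj: "a T v \<inter> a T' v = {}" using disj[OF T(1,3)] T(4) by (auto simp: a_def)
    have "card (a T v \<union> a T' v) \<le> card {e \<in> E. asg e = v}"
      using aE[OF T(1)] aE[OF T(3)] finE by (intro card_mono) auto
    then have "card (a T v) + card (a T' v) \<le> 2"
      using card_Un_disjoint[OF fina[OF T(1)] fina[OF T(3)] dj] loadE[OF vU] by simp
    then show ?thesis using T(2) by (simp add: q_def)
  qed
  have exclS: "St v = {}" if T: "T \<in> \<T>" "q T v = 2" and vU: "v \<in> U - S" for T v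
  proof -
    have dj: "a T v \<inter> St v = {}" using T(1) edges_sub by (fastforce simp: a_def St_def)
    have "card (a T v \<union> St v) \<le> card {e \<in> E. asg e = v}"
      using aE[OF T(1)] finE by (intro card_mono) (auto simp: St_def)
    then have "card (a T v) + card (St v) \<le> 2"
      using card_Un_disjoint[OF fina[OF T(1)] finSt dj] loadE[OF vU] by simp
    then show ?thesis using T(2) finSt[of v] by (simp add: q_def)
  qed
  define \<phi> where "\<phi> = (\<lambda>v. if v \<in> S then \<phi>\<^sub>0 v else if \<exists>T\<in>\<T>. q T v = 2 \<and> v = D T then gD (THE T. T \<in> \<T> \<and> q T v = 2)
      else if \<exists>T\<in>\<T>. q T v = 2 \<and> v = C T then gC (THE T. T \<in> \<T> \<and> q T v = 2) else \<phi>1 v)"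
  have the: "(THE T. T \<in> \<T> \<and> q T v = 2) = T" if "T \<in> \<T>" "q T v = 2" for T v
    using excl that by (intro the_equality) force+
  have pS: "\<phi> v = \<phi>\<^sub>0 v" if "v \<in> S" for v using that by (simp add: \<phi>_def)
  have pD: "\<phi> (D T) = gD T" if T: "T \<in> \<T>" for T
  proof -
    have 2: "q T (D T) = 2" using ABCD[OF T] by blast
    then have "D T \<notin> S" using qS[OF T] by fastforce
    then show ?thesis using T 2 the[OF T 2] by (auto simp: \<phi>_def)
  qed
  have pC: "\<phi> (C T) = gC T" if T: "T \<in> \<T>1" for T
  proof -
    have TT: "T \<in> \<T>" using T by (simp add: \<T>1_def)
    have 2: "q T (C T) = 2" using t1[OF T] by blast
    then have "C T \<notin> S" using qS[OF TT] by fastforce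
    moreover have "\<not> (\<exists>T'\<in>\<T>. q T' (C T) = 2 \<and> C T = D T')"
    proof
      assume "\<exists>T'\<in>\<T>. q T' (C T) = 2 \<and> C T = D T'"
      then obtain T' where T': "T' \<in> \<T>" "q T' (C T) = 2" "C T = D T'" by blast
      then have "T' = T" using excl[OF TT 2 T'(1)] by force
      then show False using T' dst(6)[OF TT] by simp
    qed
    ultimately show ?thesis using TT 2 the[OF TT 2] by (auto simp: \<phi>_def)
  qed
  have pN: "\<phi> v = \<phi>1 v" if "v \<notin> S" "\<And>T. T \<in> \<T> \<Longrightarrow> q T v \<noteq> 2" for v using that by (auto simp: \<phi>_def)
  have pN': "\<phi> v = \<phi>1 v" if T: "T \<in> \<T>" "v \<in> N T" for T v
  proof (rule pN)
    show "v \<notin> S" using NW[OF T(1)] T(2) by blast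
    fix T' assume T': "T' \<in> \<T>"
    show "q T' v \<noteq> 2"
    proof
      assume "q T' v = 2"
      then have "T = T'" using excl[OF T' _ T(1)] N1[OF T] by force
      then show False using N1[OF T] \<open>q T' v = 2\<close> by simp
    qed
  qed
  have pL: "\<phi> v \<in> L v" if v: "v \<in> U" for v
  proof (cases "v \<in> S")
    case True
    then show ?thesis using col pS by (simp add: col_def)
  next
    case False
    show ?thesis
    proof (cases "\<exists>T\<in>\<T>. q T v = 2")
      case True
      then obtain T where T: "T \<in> \<T>" "q T v = 2" by blast
      have "v \<in> T"
      proof -
        have "a T v \<noteq> {}" using T(2) by (auto simp: q_def)
        then obtain e where "e \<in> a T v" by blast
        then show ?thesis using aE[OF T(1), of v] asgE[of e] by (auto simp: a_def dest: edges_sub)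
      qed
      then have "v \<in> {A T, B T, C T, D T}" by (subst (asm) Teq[OF T(1)])
      then have "v = D T \<or> (T \<in> \<T>1 \<and> v = C T)"
        using T t1[of T] t2[of T] by (cases "T \<in> \<T>1") auto
      then show ?thesis using pD[OF T(1)] pC[of T] g[OF T(1)] by auto
    next
      case F: False
      then show ?thesis using pN[OF False] p1(1)[of v] v False by auto
    qed
  qed
  have proper: "\<phi> x \<noteq> \<phi> y" if T: "T \<in> \<T>" and xy: "x \<in> T" "y \<in> T" "x \<noteq> y" for T x y
  proof -
    have "\<phi> (A T) \<noteq> \<phi> (B T) \<and> \<phi> (A T) \<noteq> \<phi> (C T) \<and> \<phi> (A T) \<noteq> \<phi> (D T) \<and> \<phi> (B T) \<noteq> \<phi> (C T) \<and> \<phi> (B T) \<noteq> \<phi> (D T) \<and> \<phi> (C T) \<noteq> \<phi> (D T)"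
    proof (cases "T \<in> \<T>1")
      case True
      have B: "\<phi> (B T) = \<phi>1 (B T)" using pN'[OF T NneB] .
      have "B T \<in> U - S" using NW[OF T] NneB by blast
      then have "\<phi>1 (B T) \<in> L (B T)" "\<phi>1 (B T) \<notin> L (A T) \<inter> L (B T)"
        using p1(1)[of "B T"] p1(3)[of "B T" T] T NneB[of T] True by (auto simp: t_def)
      moreover have "\<phi> (A T) \<in> L (A T)" using pL mem(1)[OF T] TU(1)[OF T] by blast
      ultimately show ?thesis using B pC[OF True] pD[OF T] g[OF T] True by auto
    next
      case False
      then have NT': "N T = {A T, B T, C T}" by (simp add: N_def)
      have e: "\<phi> (A T) = \<phi>1 (A T)" "\<phi> (B T) = \<phi>1 (B T)" "\<phi> (C T) = \<phi>1 (C T)" using pN'[OF T] NT' by auto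
      have "\<forall>v\<in>{A T,B T,C T}. \<phi>1 v \<in> L v \<and> \<phi>1 v \<notin> t0 T (\<sigma> T) v"
      proof
        fix v assume "v \<in> {A T,B T,C T}"
        then have "v \<in> N T" "v \<in> U - S" using NT' NW[OF T] by blast+
        then show "\<phi>1 v \<in> L v \<and> \<phi>1 v \<notin> t0 T (\<sigma> T) v" using p1(1)[of v] p1(3)[of v T] T False by (simp add: t_def)
      qed
      then have "\<phi>1 (A T) \<noteq> \<phi>1 (B T) \<and> \<phi>1 (A T) \<noteq> \<phi>1 (C T) \<and> \<phi>1 (B T) \<noteq> \<phi>1 (C T)" using td4[OF T, of \<phi>1 "\<sigma> T"] by blast
      moreover have "gD T \<noteq> \<phi>1 (A T)" "gD T \<noteq> \<phi>1 (B T)" "gD T \<noteq> \<phi>1 (C T)" using g[OF T] False by blast+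
      ultimately show ?thesis unfolding e pD[OF T] by metis
    qed
    moreover have "x \<in> {A T, B T, C T, D T}" using xy(1) by (subst (asm) Teq[OF T])
    moreover have "y \<in> {A T, B T, C T, D T}" using xy(2) by (subst (asm) Teq[OF T])
    ultimately show ?thesis using xy(3) by (elim insertE emptyE) auto
  qed
  have "\<phi> x \<noteq> \<phi> y" if xy: "x \<in> U" "y \<in> U" "adj x y" for x y
  proof -
    have e: "{x, y} \<in> edges adj U" "x \<noteq> y" using xy airr by (auto simp: edges_def)
    consider "{x, y} \<in> edges adj S" | "\<exists>T\<in>\<T>. {x, y} \<subseteq> T" | "{x, y} \<in> E" "\<not> (\<exists>T\<in>\<T>. {x, y} \<subseteq> T)"
    proof -
      have "\<exists>T\<in>\<T>. {x, y} \<subseteq> T" if xyD: "{x, y} \<in> Dr"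
      proof -
        obtain T where T: "T \<in> K4s adj U" "{x, y} \<subseteq> T" using drop[OF xyD] by (elim bexE conjE)
        then have "T \<in> \<T>" using xyD unfolding \<T>_def by (intro CollectI conjI bexI[of _ "{x, y}"])
        then show ?thesis using T(2) by (intro bexI[of _ T])
      qed
      then show thesis using that e by (auto simp: E_def)
    qed
    then show ?thesis
    proof cases
      case 1
      then show ?thesis using col pS xy by (auto simp: col_def edge_in_iff)
    next
      case 2
      then show ?thesis using proper e(2) by blast
    next
      case 3
      define v where "v = asg {x, y}"
      have v: "v \<in> {x, y}" "v \<notin> S" using asgE[OF 3(1)] by (auto simp: v_def)
      have vU: "v \<in> U - S" using v xy by blast
      have St: "{x, y} \<in> St v" using 3 by (simp add: St_def v_def)
      then have "\<And>T. T \<in> \<T> \<Longrightarrow> q T v \<noteq> 2" using exclS[OF _ _ vU] by blast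
      then have "\<phi> v = \<phi>1 v" by (rule pN[OF v(2)])
      then have "\<phi> v \<notin> s v" using p1(2)[OF vU] by simp
      then have "\<phi> v \<notin> L x \<inter> L y" using St by (auto simp: s_def)
      then show ?thesis using v(1) pL[OF xy(1)] pL[OF xy(2)] by auto
    qed
  qed
  then have "col adj L U \<phi>" using pL by (simp add: col_def)
  then show ?thesis using pS by blast
qed

end

section \<open>Critical graphs are dense\<close>

lemma two_elems: assumes "2 \<le> card Z" shows "\<exists>x y. x \<in> Z \<and> y \<in> Z \<and> x \<noteq> y"
proof -
  have "finite Z" using assms by (auto intro: card_ge_0_finite)
  then show ?thesis using assms card_le_Suc0_iff_eq[of Z] by fastforce
qed

context listed begin

text \<open>The number of complete subgraphs of \<open>U\<close> on four vertices that have an edge inside \<open>S\<close>.\<close>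

definition Nk :: "'a set \<Rightarrow> 'a set \<Rightarrow> nat" where
  "Nk U S = card {T \<in> K4s adj U. card (T \<inter> S) \<ge> 2}"

lemma finite_K4s: "finite U \<Longrightarrow> finite (K4s adj U)"
  by (rule finite_subset[of _ "Pow U"]) (auto simp: K4s_def)

text \<open>Hall's theorem with the edges outside \<open>S\<close> as items: each vertex outside \<open>S\<close> offers two slots, and each complete graph with
at most one vertex in \<open>S\<close> offers one slot for the edge that it drops. A set of edges violating Hall's
condition spans vertices \<open>R\<close> for which \<open>S \<union> R\<close> would beat \<open>S\<close> in the maximisation.\<close>

lemma assignment_exists:
  assumes U: "U \<subseteq> V" and SU: "S \<subseteq> U"
    and edj: "\<And>T T' e. T \<in> K4s adj U \<Longrightarrow> T' \<in> K4s adj U \<Longrightarrow> e \<in> edges adj U \<Longrightarrow> e \<subseteq> T \<Longrightarrow> e \<subseteq> T' \<Longrightarrow> T = T'"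
    and max: "\<And>R. R \<subseteq> U - S \<Longrightarrow>
      card (edges adj (S \<union> R)) + Nk U S + 2 * card S \<le> card (edges adj S) + Nk U (S \<union> R) + 2 * card (S \<union> R)"
  obtains Dr asg where "Dr \<subseteq> edges adj U"
    "\<And>e. e \<in> edges adj U - edges adj S - Dr \<Longrightarrow> asg e \<in> e - S"
    "\<And>v. v \<in> U - S \<Longrightarrow> card {e \<in> edges adj U - edges adj S - Dr. asg e = v} \<le> 2"
    "\<And>e. e \<in> Dr \<Longrightarrow> \<exists>T\<in>K4s adj U. e \<subseteq> T \<and> card (T \<inter> S) \<le> 1"
    "\<And>T e e'. T \<in> K4s adj U \<Longrightarrow> e \<in> Dr \<Longrightarrow> e' \<in> Dr \<Longrightarrow> e \<subseteq> T \<Longrightarrow> e' \<subseteq> T \<Longrightarrow> e = e'"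
proof -
  have finU: "finite U" using U finV finite_subset by blast
  have finS: "finite S" using SU finU finite_subset by blast
  define I where "I = edges adj U - edges adj S"
  have finI: "finite I" using finite_edges[OF finU] by (simp add: I_def)
  define K where "K = {T \<in> K4s adj U. card (T \<inter> S) \<le> 1}"
  have finK: "finite K" using finite_K4s[OF finU] by (simp add: K_def)
  \<comment> \<open>\<open>Inl (v, b)\<close> are the two slots of \<open>v\<close>, and \<open>Inr T\<close> is taken by the edge that is dropped in \<open>T\<close>\<close>
  define A where "A = (\<lambda>e. (Inl ` ((e - S) \<times> (UNIV :: bool set)) \<union> Inr ` {T \<in> K. e \<subseteq> T} :: ('a \<times> bool + 'a set) set))"
  have fine: "finite e" if "e \<in> I" for e
    using that finU edges_sub finite_subset unfolding I_def by blast
  have "\<exists>f. inj_on f I \<and> (\<forall>e\<in>I. f e \<in> A e)"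
  proof (rule hall_marriage[OF finI])
    show "finite (A e)" if "e \<in> I" for e using fine[OF that] finK by (simp add: A_def)
    fix F assume F: "F \<subseteq> I"
    define R where "R = \<Union> F - S"
    have RU: "R \<subseteq> U - S"
    proof
      fix x assume "x \<in> R"
      then obtain e where "x \<in> e" "e \<in> F" "x \<notin> S" by (auto simp: R_def)
      then show "x \<in> U - S" using F edges_sub[of e U] by (auto simp: I_def)
    qed
    have finR: "finite R" using RU finU finite_subset by blast
    define G where "G = {T \<in> K. \<exists>e\<in>F. e \<subseteq> T}"
    define G' where "G' = {T \<in> K. card (T \<inter> (S \<union> R)) \<ge> 2}"
    have finG: "finite G" "finite G'" using finK by (simp_all add: G_def G'_def)
    have UA: "\<Union> (A ` F) = Inl ` (R \<times> UNIV) \<union> Inr ` G" unfolding A_def R_def G_def by blast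
    have cA: "card (\<Union> (A ` F)) = 2 * card R + card G"
      unfolding UA using finR finG by (subst card_Un_disjoint) (auto simp: card_image card_cartesian_product)
    have N: "Nk U (S \<union> R) = Nk U S + card G'"
    proof -
      have "{T \<in> K4s adj U. card (T \<inter> (S \<union> R)) \<ge> 2} = {T \<in> K4s adj U. card (T \<inter> S) \<ge> 2} \<union> G'"
      proof -
        have "card (T \<inter> S) \<le> card (T \<inter> (S \<union> R))" if "T \<in> K4s adj U" for T
          using finS finR by (intro card_mono) auto
        then show ?thesis unfolding G'_def K_def by (auto intro: order_trans)
      qed
      moreover have "{T \<in> K4s adj U. card (T \<inter> S) \<ge> 2} \<inter> G' = {}" by (auto simp: G'_def K_def)
      ultimately show ?thesis unfolding Nk_def
        using finite_K4s[OF finU] finG by (simp add: card_Un_disjoint)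
    qed
    define X where "X = edges adj (S \<union> R) - edges adj S"
    have SR: "S \<union> R \<subseteq> U" using SU RU by blast
    have finX: "finite X" unfolding X_def using finite_edges finS finR by simp
    have cX: "card X + card (edges adj S) = card (edges adj (S \<union> R))"
    proof -
      have "edges adj S \<subseteq> edges adj (S \<union> R)" by (rule edges_mono) simp
      then show ?thesis unfolding X_def
        using finite_edges[of "S \<union> R"] finS finR by (simp add: card_Diff_subset finite_edges card_mono)
    qed
    have FX: "F \<subseteq> X"
    proof
      fix e assume e: "e \<in> F"
      then have "e \<subseteq> S \<union> R" by (auto simp: R_def)
      then show "e \<in> X" using F e edges_in[of e U "S \<union> R"] by (auto simp: I_def X_def)
    qed
    have "\<forall>T\<in>G' - G. \<exists>e. e \<in> X - F \<and> e \<subseteq> T"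
    proof
      fix T assume T: "T \<in> G' - G"
      have TK: "T \<in> K4s adj U" using T by (simp add: G'_def K_def)
      have "2 \<le> card (T \<inter> (S \<union> R))" using T by (simp add: G'_def)
      then obtain x y where xy: "x \<in> T \<inter> (S \<union> R)" "y \<in> T \<inter> (S \<union> R)" "x \<noteq> y"
        using two_elems by blast
      then have ax: "adj x y" using TK by (auto simp: K4s_def)
      have "{x, y} \<in> edges adj (S \<union> R)" using xy ax by (auto simp: edges_def)
      moreover have "{x, y} \<notin> edges adj S"
      proof
        assume "{x, y} \<in> edges adj S"
        then have "{x, y} \<subseteq> T \<inter> S" using xy by (auto dest: edges_sub)
        then have "card {x, y} \<le> card (T \<inter> S)" using finS by (intro card_mono) auto
        then show False using T xy(3) by (simp add: G'_def K_def)
      qed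
      moreover have "{x, y} \<notin> F" using T xy by (auto simp: G_def G'_def)
      ultimately show "\<exists>e. e \<in> X - F \<and> e \<subseteq> T" using xy by (intro exI[of _ "{x, y}"]) (auto simp: X_def)
    qed
    from bchoice[OF this] obtain \<epsilon> where \<epsilon>: "\<And>T. T \<in> G' - G \<Longrightarrow> \<epsilon> T \<in> X - F \<and> \<epsilon> T \<subseteq> T" by blast
    have "inj_on \<epsilon> (G' - G)"
    proof (rule inj_onI)
      fix T T' assume h: "T \<in> G' - G" "T' \<in> G' - G" "\<epsilon> T = \<epsilon> T'"
      have "\<epsilon> T \<in> edges adj U" using \<epsilon>[OF h(1)] edges_mono[OF SR] by (auto simp: X_def)
      then show "T = T'" using edj[of T T' "\<epsilon> T"] \<epsilon>[OF h(1)] \<epsilon>[OF h(2)] h by (auto simp: G'_def K_def)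
    qed
    then have "card (G' - G) = card (\<epsilon> ` (G' - G))" by (simp add: card_image)
    also have "\<dots> \<le> card (X - F)" using \<epsilon> finX by (intro card_mono) auto
    also have "\<dots> = card X - card F" using FX finX finite_subset by (metis card_Diff_subset)
    finally have "card (G' - G) \<le> card X - card F" .
    moreover have "card F \<le> card X" using FX finX by (rule card_mono[rotated])
    moreover have "card G' \<le> card G + card (G' - G)"
    proof -
      have "card G' \<le> card (G \<union> (G' - G))" using finG by (intro card_mono) auto
      also have "\<dots> \<le> card G + card (G' - G)" by (rule card_Un_le)
      finally show ?thesis .
    qed
    moreover have "card (S \<union> R) = card S + card R" using finS finR RU by (intro card_Un_disjoint) auto
    ultimately show "card F \<le> card (\<Union> (A ` F))" using max[OF RU] cX N cA by linarith
  qed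
  then obtain f where f: "inj_on f I" "\<And>e. e \<in> I \<Longrightarrow> f e \<in> A e" by blast
  define Dr where "Dr = {e \<in> I. \<exists>T. f e = Inr T}"
  define asg where "asg = (\<lambda>e. fst (projl (f e)))"
  have I': "edges adj U - edges adj S - Dr = I - Dr" by (simp add: I_def)
  have nd: "\<exists>v b. f e = Inl (v, b) \<and> v \<in> e - S" if "e \<in> I - Dr" for e
    using f(2)[of e] that by (auto simp: A_def Dr_def)
  show thesis
  proof (rule that[of Dr asg])
    show "Dr \<subseteq> edges adj U" by (auto simp: Dr_def I_def)
    show "asg e \<in> e - S" if "e \<in> edges adj U - edges adj S - Dr" for e
      using nd[of e] that unfolding I' asg_def by auto
    show "card {e \<in> edges adj U - edges adj S - Dr. asg e = v} \<le> 2" for v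
    proof -
      let ?Y = "{e \<in> I - Dr. asg e = v}"
      have "f ` ?Y \<subseteq> {Inl (v, True), Inl (v, False)}"
      proof
        fix z assume "z \<in> f ` ?Y"
        then obtain e where e: "e \<in> I - Dr" "asg e = v" "z = f e" by blast
        then show "z \<in> {Inl (v, True), Inl (v, False)}" using nd[OF e(1)] by (auto simp: asg_def)
      qed
      then have "card (f ` ?Y) \<le> card {Inl (v, True), Inl (v, False) :: 'a \<times> bool + 'a set}" by (intro card_mono) auto
      moreover have "card (f ` ?Y) = card ?Y" by (rule card_image) (rule inj_on_subset[OF f(1)], auto)
      ultimately show ?thesis unfolding I' by simp
    qed
    show "\<exists>T\<in>K4s adj U. e \<subseteq> T \<and> card (T \<inter> S) \<le> 1" if "e \<in> Dr" for e
      using f(2)[of e] that by (auto simp: A_def Dr_def K_def)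
    show "e = e'" if "T \<in> K4s adj U" "e \<in> Dr" "e' \<in> Dr" "e \<subseteq> T" "e' \<subseteq> T" for T e e'
    proof -
      have *: "f d = Inr T" if d: "d \<in> Dr" "d \<subseteq> T" for d
      proof -
        obtain T1 where T1: "f d = Inr T1" "d \<in> I" using d(1) by (auto simp: Dr_def)
        then have "T1 \<in> K4s adj U" "d \<subseteq> T1" using f(2)[of d] by (auto simp: A_def K_def)
        then show ?thesis using edj[OF _ \<open>T \<in> K4s adj U\<close>, of T1 d] T1 d(2) by (auto simp: I_def)
      qed
      have "f e = f e'" using *[OF that(2,4)] *[OF that(3,5)] by simp
      then show ?thesis using f(1) that(2,3) by (auto simp: Dr_def dest: inj_onD)
    qed
  qed
qed

text \<open>Take \<open>S\<close> containing \<open>x0\<close> that maximises edges minus twice vertices minus \<open>Nk\<close>. If \<open>S\<close> were not all of \<open>U\<close>, its colouring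
would extend to \<open>U\<close>. So \<open>U\<close> is a maximiser, and the bound is the comparison with \<open>S = {x0}\<close>, of value \<open>-2\<close>.\<close>

lemma critical_dense:
  assumes U: "U \<subseteq> V" and x0: "x0 \<in> U"
    and edj: "\<And>T T' e. T \<in> K4s adj U \<Longrightarrow> T' \<in> K4s adj U \<Longrightarrow> e \<in> edges adj U \<Longrightarrow> e \<subseteq> T \<Longrightarrow> e \<subseteq> T' \<Longrightarrow> T = T'"
    and small: "\<And>S. S \<subset> U \<Longrightarrow> x0 \<in> S \<Longrightarrow> \<exists>\<phi>. col adj L S \<phi> \<and> \<phi> x0 = p"
    and bad: "\<not> (\<exists>\<phi>. col adj L U \<phi> \<and> \<phi> x0 = p)"
  shows "2 * card U + card (K4s adj U) \<le> card (edges adj U) + 2"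
proof -
  have finU: "finite U" using U finV finite_subset by blast
  define f where "f = (\<lambda>S. int (card (edges adj S)) - 2 * int (card S) - int (Nk U S))"
  define M where "M = {S. x0 \<in> S \<and> S \<subseteq> U}"
  have M: "finite M" "M \<noteq> {}" using finU x0 by (auto simp: M_def)
  obtain S where S: "S \<in> M" "\<And>S'. S' \<in> M \<Longrightarrow> f S' \<le> f S"
  proof -
    have "Max (f ` M) \<in> f ` M" using M by (intro Max_in) auto
    then obtain S where "S \<in> M" "f S = Max (f ` M)" by auto
    then show thesis using that[of S] M(1) by simp
  qed
  have "S = U"
  proof (rule ccontr)
    assume "S \<noteq> U"
    then have SU: "S \<subset> U" "S \<subseteq> U" "x0 \<in> S" using S(1) by (auto simp: M_def)
    obtain \<phi>0 where p0: "col adj L S \<phi>0" "\<phi>0 x0 = p" using small[OF SU(1,3)] by blast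
    have mx: "card (edges adj (S \<union> R)) + Nk U S + 2 * card S \<le> card (edges adj S) + Nk U (S \<union> R) + 2 * card (S \<union> R)"
      if "R \<subseteq> U - S" for R
    proof -
      have "S \<union> R \<in> M" using that SU by (auto simp: M_def)
      then have "f (S \<union> R) \<le> f S" by (rule S(2))
      then show ?thesis by (simp add: f_def)
    qed
    show False
    proof (rule assignment_exists[OF U SU(2) edj mx], assumption+)
      fix Dr asg
      assume h: "Dr \<subseteq> edges adj U"
        "\<And>e. e \<in> edges adj U - edges adj S - Dr \<Longrightarrow> asg e \<in> e - S"
        "\<And>v. v \<in> U - S \<Longrightarrow> card {e \<in> edges adj U - edges adj S - Dr. asg e = v} \<le> 2"
        "\<And>e. e \<in> Dr \<Longrightarrow> \<exists>T\<in>K4s adj U. e \<subseteq> T \<and> card (T \<inter> S) \<le> 1"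
        "\<And>T e e'. T \<in> K4s adj U \<Longrightarrow> e \<in> Dr \<Longrightarrow> e' \<in> Dr \<Longrightarrow> e \<subseteq> T \<Longrightarrow> e' \<subseteq> T \<Longrightarrow> e = e'"
      have "\<exists>\<phi>. col adj L U \<phi> \<and> (\<forall>v\<in>S. \<phi> v = \<phi>0 v)"
        by (rule extend_by_assignment[OF U SU(2) p0(1) h(1)])
          (erule h(2), erule h(3), erule h(4), (rule h(5); assumption), (rule edj; assumption))
      then obtain \<phi> where \<phi>: "col adj L U \<phi>" "\<forall>v\<in>S. \<phi> v = \<phi>0 v" by (elim exE conjE)
      have "\<phi> x0 = p" using bspec[OF \<phi>(2) SU(3)] p0(2) by simp
      then show False using bad \<phi>(1) by simp
    qed
  qed
  then have "f {x0} \<le> f U" using S(2)[of "{x0}"] x0 by (auto simp: M_def)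
  moreover have "edges adj {x0} = {}" using airr by (auto simp: edges_def)
  moreover have "Nk U U = card (K4s adj U)"
  proof -
    have "{T \<in> K4s adj U. card (T \<inter> U) \<ge> 2} = K4s adj U" by (auto simp: K4s_def Int_absorb2)
    then show ?thesis by (simp add: Nk_def)
  qed
  moreover have "Nk U {x0} = 0"
  proof -
    have "{T \<in> K4s adj U. card (T \<inter> {x0}) \<ge> 2} = {}"
    proof -
      have "card (T \<inter> {x0}) \<le> 1" for T using card_mono[of "{x0}" "T \<inter> {x0}"] by auto
      then show ?thesis by (auto simp: not_le less_Suc_eq_le numeral_2_eq_2)
    qed
    then show ?thesis unfolding Nk_def by (simp only: card.empty)
  qed
  ultimately show ?thesis by (simp add: f_def)
qed

end

section \<open>Reducible configurations\<close>

definition nb :: "('a \<Rightarrow> 'a \<Rightarrow> bool) \<Rightarrow> 'a set \<Rightarrow> 'a \<Rightarrow> 'a set" where "nb R U x = {y \<in> U. R x y}"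

text \<open>A triangle at \<open>x\<close> with a vertex \<open>c\<close> of degree three that can be coloured after \<open>x\<close> and its other neighbours. Seen from \<open>x\<close>, the two vertices \<open>b\<close>, \<open>c\<close> block only one colour, like a single neighbour.\<close>

definition pocket :: "('a \<Rightarrow> 'a \<Rightarrow> bool) \<Rightarrow> 'a set \<Rightarrow> 'a \<Rightarrow> 'a \<Rightarrow> 'a \<Rightarrow> 'a \<Rightarrow> bool" where
  "pocket R U x0 x b c \<longleftrightarrow> b \<in> U \<and> c \<in> U \<and> c \<noteq> x0 \<and> R x b \<and> R x c \<and> R b c \<and> card (nb R U c) = 3"

text \<open>Outside \<open>Z\<close>, the vertex \<open>x\<close> has a single neighbour or a pocket, which blocks a single colour either way.\<close>

definition tail :: "('a \<Rightarrow> 'a \<Rightarrow> bool) \<Rightarrow> 'a set \<Rightarrow> 'a \<Rightarrow> 'a \<Rightarrow> 'a set \<Rightarrow> bool" where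
  "tail R U x0 x Z \<longleftrightarrow> (\<exists>b. nb R U x - Z = {b}) \<or> (\<exists>b c. nb R U x - Z = {b, c} \<and> pocket R U x0 x b c)"

lemma ex_avoid:
  assumes "card X \<ge> n" "card Y < n" "finite Y"
  shows "\<exists>x\<in>X. x \<notin> Y"
proof (rule ccontr)
  assume "\<not> ?thesis"
  then have "X \<subseteq> Y" by blast
  from card_mono[OF assms(3) this] show False using assms(1,2) by linarith
qed

lemma card_le_2: "card {p, q} \<le> 2" by (simp add: card_insert_if)

text \<open>\<open>x\<close> and \<open>y\<close> see a coloured common neighbour (\<open>p\<close>) and lose one more colour each (\<open>q\<close>, \<open>r\<close>).\<close>

lemma triangle_pair:
  assumes c: "card X = 3" "card Y = 3" and m: "card (X \<inter> Y) \<le> 1"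
  shows "\<exists>\<alpha>\<in>X. \<exists>\<beta>\<in>Y. \<alpha> \<noteq> \<beta> \<and> \<alpha> \<notin> {p, q} \<and> \<beta> \<notin> {p, r}"
proof -
  have f: "finite X" "finite Y" using c by (simp_all add: card_ge_0_finite)
  have common: "u = w" if "u \<in> X" "u \<in> Y" "w \<in> X" "w \<in> Y" for u w
    using card_le_1_eq[OF _ m, of u w] f that by simp
  have c2: "card {u, w} < 3" for u w :: 'a using card_le_2[of u w] by linarith
  consider "p \<in> X" "p \<in> Y" | "p \<notin> Y" | "p \<notin> X" by blast
  then show ?thesis
  proof cases
    case 1
    obtain a where a: "a \<in> X" "a \<notin> {p, q}" using ex_avoid[of 3 X "{p, q}"] c c2 by auto
    obtain b where b: "b \<in> Y" "b \<notin> {p, r}" using ex_avoid[of 3 Y "{p, r}"] c c2 by auto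
    have "a \<noteq> b" using common[of a p] a b 1 by auto
    then show ?thesis using a b by - (rule bexI[of _ a], rule bexI[of _ b], auto)
  next
    case 2
    obtain a where a: "a \<in> X" "a \<notin> {p, q}" using ex_avoid[of 3 X "{p, q}"] c c2 by auto
    obtain b where b: "b \<in> Y" "b \<notin> {a, r}" using ex_avoid[of 3 Y "{a, r}"] c c2 by auto
    have "b \<noteq> p" using b 2 by metis
    then show ?thesis using a b by - (rule bexI[of _ a], rule bexI[of _ b], auto)
  next
    case 3
    obtain b where b: "b \<in> Y" "b \<notin> {p, r}" using ex_avoid[of 3 Y "{p, r}"] c c2 by auto
    obtain a where a: "a \<in> X" "a \<notin> {b, q}" using ex_avoid[of 3 X "{b, q}"] c c2 by auto
    have "a \<noteq> p" using a 3 by metis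
    then show ?thesis using a b by - (rule bexI[of _ a], rule bexI[of _ b], auto)
  qed
qed

text \<open>As before, with a third vertex \<open>\<gamma>\<close>, adjacent to the whole triangle and to nothing else, that is coloured along with the two.\<close>

lemma triangle_triple:
  assumes c: "card X = 3" "card Y = 3" "card Z = 3" and m: "card (X \<inter> Y) \<le> 1" "card (X \<inter> Z) \<le> 1" "card (Y \<inter> Z) \<le> 1"
  shows "\<exists>\<alpha>\<in>X. \<exists>\<beta>\<in>Y. \<exists>\<gamma>\<in>Z. \<alpha> \<noteq> \<beta> \<and> \<alpha> \<noteq> \<gamma> \<and> \<beta> \<noteq> \<gamma> \<and> \<alpha> \<notin> {p, q} \<and> \<beta> \<notin> {p, r} \<and> \<gamma> \<noteq> p"
proof -
  have f: "finite X" "finite Y" "finite Z" using c by (simp_all add: card_ge_0_finite)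
  have XZ: "u = w" if "u \<in> X" "u \<in> Z" "w \<in> X" "w \<in> Z" for u w
    using card_le_1_eq[OF _ m(2), of u w] f that by simp
  have YZ: "u = w" if "u \<in> Y" "u \<in> Z" "w \<in> Y" "w \<in> Z" for u w
    using card_le_1_eq[OF _ m(3), of u w] f that by simp
  have c2: "card {u, w} < 3" for u w :: 'a using card_le_2[of u w] by linarith
  show ?thesis
  proof (cases "p \<in> Z")
    case False
    obtain a b where ab: "a \<in> X" "b \<in> Y" "a \<noteq> b" "a \<notin> {p, q}" "b \<notin> {p, r}"
      using triangle_pair[OF c(1,2) m(1), of p q r] by (elim bexE conjE)
    obtain g where g: "g \<in> Z" "g \<notin> {a, b}" using ex_avoid[of 3 Z "{a, b}"] c c2 by auto
    have "g \<noteq> p" using g False by metis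
    then show ?thesis using ab g by - (rule bexI[of _ a], rule bexI[of _ b], rule bexI[of _ g], auto)
  next
    case pZ: True
    have Z2: "card (Z - {p}) = 2" using c(3) f pZ by simp
    have Zx: "\<exists>g\<in>Z. g \<noteq> p \<and> g \<noteq> u" for u
      using ex_avoid[of 3 Z "{p, u}"] c c2 by auto
    show ?thesis
    proof (cases "p \<in> X")
      case True
      obtain a b where ab: "a \<in> X" "b \<in> Y" "a \<noteq> b" "a \<notin> {p, q}" "b \<notin> {p, r}"
        using triangle_pair[OF c(1,2) m(1), of p q r] by (elim bexE conjE)
      obtain g where g: "g \<in> Z" "g \<noteq> p" "g \<noteq> b" using Zx by blast
      have "a \<notin> Z" using XZ[of a p] ab True pZ by auto
      then have "a \<noteq> g" using g by metis
      then show ?thesis using ab g by - (rule bexI[of _ a], rule bexI[of _ b], rule bexI[of _ g], auto)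
    next
      case pX: False
      show ?thesis
      proof (cases "p \<in> Y")
        case True
        obtain a b where ab: "a \<in> X" "b \<in> Y" "a \<noteq> b" "a \<notin> {p, q}" "b \<notin> {p, r}"
          using triangle_pair[OF c(1,2) m(1), of p q r] by (elim bexE conjE)
        obtain g where g: "g \<in> Z" "g \<noteq> p" "g \<noteq> a" using Zx by blast
        have "b \<notin> Z" using YZ[of b p] ab True pZ by auto
        then have "b \<noteq> g" using g by metis
        then show ?thesis using ab g by - (rule bexI[of _ a], rule bexI[of _ b], rule bexI[of _ g], auto)
      next
        case pY: False
        have "card (X - Z) \<ge> 2" using c(1) m(2) f card_Diff_subset_Int[of X Z] by simp
        then obtain a where a: "a \<in> X - Z" "a \<notin> {q}" using ex_avoid[of 2 "X - Z" "{q}"] by auto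
        obtain b where b: "b \<in> Y" "b \<notin> {a, r}" using ex_avoid[of 3 Y "{a, r}"] c c2 by auto
        obtain g where g: "g \<in> Z" "g \<noteq> p" "g \<noteq> b" using Zx by blast
        have "a \<noteq> p" "b \<noteq> p" "a \<noteq> g" using a b g pX pY by auto
        then show ?thesis using a b g by - (rule bexI[of _ a], rule bexI[of _ b], rule bexI[of _ g], auto)
      qed
    qed
  qed
qed

text \<open>If \<open>p\<close>, the colour of \<open>b\<close>, is in the list of \<open>x\<close>, then \<open>p\<close> is the only blocked colour: the list of \<open>c\<close> is exhausted only if it contains \<open>p\<close>, and then the lists
of \<open>x\<close> and \<open>c\<close> have no other common colour. Otherwise only a common colour of the two lists can be blocked.\<close>

lemma pocket_blocks:
  fixes Lx Lc :: "'c set"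
  assumes c: "card Lx = 3" "card Lc = 3" and m: "card (Lx \<inter> Lc) \<le> 1"
  shows "\<exists>\<beta>. \<forall>\<alpha>\<in>Lx. \<alpha> \<noteq> \<beta> \<longrightarrow> \<alpha> \<noteq> p \<and> (\<exists>\<gamma>\<in>Lc. \<gamma> \<noteq> \<alpha> \<and> \<gamma> \<noteq> p \<and> \<gamma> \<noteq> q)"
proof -
  have f: "finite Lx" "finite Lc" using c by (simp_all add: card_ge_0_finite)
  have full: "Lc = {a, p, q} \<and> a \<noteq> p \<and> a \<noteq> q" if "\<not> (\<exists>\<gamma>\<in>Lc. \<gamma> \<noteq> a \<and> \<gamma> \<noteq> p \<and> \<gamma> \<noteq> q)" for a
  proof -
    have s: "Lc \<subseteq> {a, p, q}" using that by blast
    moreover have "card {a, p, q} \<le> card Lc" using c(2) by (simp add: card_insert_if)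
    ultimately have e: "Lc = {a, p, q}" by (intro card_seteq) auto
    then show ?thesis using c(2) by (auto simp: card_insert_if split: if_splits)
  qed
  show ?thesis
  proof (cases "p \<in> Lx")
    case True
    show ?thesis
    proof (intro exI[of _ p] ballI impI conjI)
      fix a assume a: "a \<in> Lx" "a \<noteq> p"
      show "a \<noteq> p" by (rule a(2))
      show "\<exists>\<gamma>\<in>Lc. \<gamma> \<noteq> a \<and> \<gamma> \<noteq> p \<and> \<gamma> \<noteq> q"
      proof (rule ccontr)
        assume "\<not> ?thesis"
        then have "Lc = {a, p, q}" using full by blast
        then show False using card_le_1_eq[OF _ m, of a p] f a True by auto
      qed
    qed
  next
    case False
    show ?thesis
    proof (cases "\<exists>a\<in>Lx. \<not> (\<exists>\<gamma>\<in>Lc. \<gamma> \<noteq> a \<and> \<gamma> \<noteq> p \<and> \<gamma> \<noteq> q)")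
      case True
      then obtain a where a: "a \<in> Lx" "\<not> (\<exists>\<gamma>\<in>Lc. \<gamma> \<noteq> a \<and> \<gamma> \<noteq> p \<and> \<gamma> \<noteq> q)" by blast
      show ?thesis
      proof (intro exI[of _ a] ballI impI conjI)
        fix a' assume a': "a' \<in> Lx" "a' \<noteq> a"
        show "a' \<noteq> p" using a' False by metis
        show "\<exists>\<gamma>\<in>Lc. \<gamma> \<noteq> a' \<and> \<gamma> \<noteq> p \<and> \<gamma> \<noteq> q"
          using full[OF a(2)] a'(2) by (intro bexI[of _ a]) auto
      qed
    next
      case no: False
      then show ?thesis using False by (intro exI[of _ p]) auto
    qed
  qed
qed

text \<open>A minimal counterexample to colouring with the colour \<open>p0\<close> prescribed at \<open>x0\<close>.\<close>

locale critical = listed V adj L for V :: "'a set" and adj and L :: "'a \<Rightarrow> 'c set" +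
  fixes U :: "'a set" and x0 :: 'a and p0 :: 'c
  assumes UV: "U \<subseteq> V" and x0U: "x0 \<in> U"
    and smaller: "\<And>S. S \<subset> U \<Longrightarrow> x0 \<in> S \<Longrightarrow> \<exists>\<phi>. col adj L S \<phi> \<and> \<phi> x0 = p0"
    and stuck: "\<not> (\<exists>\<phi>. col adj L U \<phi> \<and> \<phi> x0 = p0)"
    and no5: "distinct [a, b, c, d, e] \<Longrightarrow> adj a b \<Longrightarrow> adj b c \<Longrightarrow> adj c d \<Longrightarrow> adj d e \<Longrightarrow> adj e a \<Longrightarrow> False"
begin

abbreviation "N \<equiv> nb adj U"

lemma finU: "finite U" using UV finV finite_subset by blast

lemma finN: "finite (N x)" using finU by (simp add: nb_def)

lemma NU: "y \<in> N x \<longleftrightarrow> y \<in> U \<and> adj x y" by (simp add: nb_def)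

text \<open>Any set \<open>W\<close> that avoids \<open>x0\<close> can be deleted; reducibility means that the colouring of the rest extends to \<open>W\<close>.\<close>

lemma deleted_set_not_extendable:
  assumes W: "W \<subseteq> U" "W \<noteq> {}" "x0 \<notin> W"
    and ext: "\<And>\<phi>. col adj L (U - W) \<phi> \<Longrightarrow> \<exists>\<psi>. (\<forall>w\<in>W. \<psi> w \<in> L w) \<and> (\<forall>w\<in>W. \<forall>y\<in>N w. \<psi> w \<noteq> (if y \<in> W then \<psi> y else \<phi> y))"
  shows False
proof -
  obtain \<phi> where p: "col adj L (U - W) \<phi>" "\<phi> x0 = p0" using smaller[of "U - W"] W x0U by blast
  obtain \<psi> where s: "\<forall>w\<in>W. \<psi> w \<in> L w" "\<forall>w\<in>W. \<forall>y\<in>N w. \<psi> w \<noteq> (if y \<in> W then \<psi> y else \<phi> y)" using ext[OF p(1)] by blast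
  let ?f = "\<lambda>v. if v \<in> W then \<psi> v else \<phi> v"
  have "col adj L U ?f" unfolding col_def
  proof (intro conjI ballI impI)
    fix v assume "v \<in> U" then show "?f v \<in> L v" using s(1) p(1) by (auto simp: col_def)
  next
    fix x y assume xy: "x \<in> U" "y \<in> U" "adj x y"
    show "?f x \<noteq> ?f y"
    proof (cases "x \<in> W")
      case True then show ?thesis using s(2) xy by (simp add: nb_def)
    next
      case xW: False
      show ?thesis
      proof (cases "y \<in> W")
        case True
        then have "\<psi> y \<noteq> (if x \<in> W then \<psi> x else \<phi> x)" using s(2) xy asym[OF xy(3)] by (simp add: nb_def)
        then show ?thesis using True xW by simp
      next
        case False then show ?thesis using xW p(1) xy by (simp add: col_def)
      qed
    qed
  qed
  moreover have "?f x0 = p0" using p(2) W(3) by simp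
  ultimately show False using stuck by blast
qed

lemma LU: "v \<in> U \<Longrightarrow> card (L v) = 3" using list3 UV by blast

lemma degree_ge_3:
  assumes "v \<in> U" "v \<noteq> x0" shows "card (N v) \<ge> 3"
proof (rule ccontr)
  assume d: "\<not> ?thesis"
  show False
  proof (rule deleted_set_not_extendable[of "{v}"])
    fix \<phi> :: "'a \<Rightarrow> 'c"
    have "card (\<phi> ` N v) < 3" using d card_image_le[OF finN, of \<phi> v] by linarith
    then obtain a where "a \<in> L v" "a \<notin> \<phi> ` N v" using ex_avoid[of 3 "L v" "\<phi> ` N v"] LU[OF assms(1)] finN by auto
    moreover have "v \<notin> N v" using airr by (simp add: nb_def)
    ultimately show "\<exists>\<psi>. (\<forall>w\<in>{v}. \<psi> w \<in> L w) \<and> (\<forall>w\<in>{v}. \<forall>y\<in>N w. \<psi> w \<noteq> (if y \<in> {v} then \<psi> y else \<phi> y))"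
      by (intro exI[of _ "\<lambda>_. a"]) auto
  qed (use assms in auto)
qed

text \<open>A tail blocks a single colour.  \<open>C\<close> collects the degree-three vertex of a pocket.\<close>

definition tails :: "'a \<Rightarrow> 'a set \<Rightarrow> 'a \<Rightarrow> 'a set \<Rightarrow> bool" where
  "tails x Z b C \<longleftrightarrow> b \<in> N x - Z \<and> b \<notin> C \<and> N x - Z = insert b C \<and> x0 \<notin> C \<and>
     (C = {} \<or> (\<exists>c d. C = {c} \<and> adj b c \<and> N c = {x, b, d} \<and> d \<noteq> x \<and> d \<noteq> b))"

lemma tail_tails:
  assumes "tail adj U x0 x Z" "x \<in> U" obtains b C where "tails x Z b C"
proof -
  from assms(1) consider b where "N x - Z = {b}" | b c where "N x - Z = {b, c}" "pocket adj U x0 x b c"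
    unfolding tail_def by blast
  then show thesis
  proof cases
    case 1 then have "tails x Z b {}" unfolding tails_def by auto
    then show thesis by (rule that)
  next
    case 2
    have p: "c \<noteq> x0" "adj b c" "card (N c) = 3" "b \<in> U" "c \<in> U" "adj x b" "adj x c" using 2(2) by (simp_all add: pocket_def)
    have xb: "x \<in> N c" "b \<in> N c" "x \<noteq> b" using p assms(2) asym airr by (auto simp: nb_def)
    then have "card (N c - {x, b}) = 1" using p(3) finN by (simp add: card_Diff_subset)
    then obtain d where d: "N c - {x, b} = {d}" by (auto simp: card_1_singleton_iff)
    have "N c = {x, b, d}" using d xb by blast
    moreover have "d \<noteq> x" "d \<noteq> b" using d by blast+
    moreover have "b \<noteq> c" using p(2) airr by auto
    ultimately have "tails x Z b {c}" using 2(1) p by (auto simp: tails_def)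
    then show thesis by (rule that)
  qed
qed

lemma tails_block:
  assumes t: "tails x Z b C" and x: "x \<in> U"
  shows "\<exists>\<beta>. \<forall>\<alpha>\<in>L x. \<alpha> \<noteq> \<beta> \<longrightarrow> \<alpha> \<noteq> \<phi> b \<and> (\<forall>c\<in>C. \<exists>\<gamma>\<in>L c. \<gamma> \<noteq> \<alpha> \<and> (\<forall>y\<in>N c - {x}. \<gamma> \<noteq> \<phi> y))"
proof (cases "C = {}")
  case False
  then obtain c d where c: "C = {c}" "adj b c" "N c = {x, b, d}" "d \<noteq> x" "d \<noteq> b" using t by (auto simp: tails_def)
  have "c \<in> N x" using t c by (auto simp: tails_def)
  then have cU: "c \<in> U" "adj x c" by (simp_all add: nb_def)
  have bx: "b \<noteq> x" using t airr by (auto simp: tails_def nb_def)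
  obtain \<beta> where "\<forall>\<alpha>\<in>L x. \<alpha> \<noteq> \<beta> \<longrightarrow> \<alpha> \<noteq> \<phi> b \<and> (\<exists>\<gamma>\<in>L c. \<gamma> \<noteq> \<alpha> \<and> \<gamma> \<noteq> \<phi> b \<and> \<gamma> \<noteq> \<phi> d)"
    using pocket_blocks[OF LU[OF x] LU[OF cU(1)] meet[OF cU(2)], of "\<phi> b" "\<phi> d"] by (elim exE)
  then show ?thesis using c bx by (intro exI[of _ \<beta>]) auto
qed auto

lemma tails_facts:
  assumes t: "tails x Z b C" and x: "x \<in> U" and yz: "y \<in> N x" "z \<in> N x" "adj y z" "y \<in> Z" "z \<in> Z" "y \<noteq> z"
  shows "\<And>c. c \<in> C \<Longrightarrow> c \<in> U \<and> adj x c \<and> c \<notin> Z \<and> c \<noteq> x \<and> \<not> adj c y \<and> \<not> adj c z \<and> c \<noteq> b \<and> card (N c) = 3 \<and> adj b c"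
    "\<And>c. c \<in> C \<Longrightarrow> \<not> adj b y" "b \<in> U" "adj x b" "b \<notin> Z" "b \<noteq> x" "x0 \<notin> C" "N x \<subseteq> insert b (C \<union> Z)" "b \<notin> C"
proof -
  show b: "b \<in> U" "adj x b" "b \<notin> Z" "b \<noteq> x" using t airr by (auto simp: tails_def nb_def)
  show "x0 \<notin> C" "N x \<subseteq> insert b (C \<union> Z)" "b \<notin> C" using t by (auto simp: tails_def)
  fix c assume cC: "c \<in> C"
  obtain d where c: "C = {c}" "adj b c" "N c = {x, b, d}" "d \<noteq> x" "d \<noteq> b" using t cC by (auto simp: tails_def)
  have cN: "c \<in> N x - Z" using t cC unfolding tails_def by blast
  have c1: "c \<in> U" "adj x c" "c \<notin> Z" "c \<noteq> x" "c \<noteq> b" using cN c(2) airr by (auto simp: nb_def)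
  have a: "adj x y" "adj x z" "x \<noteq> y" "x \<noteq> z" using yz airr by (auto simp: nb_def)
  have d5: "c \<noteq> y" "c \<noteq> z" "b \<noteq> y" "b \<noteq> z" using c1 b yz by auto
  have "\<not> adj c y"
    using no5[of x z y c b] a d5 c1 b c(2) yz(3,6) asym by auto
  moreover have "\<not> adj c z"
    using no5[of x y z c b] a d5 c1 b c(2) yz(3,6) asym by auto
  moreover have "card (N c) = 3" using c(3,4,5) b(4) by simp
  ultimately show "c \<in> U \<and> adj x c \<and> c \<notin> Z \<and> c \<noteq> x \<and> \<not> adj c y \<and> \<not> adj c z \<and> c \<noteq> b \<and> card (N c) = 3 \<and> adj b c"
    using c1 c(2) by blast
  show "\<not> adj b y"
    using no5[of x z y b c] a d5 c1 b c(2) yz(3,6) asym by auto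
qed

text \<open>Two vertices of a triangle whose remaining neighbours form tails can be coloured last,
  together with a common neighbour of degree three of the whole triangle, if there is one (\<open>Q\<close>).\<close>

lemma no_two_tails:
  assumes xyz: "x \<in> U" "y \<in> U" "z \<in> U" "adj x y" "adj x z" "adj y z" "x \<noteq> x0" "y \<noteq> x0"
    and Q: "Q = {} \<or> (\<exists>v. Q = {v} \<and> v \<in> U \<and> v \<noteq> x0 \<and> N v = {x, y, z})"
    and tx: "tail adj U x0 x ({y, z} \<union> Q)" and ty: "tail adj U x0 y ({x, z} \<union> Q)"
  shows False
proof -
  obtain bx Cx where X: "tails x ({y, z} \<union> Q) bx Cx" using tail_tails[OF tx xyz(1)] .
  obtain b'y Cy where Y: "tails y ({x, z} \<union> Q) b'y Cy" using tail_tails[OF ty xyz(2)] .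
  have ne: "x \<noteq> y" "x \<noteq> z" "y \<noteq> z" using xyz airr by auto
  have inN: "y \<in> N x" "z \<in> N x" "x \<in> N y" "z \<in> N y" using xyz asym by (auto simp: nb_def)
  have Qv: "v \<in> U" "v \<noteq> x0" "N v = {x, y, z}" "v \<noteq> x" "v \<noteq> y" "v \<noteq> z" "Q = {v}" if "v \<in> Q" for v
    using Q that airr by (auto simp: nb_def)
  have mem: "y \<in> {y, z} \<union> Q" "z \<in> {y, z} \<union> Q" "x \<in> {x, z} \<union> Q" "z \<in> {x, z} \<union> Q" by simp_all
  note FX = tails_facts[OF X xyz(1) inN(1,2) xyz(6) mem(1,2) ne(3)]
  note FY = tails_facts[OF Y xyz(2) inN(3,4) xyz(5) mem(3,4) ne(2)]
  have Cdisj: "c \<noteq> c'" "\<not> adj c c'" if "c \<in> Cx" "c' \<in> Cy" for c c'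
  proof -
    show n: "c \<noteq> c'" using FX(1)[OF that(1)] FY(1)[OF that(2)] asym by blast
    show "\<not> adj c c'"
      using no5[of x c c' y z] FX(1)[OF that(1)] FY(1)[OF that(2)] n ne xyz asym by auto
  qed
  have Csingle: "c = c'" if "c \<in> Cx" "c' \<in> Cx" for c c' using X that by (auto simp: tails_def)
  have Csingle': "c = c'" if "c \<in> Cy" "c' \<in> Cy" for c c' using Y that by (auto simp: tails_def)
  \<comment> \<open>the set to be coloured last: the two vertices, the inner vertex and the degree-three vertices of the pockets\<close>
  define W where "W = {x, y} \<union> Q \<union> Cx \<union> Cy"
  have bW: "bx \<notin> W" "b'y \<notin> W"
  proof -
    have "bx \<notin> Cy" using FX(2) FY(1)[of bx] FX(4) X asym by (metis FX(4) FX(6) FY(1) xyz(4))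
    then show "bx \<notin> W" using FX(5,6,9) by (auto simp: W_def)
    have "b'y \<notin> Cx" using FX(1)[of b'y] FY(4) asym by blast
    then show "b'y \<notin> W" using FY(5,6,9) by (auto simp: W_def)
  qed
  have zW: "z \<notin> W"
  proof -
    have "z \<notin> Cx" "z \<notin> Cy" using FX(1)[of z] FY(1)[of z] by auto
    then show ?thesis using Qv(6) ne by (auto simp: W_def)
  qed
  have cN: "u \<notin> W" if "c \<in> Cx" "u \<in> N c - {x}" for c u
  proof
    assume u: "u \<in> W"
    have "adj c u" using that by (simp add: nb_def)
    have "u \<noteq> y" using FX(1)[OF that(1)] \<open>adj c u\<close> by auto
    moreover have "u \<notin> Cy" using Cdisj(2)[OF that(1)] \<open>adj c u\<close> by auto
    moreover have "u \<notin> Cx" using Csingle[OF that(1)] \<open>adj c u\<close> airr by auto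
    moreover have "u \<notin> Q"
    proof
      assume "u \<in> Q"
      then have "c \<in> {x, y, z}" using Qv(3)[of u] asym[OF \<open>adj c u\<close>] FX(1)[OF that(1)] by (metis NU)
      then show False using FX(1)[OF that(1)] by auto
    qed
    ultimately show False using u that by (auto simp: W_def)
  qed
  have cN': "u \<notin> W" if "c \<in> Cy" "u \<in> N c - {y}" for c u
  proof
    assume u: "u \<in> W"
    have "adj c u" using that by (simp add: nb_def)
    have "u \<noteq> x" using FY(1)[OF that(1)] \<open>adj c u\<close> by auto
    moreover have "u \<notin> Cx" using Cdisj(2)[OF _ that(1)] asym[OF \<open>adj c u\<close>] by auto
    moreover have "u \<notin> Cy" using Csingle'[OF that(1)] \<open>adj c u\<close> airr by auto
    moreover have "u \<notin> Q"
    proof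
      assume "u \<in> Q"
      then have "c \<in> {x, y, z}" using Qv(3)[of u] asym[OF \<open>adj c u\<close>] FY(1)[OF that(1)] by (metis NU)
      then show False using FY(1)[OF that(1)] by auto
    qed
    ultimately show False using u that by (auto simp: W_def)
  qed
  show False
  proof (rule deleted_set_not_extendable[of W])
    show "W \<subseteq> U" using xyz Qv(1) FX(1) FY(1) by (auto simp: W_def)
    show "W \<noteq> {}" by (simp add: W_def)
    have "x0 \<notin> Q" using Qv(2)[of x0] by metis
    moreover have "x0 \<notin> Cx" by (rule FX(7))
    moreover have "x0 \<notin> Cy" by (rule FY(7))
    ultimately show "x0 \<notin> W" using xyz(7,8)[symmetric] unfolding W_def by simp
    fix \<phi>
    assume "col adj L (U - W) \<phi>"
    obtain \<beta>x where bx0: "\<forall>\<alpha>\<in>L x. \<alpha> \<noteq> \<beta>x \<longrightarrow> \<alpha> \<noteq> \<phi> bx \<and> (\<forall>c\<in>Cx. \<exists>\<gamma>\<in>L c. \<gamma> \<noteq> \<alpha> \<and> (\<forall>y\<in>N c - {x}. \<gamma> \<noteq> \<phi> y))"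
      using tails_block[OF X xyz(1), of \<phi>] by (elim exE)
    note bx = bx0[THEN bspec, THEN mp]
    obtain \<beta>y where by0: "\<forall>\<alpha>\<in>L y. \<alpha> \<noteq> \<beta>y \<longrightarrow> \<alpha> \<noteq> \<phi> b'y \<and> (\<forall>c\<in>Cy. \<exists>\<gamma>\<in>L c. \<gamma> \<noteq> \<alpha> \<and> (\<forall>u\<in>N c - {y}. \<gamma> \<noteq> \<phi> u))"
      using tails_block[OF Y xyz(2), of \<phi>] by (elim exE)
    note by' = by0[THEN bspec, THEN mp]
    have "\<exists>a b g. a \<in> L x \<and> b \<in> L y \<and> a \<noteq> b \<and> a \<notin> {\<phi> z, \<beta>x} \<and> b \<notin> {\<phi> z, \<beta>y} \<and> (\<forall>v\<in>Q. g \<in> L v \<and> g \<noteq> a \<and> g \<noteq> b \<and> g \<noteq> \<phi> z)"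
    proof (cases "Q = {}")
      case True
      then show ?thesis using triangle_pair[OF LU[OF xyz(1)] LU[OF xyz(2)] meet[OF xyz(4)], of "\<phi> z" \<beta>x \<beta>y] by blast
    next
      case False
      then obtain v where v: "v \<in> Q" by blast
      have "adj x v" "adj y v" using Qv(3)[OF v] asym NU[of x v] NU[of y v] by auto
      then obtain a b g where "a \<in> L x" "b \<in> L y" "g \<in> L v" "a \<noteq> b" "a \<noteq> g" "b \<noteq> g" "a \<notin> {\<phi> z, \<beta>x}" "b \<notin> {\<phi> z, \<beta>y}" "g \<noteq> \<phi> z"
        using triangle_triple[OF LU[OF xyz(1)] LU[OF xyz(2)] LU[OF Qv(1)[OF v]] meet[OF xyz(4)] meet[OF \<open>adj x v\<close>] meet[OF \<open>adj y v\<close>], of "\<phi> z" \<beta>x \<beta>y]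
        by (elim bexE conjE)
      then show ?thesis using Qv(7)[OF v] by - (rule exI[of _ a], rule exI[of _ b], rule exI[of _ g], auto)
    qed
    then obtain a b g where abg: "a \<in> L x" "b \<in> L y" "a \<noteq> b" "a \<noteq> \<phi> z" "a \<noteq> \<beta>x" "b \<noteq> \<phi> z" "b \<noteq> \<beta>y"
      "\<And>v. v \<in> Q \<Longrightarrow> g \<in> L v \<and> g \<noteq> a \<and> g \<noteq> b \<and> g \<noteq> \<phi> z" by blast
    have "\<forall>c\<in>Cx. \<exists>\<gamma>\<in>L c. \<gamma> \<noteq> a \<and> (\<forall>y\<in>N c - {x}. \<gamma> \<noteq> \<phi> y)" using bx[OF abg(1,5)] by (rule conjunct2)
    then have "\<forall>c\<in>Cx. \<exists>\<gamma>. \<gamma> \<in> L c \<and> \<gamma> \<noteq> a \<and> (\<forall>u\<in>N c - {x}. \<gamma> \<noteq> \<phi> u)" by (simp only: Bex_def)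
    from bchoice[OF this] obtain gx where gx0: "\<forall>c\<in>Cx. gx c \<in> L c \<and> gx c \<noteq> a \<and> (\<forall>u\<in>N c - {x}. gx c \<noteq> \<phi> u)" by (elim exE)
    note gx = gx0[THEN bspec]
    have "\<forall>c\<in>Cy. \<exists>\<gamma>\<in>L c. \<gamma> \<noteq> b \<and> (\<forall>u\<in>N c - {y}. \<gamma> \<noteq> \<phi> u)" using by'[OF abg(2,7)] by (rule conjunct2)
    then have "\<forall>c\<in>Cy. \<exists>\<gamma>. \<gamma> \<in> L c \<and> \<gamma> \<noteq> b \<and> (\<forall>u\<in>N c - {y}. \<gamma> \<noteq> \<phi> u)" by (simp only: Bex_def)
    from bchoice[OF this] obtain gy where gy0: "\<forall>c\<in>Cy. gy c \<in> L c \<and> gy c \<noteq> b \<and> (\<forall>u\<in>N c - {y}. gy c \<noteq> \<phi> u)" by (elim exE)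
    note gy = gy0[THEN bspec]
    define \<psi> where "\<psi> = (\<lambda>w. if w = x then a else if w = y then b else if w \<in> Q then g else if w \<in> Cx then gx w else gy w)"
    have CxQ: "c \<notin> Q" "c \<noteq> x" "c \<noteq> y" if "c \<in> Cx" for c using FX(1)[OF that] by auto
    have CyQ: "c \<notin> Q" "c \<noteq> x" "c \<noteq> y" "c \<notin> Cx" if "c \<in> Cy" for c using FY(1)[OF that] Cdisj(1)[OF _ that] by auto
    have px: "\<psi> x = a" and py: "\<psi> y = b" using ne by (simp_all add: \<psi>_def)
    have pq: "\<psi> v = g" if "v \<in> Q" for v using Qv(4,5)[OF that] that by (simp add: \<psi>_def)
    have pcx: "\<psi> c = gx c" if "c \<in> Cx" for c using CxQ[OF that] that by (simp add: \<psi>_def)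
    have pcy: "\<psi> c = gy c" if "c \<in> Cy" for c using CyQ[OF that] by (simp add: \<psi>_def)
    let ?\<chi> = "\<lambda>u. if u \<in> W then \<psi> u else \<phi> u"
    have Win: "x \<in> W" "y \<in> W" "\<And>v. v \<in> Q \<Longrightarrow> v \<in> W" "\<And>v. v \<in> Cx \<Longrightarrow> v \<in> W" "\<And>v. v \<in> Cy \<Longrightarrow> v \<in> W" by (simp_all add: W_def)
    have cx: "?\<chi> x = a" "?\<chi> y = b" "?\<chi> z = \<phi> z" "?\<chi> bx = \<phi> bx" "?\<chi> b'y = \<phi> b'y"
      using Win px py zW bW by simp_all
    have goodx: "a \<noteq> ?\<chi> u" if "u \<in> N x" for u
    proof -
      have "u = bx \<or> u \<in> Cx \<or> u = y \<or> u = z \<or> u \<in> Q" using FX(8) that by blast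
      then show ?thesis
      proof (elim disjE)
        assume u: "u = bx" show ?thesis unfolding u cx(4) by (rule bx[OF abg(1,5), THEN conjunct1])
      next
        assume u: "u \<in> Cx" then show ?thesis using gx[OF u] pcx[OF u] Win(4)[OF u] by auto
      next
        assume u: "u = y" show ?thesis unfolding u cx(2) by (rule abg(3))
      next
        assume u: "u = z" show ?thesis unfolding u cx(3) by (rule abg(4))
      next
        assume u: "u \<in> Q" then show ?thesis using pq[OF u] Win(3)[OF u] abg(8)[OF u] by auto
      qed
    qed
    have goody: "b \<noteq> ?\<chi> u" if "u \<in> N y" for u
    proof -
      have "u = b'y \<or> u \<in> Cy \<or> u = x \<or> u = z \<or> u \<in> Q" using FY(8) that by blast
      then show ?thesis
      proof (elim disjE)
        assume u: "u = b'y" show ?thesis unfolding u cx(5) by (rule by'[OF abg(2,7), THEN conjunct1])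
      next
        assume u: "u \<in> Cy" then show ?thesis using gy[OF u] pcy[OF u] Win(5)[OF u] by auto
      next
        assume u: "u = x" show ?thesis unfolding u cx(1) by (rule abg(3)[symmetric])
      next
        assume u: "u = z" show ?thesis unfolding u cx(3) by (rule abg(6))
      next
        assume u: "u \<in> Q" then show ?thesis using pq[OF u] Win(3)[OF u] abg(8)[OF u] by auto
      qed
    qed
    show "\<exists>\<psi>. (\<forall>w\<in>W. \<psi> w \<in> L w) \<and> (\<forall>w\<in>W. \<forall>y\<in>N w. \<psi> w \<noteq> (if y \<in> W then \<psi> y else \<phi> y))"
    proof (intro exI[of _ \<psi>] conjI ballI)
      fix w assume "w \<in> W"
      then consider "w = x" | "w = y" | "w \<in> Q" | "w \<in> Cx" | "w \<in> Cy" unfolding W_def by blast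
      note wc = this
      from wc show "\<psi> w \<in> L w"
        by cases (use px py pq pcx pcy abg gx gy in simp_all)
      fix u assume u: "u \<in> N w"
      from wc show "\<psi> w \<noteq> ?\<chi> u"
      proof cases
        case 1 then show ?thesis using goodx u px by simp
      next
        case 2 then show ?thesis using goody u py by simp
      next
        case 3
        then have "u = x \<or> u = y \<or> u = z" using Qv(3) u by blast
        then show ?thesis
        proof (elim disjE)
          assume u: "u = x" show ?thesis unfolding u cx(1) pq[OF 3] using abg(8)[OF 3] by simp
        next
          assume u: "u = y" show ?thesis unfolding u cx(2) pq[OF 3] using abg(8)[OF 3] by simp
        next
          assume u: "u = z" show ?thesis unfolding u cx(3) pq[OF 3] using abg(8)[OF 3] by simp
        qed
      next
        case 4
        show ?thesis
        proof (cases "u = x")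
          case True show ?thesis unfolding True cx(1) pcx[OF 4] using gx[OF 4] by simp
        next
          case False
          then have "u \<notin> W" using cN[OF 4] u by blast
          then show ?thesis using gx[OF 4] pcx[OF 4] u False by simp
        qed
      next
        case 5
        show ?thesis
        proof (cases "u = y")
          case True show ?thesis unfolding True cx(2) pcy[OF 5] using gy[OF 5] by simp
        next
          case False
          then have "u \<notin> W" using cN'[OF 5] u by blast
          then show ?thesis using gy[OF 5] pcy[OF 5] u False by simp
        qed
      qed
    qed
  qed
qed

text \<open>The two pockets block one colour each, so a third colour remains for \<open>w\<close>, after which \<open>c1\<close> and \<open>c2\<close> are coloured. They are not adjacent, as they would close a 5-cycle.\<close>

lemma no_two_pockets:
  assumes w: "w \<in> U" "w \<noteq> x0" and Nw: "N w = {b1, c1, b2, c2}" and dis: "distinct [b1, c1, b2, c2]"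
    and p: "pocket adj U x0 w b1 c1" "pocket adj U x0 w b2 c2"
  shows False
proof -
  note P1 = p(1)[unfolded pocket_def] and P2 = p(2)[unfolded pocket_def]
  have ne: "w \<noteq> b1" "w \<noteq> c1" "w \<noteq> b2" "w \<noteq> c2" using P1 P2 airr by auto
  have n12: "\<not> adj c1 c2" using no5[of w b1 c1 c2 b2] P1 P2 dis ne asym by auto
  define W where "W = {w, c1, c2}"
  obtain \<phi> where \<phi>: "col adj L (U - W) \<phi>" "\<phi> x0 = p0"
    using smaller[of "U - W"] w x0U P1 P2 by (auto simp: W_def)
  have third: "\<exists>d. N c = {w, b, d} \<and> d \<noteq> w \<and> d \<noteq> b" if "pocket adj U x0 w b c" for b c
  proof -
    have s: "{w, b} \<subseteq> N c" "w \<noteq> b" "card (N c) = 3" using that w asym airr by (auto simp: pocket_def nb_def)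
    then have "card (N c - {w, b}) = 1" using finN by (simp add: card_Diff_subset)
    then obtain d where d: "N c - {w, b} = {d}" by (auto simp: card_1_singleton_iff)
    then have "N c = {w, b, d}" using s(1) by blast
    then show ?thesis using d by blast
  qed
  obtain d1 d2 where d: "N c1 = {w, b1, d1}" "d1 \<noteq> w" "d1 \<noteq> b1" "N c2 = {w, b2, d2}" "d2 \<noteq> w" "d2 \<noteq> b2"
    using third[OF p(1)] third[OF p(2)] by blast
  have dW: "d1 \<notin> W" "d2 \<notin> W" "b1 \<notin> W" "b2 \<notin> W"
  proof -
    have "adj c1 d1" "adj c2 d2" using d NU[of d1 c1] NU[of d2 c2] by auto
    then have "d1 \<noteq> c1" "d1 \<noteq> c2" "d2 \<noteq> c2" "d2 \<noteq> c1" using n12 airr asym by auto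
    then show "d1 \<notin> W" "d2 \<notin> W" "b1 \<notin> W" "b2 \<notin> W" using d dis ne by (auto simp: W_def)
  qed
  have cU: "c1 \<in> U" "c2 \<in> U" "adj w c1" "adj w c2" using P1 P2 by simp_all
  obtain \<beta>1 where b10: "\<forall>\<alpha>\<in>L w. \<alpha> \<noteq> \<beta>1 \<longrightarrow> \<alpha> \<noteq> \<phi> b1 \<and> (\<exists>\<gamma>\<in>L c1. \<gamma> \<noteq> \<alpha> \<and> \<gamma> \<noteq> \<phi> b1 \<and> \<gamma> \<noteq> \<phi> d1)"
    using pocket_blocks[OF LU[OF w(1)] LU[OF cU(1)] meet[OF cU(3)], of "\<phi> b1" "\<phi> d1"] by (elim exE)
  note b1 = b10[THEN bspec, THEN mp]
  obtain \<beta>2 where b20: "\<forall>\<alpha>\<in>L w. \<alpha> \<noteq> \<beta>2 \<longrightarrow> \<alpha> \<noteq> \<phi> b2 \<and> (\<exists>\<gamma>\<in>L c2. \<gamma> \<noteq> \<alpha> \<and> \<gamma> \<noteq> \<phi> b2 \<and> \<gamma> \<noteq> \<phi> d2)"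
    using pocket_blocks[OF LU[OF w(1)] LU[OF cU(2)] meet[OF cU(4)], of "\<phi> b2" "\<phi> d2"] by (elim exE)
  note b2 = b20[THEN bspec, THEN mp]
  have "card {\<beta>1, \<beta>2} < 3" using card_le_2[of \<beta>1 \<beta>2] by linarith
  then obtain a where a: "a \<in> L w" "a \<noteq> \<beta>1" "a \<noteq> \<beta>2" using ex_avoid[of 3 "L w" "{\<beta>1, \<beta>2}"] LU[OF w(1)] by auto
  obtain g1 where g1: "g1 \<in> L c1" "g1 \<noteq> a" "g1 \<noteq> \<phi> b1" "g1 \<noteq> \<phi> d1" using b1[OF a(1,2)] by (elim conjE bexE)
  obtain g2 where g2: "g2 \<in> L c2" "g2 \<noteq> a" "g2 \<noteq> \<phi> b2" "g2 \<noteq> \<phi> d2" using b2[OF a(1,3)] by (elim conjE bexE)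
  have ab: "a \<noteq> \<phi> b1" "a \<noteq> \<phi> b2" using b1[OF a(1,2)] b2[OF a(1,3)] by simp_all
  define \<psi> where "\<psi> = \<phi>(w := a, c1 := g1, c2 := g2)"
  have \<psi>: "\<psi> w = a" "\<psi> c1 = g1" "\<psi> c2 = g2" "\<And>u. u \<notin> W \<Longrightarrow> \<psi> u = \<phi> u" using ne dis by (auto simp: \<psi>_def W_def)
  have nbr: "\<psi> v \<noteq> \<psi> u" if "v \<in> W" "u \<in> N v" for u v
  proof -
    have "v = w \<or> v = c1 \<or> v = c2" using that by (simp add: W_def)
    then show ?thesis
    proof (elim disjE)
      assume v: "v = w"
      then have "u = b1 \<or> u = c1 \<or> u = b2 \<or> u = c2" using that(2) Nw by simp
      then show ?thesis using v \<psi> dW ab g1 g2 by (elim disjE) auto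
    next
      assume v: "v = c1"
      then have "u = w \<or> u = b1 \<or> u = d1" using that(2) d by simp
      then show ?thesis using v \<psi> dW g1 by (elim disjE) auto
    next
      assume v: "v = c2"
      then have "u = w \<or> u = b2 \<or> u = d2" using that(2) d by simp
      then show ?thesis using v \<psi> dW g2 by (elim disjE) auto
    qed
  qed
  have "col adj L U \<psi>" unfolding col_def
  proof (intro conjI ballI impI)
    fix v assume "v \<in> U"
    then show "\<psi> v \<in> L v" using \<psi> \<phi>(1) a g1 g2 by (cases "v \<in> W") (auto simp: col_def W_def)
  next
    fix v u assume vu: "v \<in> U" "u \<in> U" "adj v u"
    show "\<psi> v \<noteq> \<psi> u"
    proof (cases "v \<in> W \<or> u \<in> W")
      case True
      then show ?thesis using nbr[of v u] nbr[of u v] vu asym[OF vu(3)] by (auto simp: nb_def)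
    next
      case False
      then show ?thesis using \<psi>(4) \<phi>(1) vu by (simp add: col_def)
    qed
  qed
  moreover have "\<psi> x0 = p0"
  proof -
    have "x0 \<notin> W" using w P1 P2 by (auto simp: W_def)
    then show ?thesis using \<psi>(4)[of x0] \<phi>(2) by simp
  qed
  ultimately show False using stuck by blast
qed

end

section \<open>How short faces meet\<close>

lemma cyc_edges_at:
  assumes "cyc R vs" "v \<in> set vs"
  obtains p s where "p \<noteq> s" "p \<noteq> v" "s \<noteq> v" "{e \<in> cedges vs. v \<in> e} = {{v, p}, {v, s}}"
proof -
  obtain A B where "vs = A @ v # B" using assms(2) by (meson split_list)
  then have c: "cyc R (v # B @ A)" "cedges vs = cedges (v # (B @ A))" using assms(1) cyc_rot cedges_rot by metis+
  obtain p zs where z: "B @ A = p # zs" "zs \<noteq> []" using c(1) by (cases "B @ A"; cases "tl (B @ A)") (auto simp: cyc_def)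
  obtain m s where zs: "zs = m @ [s]" using z(2) by (metis rev_exhaust)
  have d: "distinct (v # p # m @ [s])" using c(1) z(1) zs by (auto simp: cyc_def)
  have "cedges vs = pedges (v # p # m @ [s, v])" using c(2) z(1) zs by (simp add: cedges_def)
  also have "\<dots> = insert {v, p} (insert {s, v} (pedges (p # m @ [s])))"
    using pedges_snoc2[of "p # m" s v] by simp
  finally have e: "cedges vs = insert {v, p} (insert {s, v} (pedges (p # m @ [s])))" .
  have "v \<notin> e" if "e \<in> pedges (p # m @ [s])" for e using pedges_sub[OF that] d by auto
  then have "{e \<in> cedges vs. v \<in> e} = {{v, p}, {v, s}}" unfolding e by auto
  then show thesis using that[of p s] d by auto
qed

lemma cyc_mem: "cyc R vs \<Longrightarrow> e \<in> cedges vs \<Longrightarrow> x \<in> e \<Longrightarrow> x \<in> set vs"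
  using card_cedges(2) by fastforce

text \<open>A critical graph with the facial cycles of a plane drawing, of which only combinatorial properties are kept.\<close>

locale faced = critical V adj L U x0 p0
  for V :: "'a set" and adj and L :: "'a \<Rightarrow> 'c set" and U x0 p0 +
  fixes F :: "'f set" and bd :: "'f \<Rightarrow> 'a list"
  assumes finF: "finite F" and cycF: "f \<in> F \<Longrightarrow> cyc adj (bd f)" and ceF: "f \<in> F \<Longrightarrow> cedges (bd f) \<subseteq> edges adj U"
    and twoF: "e \<in> edges adj U \<Longrightarrow> card {f \<in> F. e \<in> cedges (bd f)} = 2"
    and rot: "X \<subseteq> {e \<in> edges adj U. x \<in> e} \<Longrightarrow> X \<noteq> {} \<Longrightarrow> X \<noteq> {e \<in> edges adj U. x \<in> e} \<Longrightarrow>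
       \<exists>f\<in>F. \<exists>e\<in>X. \<exists>e'\<in>edges adj U - X. x \<in> e' \<and> e \<in> cedges (bd f) \<and> e' \<in> cedges (bd f)"
    and no6: "distinct [a1, a2, a3, a4, a5, a6] \<Longrightarrow> adj a1 a2 \<Longrightarrow> adj a2 a3 \<Longrightarrow> adj a3 a4 \<Longrightarrow> adj a4 a5 \<Longrightarrow> adj a5 a6 \<Longrightarrow> adj a6 a1 \<Longrightarrow> False"
begin

abbreviation "ce f \<equiv> cedges (bd f)"
abbreviation "Vf f \<equiv> set (bd f)"
abbreviation "dg v \<equiv> card (N v)"

text \<open>The short faces that take part in the discharging. Faces at \<open>x0\<close> are exempt when \<open>x0\<close> has small degree: then
\<open>degree_ge_3\<close> does not control \<open>x0\<close>, and there are few of them anyway.\<close>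

definition SF :: "'f set" where
  "SF = {f \<in> F. length (bd f) \<le> 4 \<and> \<not> (x0 \<in> Vf f \<and> dg x0 \<le> 3)}"

text \<open>Sharing a boundary edge.\<close>

definition sh :: "'f \<Rightarrow> 'f \<Rightarrow> bool" where "sh f g \<longleftrightarrow> f \<noteq> g \<and> ce f \<inter> ce g \<noteq> {}"

lemma SF_F: "f \<in> SF \<Longrightarrow> f \<in> F" by (simp add: SF_def)

lemma ce_adj: assumes "f \<in> F" "{x, y} \<in> ce f" shows "adj x y" "x \<noteq> y" "x \<in> U" "y \<in> U" "x \<in> Vf f" "y \<in> Vf f"
proof -
  have e: "{x, y} \<in> edges adj U" using ceF[OF assms(1)] assms(2) by blast
  then show 1: "adj x y" "x \<in> U" "y \<in> U" by (simp_all add: edge_in_iff)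
  show "x \<noteq> y" using 1 airr by auto
  show "x \<in> Vf f" "y \<in> Vf f" using cyc_mem[OF cycF[OF assms(1)] assms(2)] by auto
qed

lemma edge_at: "v \<in> U \<Longrightarrow> {e \<in> edges adj U. v \<in> e} = (\<lambda>y. {v, y}) ` N v"
proof (intro equalityI subsetI)
  fix e assume v: "v \<in> U" and "e \<in> {e \<in> edges adj U. v \<in> e}"
  then obtain x y where xy: "e = {x, y}" "adj x y" "x \<in> U" "y \<in> U" "v \<in> e" by (auto elim: edgesE)
  then show "e \<in> (\<lambda>y. {v, y}) ` N v" using asym by (auto simp: nb_def insert_commute)
next
  fix e assume "v \<in> U" "e \<in> (\<lambda>y. {v, y}) ` N v"
  then show "e \<in> {e \<in> edges adj U. v \<in> e}" by (auto simp: nb_def edges_def)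
qed

lemma at_two:
  assumes "f \<in> F" "{v, p} \<in> ce f" "{v, s} \<in> ce f" "p \<noteq> s" "{v, y} \<in> ce f"
  shows "y = p \<or> y = s"
proof -
  have v: "v \<in> Vf f" using ce_adj[OF assms(1,2)] by simp
  obtain p' s' where e: "{e \<in> ce f. v \<in> e} = {{v, p'}, {v, s'}}" using cyc_edges_at[OF cycF[OF assms(1)] v] by metis
  have *: "z = p' \<or> z = s'" if "{v, z} \<in> ce f" for z
  proof -
    have "{v, z} \<in> {e \<in> ce f. v \<in> e}" using that by simp
    then have "{v, z} = {v, p'} \<or> {v, z} = {v, s'}" unfolding e by blast
    then show ?thesis using ce_adj(2)[OF assms(1) that] by (auto simp: doubleton_eq_iff)
  qed
  then show ?thesis using assms by metis
qed

lemma two_only: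
  assumes "f \<in> F" "g \<in> F" "f \<noteq> g" "e \<in> ce f" "e \<in> ce g" "h \<in> F" "e \<in> ce h"
  shows "h = f \<or> h = g"
proof -
  have "card {f \<in> F. e \<in> ce f} = 2" using twoF ceF assms by blast
  then obtain a b where "{f \<in> F. e \<in> ce f} = {a, b}" by (auto simp: card_2_iff)
  then have "f \<in> {a, b}" "g \<in> {a, b}" "h \<in> {a, b}" using assms by blast+
  then show ?thesis using assms(3) by auto
qed

text \<open>Otherwise some face would lead from an edge between \<open>v\<close> and \<open>Y\<close> to an edge between \<open>v\<close> and the rest.\<close>

lemma link_closed:
  assumes v: "v \<in> U" and Y: "Y \<subseteq> N v" "Y \<noteq> {}"
    and cl: "\<And>f y y'. f \<in> F \<Longrightarrow> y \<in> Y \<Longrightarrow> {v, y} \<in> ce f \<Longrightarrow> {v, y'} \<in> ce f \<Longrightarrow> y' \<in> Y"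
  shows "N v = Y"
proof (rule ccontr)
  assume "N v \<noteq> Y"
  then obtain z where z: "z \<in> N v" "z \<notin> Y" using Y by blast
  let ?X = "(\<lambda>y. {v, y}) ` Y"
  have "?X \<subseteq> {e \<in> edges adj U. v \<in> e}" unfolding edge_at[OF v] using Y(1) by blast
  moreover have "?X \<noteq> {}" using Y(2) by simp
  moreover have "{v, z} \<notin> ?X" using z by (auto simp: doubleton_eq_iff)
  moreover have "{v, z} \<in> {e \<in> edges adj U. v \<in> e}" unfolding edge_at[OF v] using z by blast
  ultimately obtain f e e' where f: "f \<in> F" "e \<in> ?X" "e' \<in> edges adj U - ?X" "v \<in> e'" "e \<in> ce f" "e' \<in> ce f"
    using rot[of ?X v] by blast
  obtain y where y: "e = {v, y}" "y \<in> Y" using f(2) by blast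
  have "e' \<in> (\<lambda>y. {v, y}) ` N v" using f(3,4) edge_at[OF v] by blast
  then obtain y' where y': "e' = {v, y'}" by blast
  have "y' \<in> Y" using cl[OF f(1) y(2)] f(5,6) y(1) y' by blast
  then show False using f(3) y' by blast
qed

lemma big: assumes "f \<in> SF" "v \<in> Vf f" "v \<in> U" shows "dg v \<ge> 3" "dg v = 3 \<Longrightarrow> v \<noteq> x0"
  using assms degree_ge_3[of v] by (cases "v = x0"; force simp: SF_def)+

text \<open>Two faces that share both edges at \<open>v\<close> close up around \<open>v\<close>, which then has degree two.\<close>

lemma no_double_corner:
  assumes "f \<in> SF" "g \<in> SF" "f \<noteq> g" "{v, p} \<in> ce f" "{v, s} \<in> ce f" "{v, p} \<in> ce g" "{v, s} \<in> ce g" "p \<noteq> s"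
  shows False
proof -
  have fg: "f \<in> F" "g \<in> F" using assms SF_F by blast+
  have v: "v \<in> U" "v \<in> Vf f" "p \<in> U" "s \<in> U" "adj v p" "adj v s" using ce_adj[OF fg(1) assms(4)] ce_adj[OF fg(1) assms(5)] by simp_all
  have "N v = {p, s}"
  proof (rule link_closed[OF v(1)])
    show "{p, s} \<subseteq> N v" using v by (simp add: nb_def)
    fix h y y' assume h: "h \<in> F" "y \<in> {p, s}" "{v, y} \<in> ce h" "{v, y'} \<in> ce h"
    have "h = f \<or> h = g" using two_only[OF fg assms(3), of "{v, y}" h] h assms by auto
    then show "y' \<in> {p, s}" using at_two[OF fg(1) assms(4,5,8)] at_two[OF fg(2) assms(6,7,8)] h(4) by auto
  qed simp
  then have "dg v = 2" using assms(8) by simp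
  then show False using big(1)[OF assms(1) v(2,1)] by simp
qed

text \<open>Three faces arranged cyclically around \<open>v\<close> leave no room for a further edge.\<close>

lemma closed_corner:
  assumes "f \<in> SF" "g \<in> SF" "h \<in> SF" "f \<noteq> g" "g \<noteq> h" "f \<noteq> h"
    and "{v, x} \<in> ce f" "{v, y} \<in> ce f" "{v, y} \<in> ce g" "{v, z} \<in> ce g" "{v, z} \<in> ce h" "{v, x} \<in> ce h"
    and "distinct [x, y, z]"
  shows "N v = {x, y, z}" "dg v = 3" "v \<noteq> x0"
proof -
  have F: "f \<in> F" "g \<in> F" "h \<in> F" using assms SF_F by blast+
  have d: "x \<noteq> y" "y \<noteq> z" "x \<noteq> z" using assms(13) by auto
  have v: "v \<in> U" "v \<in> Vf f" "x \<in> U" "y \<in> U" "z \<in> U" "adj v x" "adj v y" "adj v z"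
    using ce_adj[OF F(1) assms(7)] ce_adj[OF F(1) assms(8)] ce_adj[OF F(2) assms(10)] by simp_all
  show N: "N v = {x, y, z}"
  proof (rule link_closed[OF v(1)])
    show "{x, y, z} \<subseteq> N v" using v by (simp add: nb_def)
    fix k u u' assume k: "k \<in> F" "u \<in> {x, y, z}" "{v, u} \<in> ce k" "{v, u'} \<in> ce k"
    have "k = f \<or> k = g \<or> k = h"
      using two_only[OF F(3,1) assms(6)[symmetric] assms(12,7) k(1)] two_only[OF F(1,2) assms(4) assms(8,9) k(1)]
        two_only[OF F(2,3) assms(5) assms(10,11) k(1)] k(2,3) by auto
    then show "u' \<in> {x, y, z}"
      using at_two[OF F(1) assms(7,8) d(1), of u'] at_two[OF F(2) assms(9,10) d(2), of u'] at_two[OF F(3) assms(11,12) d(3)[symmetric], of u'] k(4) by auto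
  qed simp
  then show 3: "dg v = 3" using d by simp
  show "v \<noteq> x0" using big(2)[OF assms(1) v(2,1) 3] .
qed

lemma triE:
  assumes "f \<in> SF" "length (bd f) = 3"
  obtains x y z where "distinct [x, y, z]" "Vf f = {x, y, z}" "ce f = {{x, y}, {y, z}, {x, z}}"
proof -
  obtain x y z where b: "bd f = [x, y, z]" using assms(2) by (auto simp: length_Suc_conv eval_nat_numeral)
  have "distinct (bd f)" using cycF[OF SF_F[OF assms(1)]] by (simp add: cyc_def)
  then show thesis using that[of x y z] b by (auto simp: cedges_def insert_commute)
qed

lemma tri_edge:
  assumes "f \<in> SF" "length (bd f) = 3" "{u, v} \<in> ce f"
  obtains a where "distinct [u, v, a]" "Vf f = {u, v, a}" "ce f = {{u, v}, {v, a}, {u, a}}"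
proof -
  obtain x y z where t: "distinct [x, y, z]" "Vf f = {x, y, z}" "ce f = {{x, y}, {y, z}, {x, z}}" using triE[OF assms(1,2)] .
  from assms(3) consider "u = x" "v = y" | "u = y" "v = x" | "u = y" "v = z" | "u = z" "v = y" | "u = x" "v = z" | "u = z" "v = x"
    unfolding t(3) by (auto simp: doubleton_eq_iff)
  then show thesis
  proof cases
    case 1 show thesis by (rule that[of z]) (use 1 t in \<open>auto simp: insert_commute\<close>)
  next
    case 2 show thesis by (rule that[of z]) (use 2 t in \<open>auto simp: insert_commute\<close>)
  next
    case 3 show thesis by (rule that[of x]) (use 3 t in \<open>auto simp: insert_commute\<close>)
  next
    case 4 show thesis by (rule that[of x]) (use 4 t in \<open>auto simp: insert_commute\<close>)
  next
    case 5 show thesis by (rule that[of y]) (use 5 t in \<open>auto simp: insert_commute\<close>)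
  next
    case 6 show thesis by (rule that[of y]) (use 6 t in \<open>auto simp: insert_commute\<close>)
  qed
qed

lemma quad_edge:
  assumes "f \<in> SF" "length (bd f) = 4" "{u, v} \<in> ce f"
  obtains p q where "distinct [u, v, p, q]" "Vf f = {u, v, p, q}" "ce f = {{u, v}, {v, p}, {p, q}, {q, u}}"
proof -
  obtain w x y z where b: "bd f = [w, x, y, z]" using assms(2) by (auto simp: length_Suc_conv eval_nat_numeral)
  have d: "distinct [w, x, y, z]" using cycF[OF SF_F[OF assms(1)]] b by (simp add: cyc_def)
  have e: "ce f = {{w, x}, {x, y}, {y, z}, {z, w}}" "Vf f = {w, x, y, z}" using b by (auto simp: cedges_def)
  from assms(3) consider "u = w" "v = x" | "u = x" "v = w" | "u = x" "v = y" | "u = y" "v = x" | "u = y" "v = z" | "u = z" "v = y"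
    | "u = z" "v = w" | "u = w" "v = z"
    unfolding e by (auto simp: doubleton_eq_iff)
  then show thesis
  proof cases
    case 1 show thesis by (rule that[of y z]) (use 1 d e in \<open>auto simp: insert_commute\<close>)
  next
    case 2 show thesis by (rule that[of z y]) (use 2 d e in \<open>auto simp: insert_commute\<close>)
  next
    case 3 show thesis by (rule that[of z w]) (use 3 d e in \<open>auto simp: insert_commute\<close>)
  next
    case 4 show thesis by (rule that[of w z]) (use 4 d e in \<open>auto simp: insert_commute\<close>)
  next
    case 5 show thesis by (rule that[of w x]) (use 5 d e in \<open>auto simp: insert_commute\<close>)
  next
    case 6 show thesis by (rule that[of x w]) (use 6 d e in \<open>auto simp: insert_commute\<close>)
  next
    case 7 show thesis by (rule that[of x y]) (use 7 d e in \<open>auto simp: insert_commute\<close>)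
  next
    case 8 show thesis by (rule that[of y x]) (use 8 d e in \<open>auto simp: insert_commute\<close>)
  qed
qed

lemma len34: "f \<in> SF \<Longrightarrow> length (bd f) = 3 \<or> length (bd f) = 4"
  using cycF[OF SF_F] by (force simp: SF_def cyc_def)

lemma sh_edge: assumes "sh f g" "f \<in> SF" obtains u v where "{u, v} \<in> ce f" "{u, v} \<in> ce g"
proof -
  obtain e where e: "e \<in> ce f" "e \<in> ce g" using assms(1) by (auto simp: sh_def)
  then have "e \<in> edges adj U" using ceF[OF SF_F[OF assms(2)]] by blast
  then show thesis using e that by (metis edgesE)
qed

lemma sh_sym: "sh f g \<Longrightarrow> sh g f" by (auto simp: sh_def)

text \<open>The union of a triangle and a quadrangle on a common edge bounds a 5-cycle, unless they share two edges at a vertex.\<close>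

lemma sh_tri_quad:
  assumes "f \<in> SF" "g \<in> SF" "length (bd f) = 3" "length (bd g) = 4" "sh f g" shows False
proof -
  obtain u v where uv: "{u, v} \<in> ce f" "{u, v} \<in> ce g" using sh_edge[OF assms(5,1)] .
  obtain a where a: "distinct [u, v, a]" "ce f = {{u, v}, {v, a}, {u, a}}" using tri_edge[OF assms(1,3) uv(1)] by metis
  obtain p q where pq: "distinct [u, v, p, q]" "ce g = {{u, v}, {v, p}, {p, q}, {q, u}}" using quad_edge[OF assms(2,4) uv(2)] by metis
  have fg: "f \<noteq> g" using assms(5) by (simp add: sh_def)
  have F: "f \<in> F" "g \<in> F" using assms SF_F by blast+
  have A: "adj v a" "adj u a" using ce_adj[OF F(1), of v a] ce_adj[OF F(1), of u a] a by simp_all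
  have B: "adj v p" "adj p q" "adj q u" using ce_adj[OF F(2), of v p] ce_adj[OF F(2), of p q] ce_adj[OF F(2), of q u] pq by simp_all
  consider "a = p" | "a = q" | "a \<noteq> p" "a \<noteq> q" by blast
  then show False
  proof cases
    case 1
    show False by (rule no_double_corner[OF assms(1,2) fg, of v u a]) (use a pq 1 in \<open>auto simp: insert_commute\<close>)
  next
    case 2
    show False by (rule no_double_corner[OF assms(1,2) fg, of u v a]) (use a pq 2 in \<open>auto simp: insert_commute\<close>)
  next
    case 3
    show False by (rule no5[of a u q p v]) (use a(1) pq(1) 3 A B asym in auto)
  qed
qed

lemma sh_tri:
  assumes "f \<in> SF" "g \<in> SF" "length (bd f) = 3" "sh f g" "{u, v} \<in> ce f" "{u, v} \<in> ce g"
  obtains a b where "distinct [u, v, a, b]" "Vf f = {u, v, a}" "ce f = {{u, v}, {v, a}, {u, a}}"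
    "Vf g = {u, v, b}" "ce g = {{u, v}, {v, b}, {u, b}}" "length (bd g) = 3"
proof -
  have l: "length (bd g) = 3" using sh_tri_quad[OF assms(1,2,3)] assms(4) len34[OF assms(2)] by blast
  obtain a where a: "distinct [u, v, a]" "Vf f = {u, v, a}" "ce f = {{u, v}, {v, a}, {u, a}}" using tri_edge[OF assms(1,3,5)] .
  obtain b where b: "distinct [u, v, b]" "Vf g = {u, v, b}" "ce g = {{u, v}, {v, b}, {u, b}}" using tri_edge[OF assms(2) l assms(6)] .
  have "a \<noteq> b"
  proof
    assume e: "a = b"
    have "f \<noteq> g" using assms(4) by (simp add: sh_def)
    then show False by (rule no_double_corner[OF assms(1,2), of u v a]) (use a b e in auto)
  qed
  then show thesis using that[of a b] a b l by auto
qed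

text \<open>Two quadrangles on a common edge bound a 6-cycle unless they overlap further; avoiding 5-cycles and double corners, they have the same four vertices, crossed over.\<close>

lemma sh_quad:
  assumes "f \<in> SF" "g \<in> SF" "length (bd f) = 4" "sh f g" "{u, v} \<in> ce f" "{u, v} \<in> ce g"
  obtains p q where "distinct [u, v, p, q]" "Vf f = {u, v, p, q}" "ce f = {{u, v}, {v, p}, {p, q}, {q, u}}"
    "Vf g = {u, v, p, q}" "ce g = {{u, v}, {v, q}, {q, p}, {p, u}}" "length (bd g) = 4"
proof -
  have fg: "f \<noteq> g" using assms(4) by (simp add: sh_def)
  have F: "f \<in> F" "g \<in> F" using assms SF_F by blast+
  have l: "length (bd g) = 4" using sh_tri_quad[OF assms(2,1) _ assms(3) sh_sym[OF assms(4)]] len34[OF assms(2)] by blast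
  obtain p q where p: "distinct [u, v, p, q]" "Vf f = {u, v, p, q}" "ce f = {{u, v}, {v, p}, {p, q}, {q, u}}" using quad_edge[OF assms(1,3,5)] .
  obtain r s where r: "distinct [u, v, r, s]" "Vf g = {u, v, r, s}" "ce g = {{u, v}, {v, r}, {r, s}, {s, u}}" using quad_edge[OF assms(2) l assms(6)] .
  have A: "adj u v" "adj v p" "adj p q" "adj q u" "adj v r" "adj r s" "adj s u"
    using ce_adj(1)[OF F(1), of u v] ce_adj(1)[OF F(1), of v p] ce_adj(1)[OF F(1), of p q] ce_adj(1)[OF F(1), of q u]
      ce_adj(1)[OF F(2), of v r] ce_adj(1)[OF F(2), of r s] ce_adj(1)[OF F(2), of s u] p r by simp_all
  have pr: "p \<noteq> r"
  proof
    assume e: "p = r"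
    show False by (rule no_double_corner[OF assms(1,2) fg, of v u p]) (use p r e in \<open>auto simp: insert_commute\<close>)
  qed
  have qs: "q \<noteq> s"
  proof
    assume e: "q = s"
    show False by (rule no_double_corner[OF assms(1,2) fg, of u v q]) (use p r e in \<open>auto simp: insert_commute\<close>)
  qed
  have "p = s \<and> q = r"
  proof (rule ccontr)
    assume n: "\<not> ?thesis"
    consider "p \<noteq> s" "q \<noteq> r" | "p = s" "q \<noteq> r" | "p \<noteq> s" "q = r" using n by blast
    then show False
    proof cases
      case 1
      show False by (rule no6[of v p q u s r]) (use p(1) r(1) pr qs 1 A asym in auto)
    next
      case 2
      show False by (rule no5[of u v r p q]) (use p(1) r(1) pr qs 2 A asym in auto)
    next
      case 3
      show False by (rule no5[of v u s q p]) (use p(1) r(1) pr qs 3 A asym in auto)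
    qed
  qed
  then show thesis using that[of p q] p r l by auto
qed

text \<open>In a triangle, two vertices of degree three other than \<open>x0\<close> would both have a tail.\<close>

lemma deg3_unique:
  assumes "x \<in> U" "y \<in> U" "z \<in> U" "adj x y" "adj x z" "adj y z" "x \<noteq> x0" "y \<noteq> x0" "dg x = 3" "dg y = 3"
  shows False
proof -
  have t: "tail adj U x0 a {b, c}" if "b \<in> N a" "c \<in> N a" "b \<noteq> c" "dg a = 3" for a b c
  proof -
    have "card (N a - {b, c}) = 1" using that finN by (simp add: card_Diff_subset)
    then show ?thesis by (auto simp: tail_def card_1_singleton_iff)
  qed
  have ne: "x \<noteq> z" "y \<noteq> z" using assms airr by auto
  show False
    by (rule no_two_tails[of x y z "{}"]) (use assms ne asym in \<open>simp_all add: t nb_def\<close>)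
qed

text \<open>If \<open>g\<close> shares edges with two faces, all are triangles, and they close up around a vertex \<open>c\<close>
of degree three: the third vertices of the outer two coincide, as otherwise there is a 5-cycle. Three quadrangles
would make two adjacent vertices of degree three.\<close>

lemma sh_trans:
  assumes S: "f \<in> SF" "g \<in> SF" "h \<in> SF" and fg: "sh f g" and gh: "sh g h" and ne: "f \<noteq> h"
  obtains c x y z where "distinct [c, x, y, z]" "length (bd f) = 3" "length (bd g) = 3" "length (bd h) = 3"
    "Vf f = {c, x, y}" "Vf g = {c, y, z}" "Vf h = {c, x, z}"
    "ce f = {{c, x}, {c, y}, {x, y}}" "ce g = {{c, y}, {c, z}, {y, z}}" "ce h = {{c, x}, {c, z}, {x, z}}"
    "N c = {x, y, z}" "dg c = 3" "c \<noteq> x0"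
proof -
  note out = that
  have F: "f \<in> F" "g \<in> F" "h \<in> F" using S SF_F by blast+
  have nfg: "f \<noteq> g" and ngh: "g \<noteq> h" using fg gh by (simp_all add: sh_def)
  obtain u v where uv: "{u, v} \<in> ce g" "{u, v} \<in> ce f" using sh_edge[OF sh_sym[OF fg] S(2)] .
  obtain u' v' where uv': "{u', v'} \<in> ce g" "{u', v'} \<in> ce h" using sh_edge[OF gh S(2)] .
  have diff: "{u', v'} \<noteq> {u, v}" using two_only[OF F(1,2) nfg uv(2,1) F(3)] uv' ne ngh by auto
  show thesis
  proof (cases "length (bd g) = 3")
    case True
    obtain a b where g: "distinct [u, v, a, b]" "Vf g = {u, v, a}" "ce g = {{u, v}, {v, a}, {u, a}}"
      "Vf f = {u, v, b}" "ce f = {{u, v}, {v, b}, {u, b}}" "length (bd f) = 3"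
      using sh_tri[OF S(2,1) True sh_sym[OF fg] uv] .
    have main: thesis if w: "{u, v} = {s, t}" and sa: "{u', v'} = {s, a}" for s t
    proof -
      have st: "distinct [s, t, a, b]" "ce g = {{s, t}, {t, a}, {s, a}}" "Vf g = {s, t, a}" "ce f = {{s, t}, {t, b}, {s, b}}" "Vf f = {s, t, b}"
        using w g by (auto simp: doubleton_eq_iff insert_commute)
      have "{s, a} \<in> ce g" "{s, a} \<in> ce h" using uv' sa by auto
      then obtain t' d where h: "distinct [s, a, t', d]" "Vf g = {s, a, t'}" "Vf h = {s, a, d}" "ce h = {{s, a}, {a, d}, {s, d}}" "length (bd h) = 3"
        using sh_tri[OF S(2,3) True gh] by metis
      have "t' = t" using h(1,2) st(1,3) by auto
      then have d: "d \<noteq> t" "d \<noteq> s" "d \<noteq> a" using h(1) by auto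
      have db: "d = b"
      proof (rule ccontr)
        assume "d \<noteq> b"
        have A: "adj s b" "adj b t" "adj t a" "adj a d" "adj d s"
          using ce_adj(1)[OF F(1), of s b] ce_adj(1)[OF F(1), of b t] ce_adj(1)[OF F(2), of t a] ce_adj(1)[OF F(3), of a d] ce_adj(1)[OF F(3), of d s]
            st h(4) by (auto simp: insert_commute)
        show False by (rule no5[of s b t a d]) (use A st(1) d \<open>d \<noteq> b\<close> in auto)
      qed
      have dis: "distinct [b, t, a]" and dd: "distinct [s, b, t, a]" using st(1) by auto
      have cc: "N s = {b, t, a}" "dg s = 3" "s \<noteq> x0"
        by (rule closed_corner[OF S nfg ngh ne _ _ _ _ _ _ dis]; use st(2,4) h(4)[unfolded db] in \<open>simp add: insert_commute\<close>)+
      have "Vf f = {s, b, t}" unfolding st(5) by blast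
      moreover have "Vf h = {s, b, a}" unfolding h(3) db by blast
      moreover have "ce f = {{s, b}, {s, t}, {b, t}}" unfolding st(4) by (simp add: insert_commute)
      moreover have "ce g = {{s, t}, {s, a}, {t, a}}" unfolding st(2) by (simp add: insert_commute)
      moreover have "ce h = {{s, b}, {s, a}, {b, a}}" unfolding h(4) db by (simp add: insert_commute)
      ultimately show thesis using out[OF dd g(6) True h(5) _ st(3) _ _ _ _ cc] by blast
    qed
    have "{u', v'} \<in> {{u, v}, {v, a}, {u, a}}" using uv'(1) unfolding g(3) .
    then have "{u', v'} = {u, a} \<or> {u', v'} = {v, a}" using diff by blast
    then show thesis
    proof
      assume "{u', v'} = {u, a}" then show thesis by (rule main[OF refl])
    next
      have "{u, v} = {v, u}" by blast
      moreover assume "{u', v'} = {v, a}"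
      ultimately show thesis by (rule main)
    qed
  next
    case False
    then have l: "length (bd g) = 4" using len34[OF S(2)] by blast
    obtain p q where g: "distinct [u, v, p, q]" "Vf g = {u, v, p, q}" "ce g = {{u, v}, {v, p}, {p, q}, {q, u}}"
      "Vf f = {u, v, p, q}" "ce f = {{u, v}, {v, q}, {q, p}, {p, u}}" "length (bd f) = 4"
      using sh_quad[OF S(2,1) l sh_sym[OF fg] uv] .
    have gf: "{p, q} \<in> ce f" "{u, v} \<in> ce f" "{v, q} \<in> ce f" "{u, p} \<in> ce f" unfolding g(5) by (simp_all add: insert_commute)
    have gg: "{p, q} \<in> ce g" "{u, v} \<in> ce g" "{v, p} \<in> ce g" "{u, q} \<in> ce g" unfolding g(3) by (simp_all add: insert_commute)
    have "{p, q} \<notin> ce h" using two_only[OF F(1,2) nfg gf(1) gg(1) F(3)] ne ngh by blast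
    moreover have "{u, v} \<notin> ce h" using two_only[OF F(1,2) nfg gf(2) gg(2) F(3)] ne ngh by blast
    moreover have "{u', v'} \<in> {{u, v}, {v, p}, {p, q}, {q, u}}" using uv'(1) unfolding g(3) .
    ultimately have hh: "{v, p} \<in> ce h \<or> {q, u} \<in> ce h" using uv'(2) by (metis insert_iff empty_iff)
    from hh have h: "{u, p} \<in> ce h \<and> {u, q} \<in> ce h \<and> {v, p} \<in> ce h \<and> {v, q} \<in> ce h"
    proof
      assume "{v, p} \<in> ce h"
      note e' = gg(3) this
      obtain p' q' where h: "distinct [v, p, p', q']" "ce g = {{v, p}, {p, p'}, {p', q'}, {q', v}}" "ce h = {{v, p}, {p, q'}, {q', p'}, {p', v}}"
        using sh_quad[OF S(2,3) l gh e'] by metis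
      have "{p, p'} \<in> ce g" "{q', v} \<in> ce g" unfolding h(2) by blast+
      then have "p' = q \<and> q' = u" using g(1) h(1) unfolding g(3) by (auto simp: doubleton_eq_iff)
      then show ?thesis unfolding h(3) by (simp add: insert_commute)
    next
      assume "{q, u} \<in> ce h"
      note e' = gg(4)[unfolded insert_commute[of u q]] this
      obtain p' q' where h: "distinct [q, u, p', q']" "ce g = {{q, u}, {u, p'}, {p', q'}, {q', q}}" "ce h = {{q, u}, {u, q'}, {q', p'}, {p', q}}"
        using sh_quad[OF S(2,3) l gh e'] by metis
      have "{u, p'} \<in> ce g" "{q', q} \<in> ce g" unfolding h(2) by blast+
      then have "p' = v \<and> q' = p" using g(1) h(1) unfolding g(3) by (auto simp: doubleton_eq_iff)
      then show ?thesis unfolding h(3) by (simp add: insert_commute)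
    qed
    have d1: "distinct [q, v, p]" and d2: "distinct [p, u, q]" using g(1) by auto
    have uv2: "{v, u} = {u, v}" by blast
    have U3: "dg u = 3" "u \<noteq> x0"
      using closed_corner(2,3)[OF S(2,1,3) nfg[symmetric] ne ngh gg(4) gg(2) gf(2) gf(4) _ _ d1] h by blast+
    have V3: "dg v = 3" "v \<noteq> x0"
      using closed_corner(2,3)[OF S(2,1,3) nfg[symmetric] ne ngh gg(3) gg(2)[folded uv2] gf(2)[folded uv2] gf(3) _ _ d2] h by blast+
    have A: "adj u v" "adj v p" "adj u p" "u \<in> U" "v \<in> U" "p \<in> U"
      using ce_adj[OF F(2) gg(2)] ce_adj[OF F(2) gg(3)] ce_adj(1)[OF F(1) gf(4)] by blast+
    show thesis using deg3_unique[OF A(4,5,6,1,3,2) U3(2) V3(2) U3(1) V3(1)] by blast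
  qed
qed

end

context faced begin

section \<open>Clusters of short faces\<close>

definition cl :: "'f \<Rightarrow> 'f set" where "cl f = {g \<in> SF. g = f \<or> sh f g}"
definition CS :: "'f set set" where "CS = cl ` SF"
text \<open>Twice the deficit \<open>7 - len\<close> of a triangular or quadrangular face.\<close>

definition val :: "'f \<Rightarrow> nat" where "val f = (if length (bd f) = 3 then 8 else 6)"
text \<open>The neighbours of \<open>v\<close> along the boundary edges of the cluster \<open>C\<close>; different clusters use different ones.\<close>

definition Nb :: "'f set \<Rightarrow> 'a \<Rightarrow> 'a set" where "Nb C v = {y. \<exists>f\<in>C. {v, y} \<in> ce f}"
definition VC :: "'f set \<Rightarrow> 'a set" where "VC C = (\<Union>f\<in>C. Vf f)"

abbreviation "tla v Z \<equiv> tail adj U x0 v Z"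

text \<open>A payment scheme \<open>p\<close> for the cluster \<open>C\<close>: its vertices pay its weight, up to two units taken from
the \<open>K\<^sub>4\<close> that it spans if it consists of three triangles. The conditions on \<open>p v\<close> are tailored to the vertex count: a vertex that spends two of
its edges on \<open>C\<close> pays at most \<open>2\<close>, or \<open>3\<close> if the remaining neighbours are no tail, or \<open>4\<close> if it sees a pocket of \<open>C\<close>; one that spends three
pays at most \<open>7\<close>, and \<open>7\<close> only if the remaining neighbours are no tail. The vertex \<open>x0\<close> pays in proportion to its faces.\<close>

definition good :: "'f set \<Rightarrow> ('a \<Rightarrow> nat) \<Rightarrow> bool" where
  "good C p \<longleftrightarrow> (\<Sum>f\<in>C. val f) \<le> (\<Sum>v\<in>VC C. p v) + (if card C = 3 then 2 else 0) \<and>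
    (\<forall>v\<in>VC C. v \<noteq> x0 \<longrightarrow> (card (Nb C v) = 2 \<or> card (Nb C v) = 3) \<and> (dg v = 3 \<longrightarrow> p v \<le> 2) \<and>
      (card (Nb C v) = 2 \<longrightarrow> p v \<le> 2 \<or> (p v \<le> 3 \<and> \<not> tla v (Nb C v)) \<or>
         (p v \<le> 4 \<and> (\<exists>b c. Nb C v = {b, c} \<and> b \<noteq> c \<and> pocket adj U x0 v b c))) \<and>
      (card (Nb C v) = 3 \<longrightarrow> p v \<le> 7 \<and> (p v \<le> 6 \<or> \<not> tla v (Nb C v)))) \<and>
    (x0 \<in> VC C \<longrightarrow> p x0 \<le> 4 * card {f \<in> C. x0 \<in> Vf f}) \<and>
    (card C = 3 \<longrightarrow> VC C \<in> K4s adj U \<and> (\<forall>x\<in>VC C. \<forall>y\<in>VC C. x \<noteq> y \<longrightarrow> y \<in> Nb C x))"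

lemma finSF: "finite SF" using finF by (simp add: SF_def)

lemma VfU: "f \<in> F \<Longrightarrow> v \<in> Vf f \<Longrightarrow> v \<in> U"
  using card_cedges(2)[OF cycF] ceF edges_sub by blast

text \<open>Clusters are the classes of an equivalence relation.\<close>

lemma sh_third:
  assumes "f \<in> SF" "g \<in> SF" "h \<in> SF" "sh f g" "sh g h" "f \<noteq> h" shows "sh f h"
  by (rule sh_trans[OF assms]) (use assms(6) in \<open>auto simp: sh_def\<close>)

lemma cl_eq: assumes "f \<in> SF" "g \<in> cl f" shows "cl g = cl f"
proof -
  have g: "g \<in> SF" "g = f \<or> sh f g" using assms(2) by (auto simp: cl_def)
  show ?thesis
  proof (cases "g = f")
    case False
    then have s: "sh f g" "sh g f" using g sh_sym by auto
    have "h \<in> cl f" if "h \<in> cl g" for h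
    proof (cases "h = f \<or> h = g")
      case True then show ?thesis using assms g s by (auto simp: cl_def)
    next
      case False
      then have h: "h \<in> SF" "sh g h" using that by (auto simp: cl_def)
      then show ?thesis using sh_third[OF assms(1) g(1) h(1) s(1) h(2)] False by (auto simp: cl_def)
    qed
    moreover have "h \<in> cl g" if "h \<in> cl f" for h
    proof (cases "h = f \<or> h = g")
      case True then show ?thesis using assms g s by (auto simp: cl_def)
    next
      case False
      then have h: "h \<in> SF" "sh f h" using that by (auto simp: cl_def)
      then show ?thesis using sh_third[OF g(1) assms(1) h(1) s(2) h(2)] False by (auto simp: cl_def)
    qed
    ultimately show ?thesis by blast
  qed simp
qed

lemma cl_self: "f \<in> SF \<Longrightarrow> f \<in> cl f" by (simp add: cl_def)

lemma CS_facts: "finite CS" "\<And>C. C \<in> CS \<Longrightarrow> C \<subseteq> SF" "\<And>C. C \<in> CS \<Longrightarrow> finite C" "\<Union> CS = SF"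
  "\<And>C C' f g. C \<in> CS \<Longrightarrow> C' \<in> CS \<Longrightarrow> f \<in> C \<Longrightarrow> g \<in> C' \<Longrightarrow> f = g \<or> sh f g \<Longrightarrow> C = C'"
proof -
  show "finite CS" using finSF by (simp add: CS_def)
  show s: "C \<subseteq> SF" if "C \<in> CS" for C using that by (auto simp: CS_def cl_def)
  show "finite C" if "C \<in> CS" for C using s[OF that] finSF finite_subset by blast
  show "\<Union> CS = SF" using cl_self by (auto simp: CS_def cl_def)
  show "C = C'" if "C \<in> CS" "C' \<in> CS" "f \<in> C" "g \<in> C'" "f = g \<or> sh f g" for C C' f g
  proof -
    have "C = cl f" "C' = cl g" using that cl_eq by (auto simp: CS_def)
    moreover have "g \<in> cl f" using that s[OF that(2)] by (auto simp: cl_def)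
    ultimately show ?thesis using cl_eq[of f g] that(3) s[OF that(1)] by blast
  qed
qed

lemma Nb_tri:
  assumes "ce f = {{x, y}, {y, z}, {x, z}}" "distinct [x, y, z]"
  shows "{w. {x, w} \<in> ce f} = {y, z}" "{w. {y, w} \<in> ce f} = {x, z}" "{w. {z, w} \<in> ce f} = {x, y}"
    "v \<notin> {x, y, z} \<Longrightarrow> {w. {v, w} \<in> ce f} = {}"
  using assms unfolding assms(1) by (auto simp: doubleton_eq_iff)

lemma Nb_quad:
  assumes "ce f = {{u, v}, {v, p}, {p, q}, {q, u}}" "distinct [u, v, p, q]"
  shows "{w. {u, w} \<in> ce f} = {v, q}" "{w. {v, w} \<in> ce f} = {u, p}" "{w. {p, w} \<in> ce f} = {v, q}" "{w. {q, w} \<in> ce f} = {p, u}"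
  using assms unfolding assms(1) by (auto simp: doubleton_eq_iff)

lemma Nb_Un: "Nb {f} v = {w. {v, w} \<in> ce f}" "Nb {f, g} v = {w. {v, w} \<in> ce f} \<union> {w. {v, w} \<in> ce g}"
  "Nb {f, g, h} v = {w. {v, w} \<in> ce f} \<union> {w. {v, w} \<in> ce g} \<union> {w. {v, w} \<in> ce h}"
  by (auto simp: Nb_def)

lemma tail_deg:
  assumes "Z \<subseteq> N v" "finite Z" "dg v = Suc (card Z)" shows "tla v Z"
proof -
  have "card (N v - Z) = 1" using assms by (simp add: card_Diff_subset)
  then show ?thesis by (auto simp: tail_def card_1_singleton_iff)
qed

lemma tri_adj:
  assumes "f \<in> SF" "ce f = {{x, y}, {y, z}, {x, z}}"
  shows "adj x y" "adj x z" "adj y z" "x \<in> U" "y \<in> U" "z \<in> U"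
  using ce_adj[OF SF_F[OF assms(1)], of x y] ce_adj[OF SF_F[OF assms(1)], of y z] ce_adj[OF SF_F[OF assms(1)], of x z] assms(2) by simp_all

text \<open>At most one vertex has a tail and pays \<open>2\<close>; the others pay \<open>3\<close>.\<close>

lemma good_tri:
  assumes f: "f \<in> SF" "length (bd f) = 3"
  shows "\<exists>p. good {f} p"
proof -
  obtain x y z where t: "distinct [x, y, z]" "Vf f = {x, y, z}" "ce f = {{x, y}, {y, z}, {x, z}}" using triE[OF f] .
  note A = tri_adj[OF f(1) t(3)]
  note Nt = Nb_tri[OF t(3,1)]
  define r where "r = (\<lambda>v. v \<noteq> x0 \<and> tla v (Nb {f} v))"
  define p where "p = (\<lambda>v. if r v then 2 else (3::nat))"
  have nb: "Nb {f} x = {y, z}" "Nb {f} y = {x, z}" "Nb {f} z = {x, y}" using Nt by (simp_all add: Nb_Un)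
  have one: "\<not> (r x \<and> r y)" "\<not> (r x \<and> r z)" "\<not> (r y \<and> r z)"
  proof -
    show "\<not> (r x \<and> r y)" using no_two_tails[of x y z "{}"] A nb by (auto simp: r_def)
    show "\<not> (r x \<and> r z)" using no_two_tails[of x z y "{}"] A nb asym by (auto simp: r_def insert_commute)
    show "\<not> (r y \<and> r z)" using no_two_tails[of y z x "{}"] A nb asym by (auto simp: r_def insert_commute)
  qed
  have V: "VC {f} = {x, y, z}" using t by (simp add: VC_def)
  have cN: "card (Nb {f} v) = 2 \<and> Nb {f} v \<subseteq> N v" if "v \<in> {x, y, z}" for v
    using that nb t(1) A asym by (auto simp: nb_def)
  have "good {f} p" unfolding good_def
  proof (intro conjI ballI impI)
    show "(\<Sum>f\<in>{f}. val f) \<le> (\<Sum>v\<in>VC {f}. p v) + (if card {f} = 3 then 2 else 0)"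
      unfolding V using t(1) f(2) one by (auto simp: val_def p_def)
    fix v assume v: "v \<in> VC {f}" "v \<noteq> x0"
    then have c: "card (Nb {f} v) = 2" "Nb {f} v \<subseteq> N v" using cN V by auto
    then show "card (Nb {f} v) = 2 \<or> card (Nb {f} v) = 3" by simp
    have "tla v (Nb {f} v)" if "dg v = 3" by (rule tail_deg) (use c that in \<open>auto intro: card_ge_0_finite\<close>)
    then show "p v \<le> 2" if "dg v = 3" using that v by (simp add: p_def r_def)
    show "p v \<le> 2 \<or> p v \<le> 3 \<and> \<not> tla v (Nb {f} v) \<or> p v \<le> 4 \<and> (\<exists>b c. Nb {f} v = {b, c} \<and> b \<noteq> c \<and> pocket adj U x0 v b c)"
      using v by (simp add: p_def r_def)
    show "p v \<le> 7" "p v \<le> 6 \<or> \<not> tla v (Nb {f} v)" by (simp_all add: p_def)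
  next
    assume "x0 \<in> VC {f}"
    then have "{g \<in> {f}. x0 \<in> Vf g} = {f}" by (auto simp: VC_def)
    then show "p x0 \<le> 4 * card {g \<in> {f}. x0 \<in> Vf g}" by (simp add: p_def)
  qed auto
  then show ?thesis by blast
qed

lemma good_quad:
  assumes f: "f \<in> SF" "length (bd f) = 4"
  shows "\<exists>p. good {f} p"
proof -
  have "cyc adj (bd f)" using cycF SF_F f by blast
  then have "card (Vf f) = 4" using f(2) by (simp add: cyc_def distinct_card)
  have k: "card (Nb {f} v) = 2" if vf: "v \<in> Vf f" for v
  proof -
    obtain p s where e: "p \<noteq> s" "p \<noteq> v" "s \<noteq> v" "{e \<in> ce f. v \<in> e} = {{v, p}, {v, s}}" using cyc_edges_at[OF \<open>cyc adj (bd f)\<close> vf] .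
    have "{v, w} \<in> ce f \<longleftrightarrow> w = p \<or> w = s" for w
    proof -
      have "{v, w} \<in> ce f \<longleftrightarrow> {v, w} \<in> {e \<in> ce f. v \<in> e}" by simp
      also have "\<dots> \<longleftrightarrow> w = p \<or> w = s" unfolding e(4) using e by (auto simp: doubleton_eq_iff)
      finally show ?thesis .
    qed
    then have "Nb {f} v = {p, s}" by (auto simp: Nb_Un)
    then show ?thesis using e(1) by simp
  qed
  have "good {f} (\<lambda>_. 2)" unfolding good_def
  proof (intro conjI ballI impI)
    show "(\<Sum>f\<in>{f}. val f) \<le> (\<Sum>v\<in>VC {f}. 2) + (if card {f} = 3 then 2 else 0)"
      using \<open>card (Vf f) = 4\<close> f(2) by (simp add: val_def VC_def)
    fix v assume "v \<in> VC {f}"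
    then show "card (Nb {f} v) = 2 \<or> card (Nb {f} v) = 3" using k by (simp add: VC_def)
  next
    assume "x0 \<in> VC {f}"
    then have "{g \<in> {f}. x0 \<in> Vf g} = {f}" by (auto simp: VC_def)
    then show "2 \<le> 4 * card {g \<in> {f}. x0 \<in> Vf g}" by simp
  qed auto
  then show ?thesis by blast
qed

text \<open>The ends \<open>u\<close>, \<open>v\<close> of the common edge pay \<open>6\<close> and the other two vertices \<open>2\<close>. If \<open>u\<close> or \<open>v\<close> has degree three it pays only \<open>2\<close>, but
then both other vertices see a pocket and pay \<open>4\<close>.\<close>

lemma good_diamond:
  assumes S: "f \<in> SF" "g \<in> SF" "f \<noteq> g" "length (bd f) = 3" "length (bd g) = 3"
    and t: "distinct [u, v, a, b]" "Vf f = {u, v, a}" "ce f = {{u, v}, {v, a}, {u, a}}" "Vf g = {u, v, b}" "ce g = {{u, v}, {v, b}, {u, b}}"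
  shows "\<exists>p. good {f, g} p"
proof -
  note A = tri_adj[OF S(1) t(3)] tri_adj[OF S(2) t(5)]
  have ta: "distinct [u, v, a]" and tb: "distinct [u, v, b]" using t(1) by auto
  note Na = Nb_tri[OF t(3) ta] and Nbb = Nb_tri[OF t(5) tb]
  let ?C = "{f, g}"
  have nb: "Nb ?C u = {v, a, b}" "Nb ?C v = {u, a, b}" "Nb ?C a = {u, v}" "Nb ?C b = {u, v}"
    unfolding Nb_Un using Na Nbb t(1) by auto
  have V: "VC ?C = {u, v, a, b}" using t by (auto simp: VC_def)
  define pr where "pr = (\<lambda>w. w \<noteq> x0 \<and> dg w = 3)"
  define p where "p = (\<lambda>w. if w = u \<or> w = v then (if pr w then 2 else 6) else if pr u \<or> pr v then 4 else (2::nat))"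
  have uv: "\<not> (pr u \<and> pr v)" using deg3_unique[of u v a] A asym by (auto simp: pr_def)
  have ua: "\<not> (pr u \<and> pr a)" "\<not> (pr v \<and> pr a)" "\<not> (pr u \<and> pr b)" "\<not> (pr v \<and> pr b)"
    using deg3_unique[of u a v] deg3_unique[of v a u] deg3_unique[of u b v] deg3_unique[of v b u] A asym by (auto simp: pr_def)
  have pk: "pocket adj U x0 w u v" if "pr v" "w = a \<or> w = b" for w
    using that A asym by (auto simp: pocket_def pr_def)
  have pk': "pocket adj U x0 w v u" if "pr u" "w = a \<or> w = b" for w
    using that A asym by (auto simp: pocket_def pr_def)
  have "good ?C p" unfolding good_def
  proof (intro conjI ballI impI)
    have "(\<Sum>f\<in>?C. val f) = 16" using S by (simp add: val_def)
    moreover have "(\<Sum>w\<in>VC ?C. p w) = p u + p v + p a + p b" unfolding V using t(1) by simp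
    moreover have "p u + p v + p a + p b \<ge> 16" using t(1) uv by (auto simp: p_def)
    ultimately show "(\<Sum>f\<in>?C. val f) \<le> (\<Sum>v\<in>VC ?C. p v) + (if card ?C = 3 then 2 else 0)" by simp
    fix w assume w: "w \<in> VC ?C" "w \<noteq> x0"
    have wc: "w = u \<or> w = v \<or> w = a \<or> w = b" using w(1) V by auto
    show "card (Nb ?C w) = 2 \<or> card (Nb ?C w) = 3" using wc nb t(1) by auto
    show "p w \<le> 2" if "dg w = 3"
    proof -
      have "pr w" using that w(2) by (simp add: pr_def)
      then show ?thesis using wc ua by (auto simp: p_def)
    qed
    show "p w \<le> 2 \<or> p w \<le> 3 \<and> \<not> tla w (Nb ?C w) \<or> p w \<le> 4 \<and> (\<exists>b c. Nb ?C w = {b, c} \<and> b \<noteq> c \<and> pocket adj U x0 w b c)"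
      if "card (Nb ?C w) = 2"
    proof -
      have wab: "w = a \<or> w = b" using wc that nb t(1) by auto
      then have nw: "Nb ?C w = {u, v}" "w \<noteq> u" "w \<noteq> v" using nb t(1) by auto
      show ?thesis
      proof (cases "pr u \<or> pr v")
        case False then show ?thesis using nw by (simp add: p_def)
      next
        case True
        then have "p w \<le> 4" using nw by (simp add: p_def)
        moreover have "\<exists>b c. Nb ?C w = {b, c} \<and> b \<noteq> c \<and> pocket adj U x0 w b c"
        proof (cases "pr v")
          case True
          show ?thesis by (rule exI[of _ u], rule exI[of _ v]) (use nw(1) pk[OF True wab] t(1) in auto)
        next
          case False
          then have "pr u" using \<open>pr u \<or> pr v\<close> by blast
          show ?thesis by (rule exI[of _ v], rule exI[of _ u]) (use nw(1) pk'[OF \<open>pr u\<close> wab] t(1) in auto)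
        qed
        ultimately show ?thesis by blast
      qed
    qed
    show "p w \<le> 7" "p w \<le> 6 \<or> \<not> tla w (Nb ?C w)" by (simp_all add: p_def)
  next
    assume "x0 \<in> VC ?C"
    then have xc: "x0 = u \<or> x0 = v \<or> x0 = a \<or> x0 = b" using V by auto
    show "p x0 \<le> 4 * card {f \<in> ?C. x0 \<in> Vf f}"
    proof (cases "x0 = u \<or> x0 = v")
      case True
      then have "{f \<in> ?C. x0 \<in> Vf f} = {f, g}" using t by auto
      then show ?thesis using S(3) by (simp add: p_def)
    next
      case False
      then have "p x0 \<le> 4" by (simp add: p_def)
      moreover have "{f \<in> ?C. x0 \<in> Vf f} \<noteq> {}" using xc False t by auto
      then have "card {f \<in> ?C. x0 \<in> Vf f} \<ge> 1" by (simp add: Suc_le_eq card_gt_0_iff)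
      ultimately show ?thesis by linarith
    qed
  qed (use S(3) in auto)
  then show ?thesis by blast
qed

text \<open>All four vertices pay \<open>4\<close>, except that at most one of degree three pays \<open>2\<close>; the total is at least \<open>14\<close>, more than the weight \<open>12\<close>.\<close>

lemma good_quads:
  assumes S: "f \<in> SF" "g \<in> SF" "f \<noteq> g" "length (bd f) = 4" "length (bd g) = 4"
    and t: "distinct [u, v, p, q]" "Vf f = {u, v, p, q}" "ce f = {{u, v}, {v, p}, {p, q}, {q, u}}"
      "Vf g = {u, v, p, q}" "ce g = {{u, v}, {v, q}, {q, p}, {p, u}}"
  shows "\<exists>p. good {f, g} p"
proof -
  have F: "f \<in> F" "g \<in> F" using S SF_F by blast+
  have A: "adj u v" "adj v p" "adj p q" "adj q u" "adj v q" "adj p u" "u \<in> U" "v \<in> U" "p \<in> U" "q \<in> U"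
    using ce_adj[OF F(1), of u v] ce_adj[OF F(1), of v p] ce_adj[OF F(1), of p q] ce_adj[OF F(1), of q u]
      ce_adj(1)[OF F(2), of v q] ce_adj(1)[OF F(2), of p u] t by simp_all
  let ?C = "{f, g}"
  have t': "distinct [u, v, q, p]" using t(1) by auto
  note N1 = Nb_quad[OF t(3,1)] and N2 = Nb_quad[OF t(5) t']
  have nb: "Nb ?C u = {v, p, q}" "Nb ?C v = {u, p, q}" "Nb ?C p = {u, v, q}" "Nb ?C q = {u, v, p}"
    unfolding Nb_Un using N1 N2 by auto
  have V: "VC ?C = {u, v, p, q}" using t by (auto simp: VC_def)
  define pr where "pr = (\<lambda>w. w \<noteq> x0 \<and> dg w = 3)"
  define P where "P = (\<lambda>w. if pr w then 2 else (4::nat))"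
  have one: "\<not> (pr u \<and> pr v)" "\<not> (pr u \<and> pr p)" "\<not> (pr u \<and> pr q)" "\<not> (pr v \<and> pr p)" "\<not> (pr v \<and> pr q)" "\<not> (pr p \<and> pr q)"
    using deg3_unique[of u v p] deg3_unique[of u p v] deg3_unique[of u q v] deg3_unique[of v p u] deg3_unique[of v q u] deg3_unique[of p q u] A asym
    by (auto simp: pr_def)
  have "good ?C P" unfolding good_def
  proof (intro conjI ballI impI)
    have "(\<Sum>f\<in>?C. val f) = 12" using S by (simp add: val_def)
    moreover have "(\<Sum>w\<in>VC ?C. P w) = P u + P v + P p + P q" unfolding V using t(1) by simp
    moreover have "P u + P v + P p + P q \<ge> 12" using one by (auto simp: P_def)
    ultimately show "(\<Sum>f\<in>?C. val f) \<le> (\<Sum>v\<in>VC ?C. P v) + (if card ?C = 3 then 2 else 0)" by simp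
    fix w assume w: "w \<in> VC ?C" "w \<noteq> x0"
    have c3: "card (Nb ?C w) = 3" using w(1) nb t(1) unfolding V by auto
    show "card (Nb ?C w) = 2 \<or> card (Nb ?C w) = 3" using c3 by simp
    show "P w \<le> 2" if "dg w = 3" using that w(2) by (simp add: P_def pr_def)
    show "P w \<le> 2 \<or> P w \<le> 3 \<and> \<not> tla w (Nb ?C w) \<or> P w \<le> 4 \<and> (\<exists>b c. Nb ?C w = {b, c} \<and> b \<noteq> c \<and> pocket adj U x0 w b c)"
      if "card (Nb ?C w) = 2" using that c3 by simp
    show "P w \<le> 7" "P w \<le> 6 \<or> \<not> tla w (Nb ?C w)" by (simp_all add: P_def)
  next
    assume "x0 \<in> VC ?C"
    then have "{f \<in> ?C. x0 \<in> Vf f} = {f, g}" using V t by auto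
    then show "P x0 \<le> 4 * card {f \<in> ?C. x0 \<in> Vf f}" using S(3) by (simp add: P_def)
  qed (use S(3) in auto)
  then show ?thesis by blast
qed

text \<open>The centre pays \<open>2\<close> and the corners \<open>7\<close>, except for at most one corner with a tail, which pays \<open>6\<close>. Two of the \<open>24\<close> units are left to the \<open>K\<^sub>4\<close>.\<close>

lemma good_K4:
  assumes S: "f \<in> SF" "g \<in> SF" "h \<in> SF" "f \<noteq> g" "g \<noteq> h" "f \<noteq> h" "length (bd f) = 3" "length (bd g) = 3" "length (bd h) = 3"
    and t: "distinct [c, x, y, z]" "Vf f = {c, x, y}" "Vf g = {c, y, z}" "Vf h = {c, x, z}"
      "ce f = {{c, x}, {c, y}, {x, y}}" "ce g = {{c, y}, {c, z}, {y, z}}" "ce h = {{c, x}, {c, z}, {x, z}}"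
    and c: "N c = {x, y, z}" "dg c = 3" "c \<noteq> x0"
  shows "\<exists>p. good {f, g, h} p"
proof -
  have F: "f \<in> F" "g \<in> F" "h \<in> F" using S SF_F by blast+
  have A: "adj c x" "adj c y" "adj c z" "adj x y" "adj y z" "adj x z" "c \<in> U" "x \<in> U" "y \<in> U" "z \<in> U"
    using ce_adj[OF F(1), of c x] ce_adj[OF F(1), of c y] ce_adj[OF F(1), of x y] ce_adj[OF F(2), of c z] ce_adj(1)[OF F(2), of y z]
      ce_adj(1)[OF F(3), of x z] t by simp_all
  have ef: "ce f = {{c, x}, {x, y}, {c, y}}" "ce g = {{c, y}, {y, z}, {c, z}}" "ce h = {{c, x}, {x, z}, {c, z}}"
    using t by auto
  have df: "distinct [c, x, y]" "distinct [c, y, z]" "distinct [c, x, z]" using t(1) by auto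
  note N1 = Nb_tri[OF ef(1) df(1)] and N2 = Nb_tri[OF ef(2) df(2)] and N3 = Nb_tri[OF ef(3) df(3)]
  let ?C = "{f, g, h}"
  have nb: "Nb ?C c = {x, y, z}" "Nb ?C x = {c, y, z}" "Nb ?C y = {c, x, z}" "Nb ?C z = {c, x, y}"
  proof -
    have "x \<notin> {c, y, z}" "y \<notin> {c, x, z}" "z \<notin> {c, x, y}" using t(1) by auto
    note o = N2(4)[OF this(1)] N3(4)[OF this(2)] N1(4)[OF this(3)]
    show "Nb ?C c = {x, y, z}" "Nb ?C x = {c, y, z}" "Nb ?C y = {c, x, z}" "Nb ?C z = {c, x, y}"
      unfolding Nb_Un N1 N2 N3 o by auto
  qed
  have V: "VC ?C = {c, x, y, z}" using t by (auto simp: VC_def)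
  have cC: "card ?C = 3" using S by simp
  define r where "r = (\<lambda>w. w \<noteq> x0 \<and> tla w (Nb ?C w))"
  define p where "p = (\<lambda>w. if w = c then 2 else if r w then 6 else (7::nat))"
  have one: "\<not> (r x \<and> r y)" "\<not> (r x \<and> r z)" "\<not> (r y \<and> r z)"
  proof -
    have Q: "{c} = {} \<or> (\<exists>v. {c} = {v} \<and> v \<in> U \<and> v \<noteq> x0 \<and> N v = {i, j, k})" if "{i, j, k} = {x, y, z}" for i j k
      using A c that by auto
    show "\<not> (r x \<and> r y)"
      using no_two_tails[of x y z "{c}", OF A(8,9,10,4,6,5) _ _ Q[OF refl]] nb by (auto simp: r_def insert_commute)
    have "{x, z, y} = {x, y, z}" by auto
    then show "\<not> (r x \<and> r z)"
      using no_two_tails[of x z y "{c}", OF A(8,10,9,6,4) asym[OF A(5)] _ _ Q] nb by (auto simp: r_def insert_commute)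
    have "{y, z, x} = {x, y, z}" by auto
    then show "\<not> (r y \<and> r z)"
      using no_two_tails[of y z x "{c}", OF A(9,10,8,5) asym[OF A(4)] asym[OF A(6)] _ _ Q] nb by (auto simp: r_def insert_commute)
  qed
  have n3: "dg w \<noteq> 3" if "w = x \<or> w = y \<or> w = z" "w \<noteq> x0" for w
    using deg3_unique[of w c] that A c asym by (metis (no_types))
  have sub: "Nb ?C w \<subseteq> N w" "card (Nb ?C w) = 3" if "w \<in> {c, x, y, z}" for w
    using that nb A asym t(1) by (auto simp: nb_def)
  have "good ?C p" unfolding good_def
  proof (intro conjI ballI impI)
    have "(\<Sum>f\<in>?C. val f) = 24" using S by (simp add: val_def)
    moreover have "(\<Sum>w\<in>VC ?C. p w) = p c + p x + p y + p z" unfolding V using t(1) by simp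
    moreover have "p c + p x + p y + p z \<ge> 22" using t(1) one by (auto simp: p_def)
    ultimately show "(\<Sum>f\<in>?C. val f) \<le> (\<Sum>v\<in>VC ?C. p v) + (if card ?C = 3 then 2 else 0)" using cC by simp
    fix w assume w: "w \<in> VC ?C" "w \<noteq> x0"
    have c3: "card (Nb ?C w) = 3" using sub(2) w(1) V by blast
    show "card (Nb ?C w) = 2 \<or> card (Nb ?C w) = 3" using c3 by simp
    show "p w \<le> 2" if "dg w = 3" using that n3[of w] w V by (auto simp: p_def)
    show "p w \<le> 2 \<or> p w \<le> 3 \<and> \<not> tla w (Nb ?C w) \<or> p w \<le> 4 \<and> (\<exists>b c. Nb ?C w = {b, c} \<and> b \<noteq> c \<and> pocket adj U x0 w b c)"
      if "card (Nb ?C w) = 2" using that c3 by simp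
    show "p w \<le> 7" by (simp add: p_def)
    show "p w \<le> 6 \<or> \<not> tla w (Nb ?C w)" using w(2) by (simp add: p_def r_def)
  next
    assume "x0 \<in> VC ?C"
    then have xc: "x0 = x \<or> x0 = y \<or> x0 = z" using V c(3) by auto
    have "card {k \<in> ?C. x0 \<in> Vf k} \<ge> 2"
    proof -
      have "{f, h} \<subseteq> {k \<in> ?C. x0 \<in> Vf k} \<or> {f, g} \<subseteq> {k \<in> ?C. x0 \<in> Vf k} \<or> {g, h} \<subseteq> {k \<in> ?C. x0 \<in> Vf k}"
        using xc t by auto
      moreover have "card {f, h} = 2" "card {f, g} = 2" "card {g, h} = 2" using S by simp_all
      ultimately show ?thesis by (metis (no_types, lifting) card_mono finite.emptyI finite.insertI finite_Collect_conjI finite_subset mem_Collect_eq subsetI)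
    qed
    moreover have "p x0 \<le> 7" by (simp add: p_def)
    ultimately show "p x0 \<le> 4 * card {f \<in> ?C. x0 \<in> Vf f}" by linarith
  next
    show "VC ?C \<in> K4s adj U" unfolding V K4s_def using A asym t(1) by auto
    show "w' \<in> Nb ?C w" if "w \<in> VC ?C" "w' \<in> VC ?C" "w \<noteq> w'" for w w' using that V nb by auto
  qed
  then show ?thesis by blast
qed

lemma good_exists: assumes C: "C \<in> CS" shows "\<exists>p. good C p"
proof -
  obtain f where f: "f \<in> SF" "C = cl f" using C by (auto simp: CS_def)
  show ?thesis
  proof (cases "\<exists>g\<in>SF. sh f g")
    case False
    then have "C = {f}" using f by (auto simp: cl_def)
    then show ?thesis using good_tri good_quad len34 f(1) by blast
  next
    case True
    then obtain g where g: "g \<in> SF" "sh f g" by blast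
    have fg: "f \<noteq> g" using g(2) by (simp add: sh_def)
    show ?thesis
    proof (cases "\<exists>h\<in>SF. h \<noteq> f \<and> h \<noteq> g \<and> sh f h")
      case False
      then have Cfg: "C = {f, g}" using f g by (auto simp: cl_def)
      obtain u v where uv: "{u, v} \<in> ce f" "{u, v} \<in> ce g" using sh_edge[OF g(2) f(1)] .
      show ?thesis
      proof (cases "length (bd f) = 3")
        case True
        obtain a b where "distinct [u, v, a, b]" "Vf f = {u, v, a}" "ce f = {{u, v}, {v, a}, {u, a}}"
          "Vf g = {u, v, b}" "ce g = {{u, v}, {v, b}, {u, b}}" "length (bd g) = 3" using sh_tri[OF f(1) g(1) True g(2) uv] .
        then show ?thesis unfolding Cfg by (intro good_diamond[OF f(1) g(1) fg True])
      next
        case False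
        then have l: "length (bd f) = 4" using len34 f(1) by blast
        obtain p q where "distinct [u, v, p, q]" "Vf f = {u, v, p, q}" "ce f = {{u, v}, {v, p}, {p, q}, {q, u}}"
          "Vf g = {u, v, p, q}" "ce g = {{u, v}, {v, q}, {q, p}, {p, u}}" "length (bd g) = 4" using sh_quad[OF f(1) g(1) l g(2) uv] .
        then show ?thesis unfolding Cfg by (intro good_quads[OF f(1) g(1) fg l])
      qed
    next
      case True
      then obtain h where h: "h \<in> SF" "h \<noteq> f" "h \<noteq> g" "sh f h" by blast
      have gh: "sh g h" using sh_third[OF g(1) f(1) h(1) sh_sym[OF g(2)] h(4)] h(3) by simp
      obtain c x y z where k: "distinct [c, x, y, z]" "length (bd f) = 3" "length (bd g) = 3" "length (bd h) = 3"
        "Vf f = {c, x, y}" "Vf g = {c, y, z}" "Vf h = {c, x, z}"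
        "ce f = {{c, x}, {c, y}, {x, y}}" "ce g = {{c, y}, {c, z}, {y, z}}" "ce h = {{c, x}, {c, z}, {x, z}}"
        "N c = {x, y, z}" "dg c = 3" "c \<noteq> x0"
        using sh_trans[OF f(1) g(1) h(1) g(2) gh h(2)[symmetric]] .
      have "C = {f, g, h}"
      proof
        show "{f, g, h} \<subseteq> C" using f g h by (auto simp: cl_def)
        show "C \<subseteq> {f, g, h}"
        proof
          fix k' assume "k' \<in> C"
          show "k' \<in> {f, g, h}"
          proof (rule ccontr)
            assume n: "k' \<notin> {f, g, h}"
            then have k': "k' \<in> SF" "sh f k'" "k' \<noteq> g" using \<open>k' \<in> C\<close> f by (auto simp: cl_def)
            obtain c' x' y' z' where m: "distinct [c', x', y', z']"
              "ce k' = {{c', x'}, {c', y'}, {x', y'}}" "ce f = {{c', y'}, {c', z'}, {y', z'}}" "ce g = {{c', x'}, {c', z'}, {x', z'}}"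
              "dg c' = 3" "c' \<noteq> x0"
              using sh_trans[OF k'(1) f(1) g(1) sh_sym[OF k'(2)] g(2) k'(3)] by metis
            have F: "f \<in> F" "g \<in> F" "h \<in> F" "k' \<in> F" using f(1) g(1) h(1) k'(1) SF_F by blast+
            have "{c', z'} \<in> ce f" "{c', z'} \<in> ce g" using m by auto
            then have "{c', z'} \<in> {{c, x}, {c, y}, {x, y}} \<inter> {{c, y}, {c, z}, {y, z}}" unfolding k(8,9) by blast
            then have e: "c' = c \<and> z' = y \<or> c' = y \<and> z' = c" using k(1) by (auto simp: doubleton_eq_iff)
            show False
            proof (cases "c' = c")
              case True
              then have "z' = y" using e k(1) by auto
              have "{c, y'} \<in> ce f" using m(3) True by auto
              then have "{c, y'} \<in> {{c, x}, {c, y}, {x, y}}" unfolding k(8) .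
              then have "y' = x" using m(1) \<open>z' = y\<close> k(1) True by (auto simp: doubleton_eq_iff)
              then have "{c, x} \<in> ce k'" using m(2) True by auto
              moreover have "{c, x} \<in> ce f" "{c, x} \<in> ce h" using k(8,10) by auto
              ultimately have "k' = f \<or> k' = h" using two_only[OF F(1,3) h(2)[symmetric]] F(4) by blast
              then show False using n by blast
            next
              case False
              then have "dg y = 3" "y \<noteq> x0" using e m(5,6) by auto
              moreover have "adj c y" "adj c x" "adj y x" "c \<in> U" "y \<in> U" "x \<in> U"
                using ce_adj[OF F(1), of c y] ce_adj[OF F(1), of c x] ce_adj[OF F(1), of x y] asym k(8) by auto
              ultimately show False using deg3_unique[of c y x] k(12,13) by blast
            qed
          qed
        qed
      qed
      then show ?thesis using good_K4[OF f(1) g(1) h(1) fg h(3)[symmetric] h(2)[symmetric] k(2,3,4) k(1) k(5-13)] by simp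
    qed
  qed
qed

end

context faced begin

section \<open>Discharging\<close>

lemma Nb_N: "C \<in> CS \<Longrightarrow> Nb C v \<subseteq> N v"
proof
  fix y assume C: "C \<in> CS" and "y \<in> Nb C v"
  then obtain f where f: "f \<in> C" "{v, y} \<in> ce f" by (auto simp: Nb_def)
  then have "f \<in> F" using CS_facts(2)[OF C] SF_F by blast
  then show "y \<in> N v" using ce_adj[OF _ f(2)] by (simp add: nb_def)
qed

lemma Nb_disjoint:
  assumes "C \<in> CS" "C' \<in> CS" "C \<noteq> C'" shows "Nb C v \<inter> Nb C' v = {}"
proof (rule ccontr)
  assume "\<not> ?thesis"
  then obtain y f g where y: "f \<in> C" "{v, y} \<in> ce f" "g \<in> C'" "{v, y} \<in> ce g" by (auto simp: Nb_def)
  then have "f = g \<or> sh f g" by (auto simp: sh_def)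
  then show False using CS_facts(5)[OF assms(1,2) y(1,3)] assms(3) by blast
qed

lemma goodD:
  assumes "good C p" "v \<in> VC C" "v \<noteq> x0"
  shows "card (Nb C v) = 2 \<or> card (Nb C v) = 3" "dg v = 3 \<Longrightarrow> p v \<le> 2"
    "card (Nb C v) = 2 \<Longrightarrow> p v \<le> 2 \<or> (p v \<le> 3 \<and> \<not> tla v (Nb C v)) \<or>
         (p v \<le> 4 \<and> (\<exists>b c. Nb C v = {b, c} \<and> b \<noteq> c \<and> pocket adj U x0 v b c))"
    "card (Nb C v) = 3 \<Longrightarrow> p v \<le> 7" "card (Nb C v) = 3 \<Longrightarrow> p v \<le> 6 \<or> \<not> tla v (Nb C v)"
  using assms unfolding good_def by blast+

text \<open>The clusters at \<open>v\<close> use disjoint sets of edges at \<open>v\<close>, two or three each, for payments of at most \<open>4\<close> and \<open>7\<close>; so at most \<open>7/3\<close> per edge, which suffices from degree six on. For smaller degrees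
there are at most two clusters, and a payment that is too large for the bound would need a tail or two pockets at \<open>v\<close> where there are none.\<close>

lemma vertex_pays:
  assumes v: "v \<in> U" "v \<noteq> x0" and P: "\<And>C. C \<in> CS \<Longrightarrow> good C (P C)"
  shows "(\<Sum>C\<in>{C \<in> CS. v \<in> VC C}. P C v) + 10 \<le> 4 * dg v"
proof -
  define M where "M = {C \<in> CS. v \<in> VC C}"
  define k where "k = (\<lambda>C. card (Nb C v))"
  have finM: "finite M" using CS_facts(1) by (simp add: M_def)
  have M: "C \<in> CS" "v \<in> VC C" "good C (P C)" if "C \<in> M" for C using that P by (simp_all add: M_def)
  note G = goodD[OF M(3,2) v(2)]
  have k23: "k C = 2 \<or> k C = 3" if "C \<in> M" for C using G(1)[OF that that] by (simp add: k_def)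
  have p4: "P C v \<le> 4" if "C \<in> M" "k C = 2" for C using G(3)[OF that(1) that(1)] that(2) by (auto simp: k_def)
  have p7: "P C v \<le> 7" if "C \<in> M" "k C = 3" for C using G(4)[OF that(1) that(1)] that(2) by (auto simp: k_def)
  have sumk: "(\<Sum>C\<in>M. k C) \<le> dg v"
  proof -
    have "(\<Sum>C\<in>M. k C) = card (\<Union>C\<in>M. Nb C v)" unfolding k_def
    proof (rule card_UN_disjoint[symmetric, OF finM]; intro ballI impI)
      show "finite (Nb C v)" if "C \<in> M" for C by (rule finite_subset[OF Nb_N[OF M(1)[OF that]] finN])
      show "Nb C v \<inter> Nb D v = {}" if "C \<in> M" "D \<in> M" "C \<noteq> D" for C D by (rule Nb_disjoint[OF M(1)[OF that(1)] M(1)[OF that(2)] that(3)])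
    qed
    also have "\<dots> \<le> dg v" by (rule card_mono[OF finN]) (use Nb_N M in blast)
    finally show ?thesis .
  qed
  have d3: "dg v \<ge> 3" using degree_ge_3 v by blast
  have two: "2 * card M \<le> (\<Sum>C\<in>M. k C)"
  proof -
    have "2 \<le> k C" if "C \<in> M" for C using k23[OF that] by linarith
    then show ?thesis using sum_bounded_below[of M 2 k] by (simp add: mult.commute)
  qed
  \<comment> \<open>a pocket of one cluster is the tail left over by the other\<close>
  have pk: "tla v (Nb C' v)" if h: "C \<in> M" "C' \<in> M" "C \<noteq> C'" "k C = 2" "k C' + 2 = dg v" "\<not> P C v \<le> 3" for C C'
  proof -
    obtain b c where bc: "Nb C v = {b, c}" "pocket adj U x0 v b c" using G(3)[OF h(1) h(1)] h(4,6) unfolding k_def by fastforce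
    have "card (N v - Nb C' v) = dg v - card (Nb C' v)"
      by (rule card_Diff_subset[OF finite_subset[OF Nb_N finN] Nb_N]) (rule M(1)[OF h(2)])+
    then have "card (N v - Nb C' v) = 2" using h(5) by (simp add: k_def)
    moreover have "Nb C v \<subseteq> N v - Nb C' v" using Nb_N[OF M(1)[OF h(1)]] Nb_disjoint[OF M(1)[OF h(1)] M(1)[OF h(2)] h(3)] by blast
    moreover have "card (Nb C v) = 2" using h(4) by (simp add: k_def)
    ultimately have "N v - Nb C' v = {b, c}" using card_subset_eq[of "N v - Nb C' v" "Nb C v"] finN bc(1) by auto
    then show ?thesis unfolding tail_def using bc(2) by blast
  qed
  have "(\<Sum>C\<in>M. P C v) + 10 \<le> 4 * dg v"
  proof (cases "dg v \<ge> 6")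
    case True
    have "3 * (\<Sum>C\<in>M. P C v) = (\<Sum>C\<in>M. 3 * P C v)" by (simp add: sum_distrib_left)
    also have "\<dots> \<le> (\<Sum>C\<in>M. 7 * k C)"
    proof (rule sum_mono)
      fix C assume C: "C \<in> M"
      show "3 * P C v \<le> 7 * k C" using k23[OF C] p4[OF C] p7[OF C] by linarith
    qed
    also have "\<dots> = 7 * (\<Sum>C\<in>M. k C)" by (simp add: sum_distrib_left)
    finally show ?thesis using sumk True by linarith
  next
    case False
    then have "card M \<le> 2" using two sumk by linarith
    then consider "card M = 0" | "card M = 1" | "card M = 2" by linarith
    then show ?thesis
    proof cases
      case 1 then have "M = {}" using finM by simp
      then show ?thesis using d3 by simp
    next
      case 2
      then obtain C where C: "M = {C}" by (auto simp: card_1_singleton_iff)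
      then have CM: "C \<in> M" by simp
      have s: "(\<Sum>C\<in>M. P C v) = P C v" unfolding C by simp
      have t: "tla v (Nb C v)" if "k C = 3" "dg v = 4"
        by (rule tail_deg[OF Nb_N[OF M(1)[OF CM]] finite_subset[OF Nb_N[OF M(1)[OF CM]] finN]]) (use that in \<open>simp add: k_def\<close>)
      have "dg v = 3 \<longrightarrow> P C v \<le> 2" using G(2)[OF CM CM] by blast
      moreover have "dg v = 4 \<longrightarrow> P C v \<le> 6" using k23[OF CM] p4[OF CM] G(5)[OF CM CM] t by (auto simp: k_def)
      moreover have "P C v \<le> 7" using k23[OF CM] p4[OF CM] p7[OF CM] by linarith
      ultimately show ?thesis unfolding s using d3 by linarith
    next
      case 3
      then obtain C D where CD: "M = {C, D}" "C \<noteq> D" by (auto simp: card_2_iff)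
      then have CM: "C \<in> M" and DM: "D \<in> M" by simp_all
      have s: "(\<Sum>C\<in>M. P C v) = P C v + P D v" and ks: "k C + k D \<le> dg v" using CD sumk by simp_all
      note kk = k23[OF CM] k23[OF DM]
      note pp = p4[OF CM] p4[OF DM] p7[OF CM] p7[OF DM]
      have four: ?thesis if d: "dg v = 4"
      proof -
        have k2: "k C = 2" "k D = 2" using d ks kk by linarith+
        have nb: "P X v \<le> 2 \<or> (P X v \<le> 3 \<and> \<not> tla v (Nb X v)) \<or>
             (P X v \<le> 4 \<and> (\<exists>b c. Nb X v = {b, c} \<and> b \<noteq> c \<and> pocket adj U x0 v b c))" if "X \<in> M" for X
          using G(3)[OF that that] that CD(1) k2 by (auto simp: k_def)
        have CU: "Nb C v \<union> Nb D v = N v"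
        proof (rule card_subset_eq[OF finN])
          show "Nb C v \<union> Nb D v \<subseteq> N v" using Nb_N M(1) CM DM by blast
          have fin: "finite (Nb C v)" "finite (Nb D v)" using Nb_N M(1) CM DM finN finite_subset by metis+
          then show "card (Nb C v \<union> Nb D v) = dg v"
            using card_Un_disjoint[OF fin Nb_disjoint[OF M(1)[OF CM] M(1)[OF DM] CD(2)]] k2 d by (simp add: k_def)
        qed
        have half: "P Y v \<le> 2" if X: "X \<in> M" "Y \<in> M" "X \<noteq> Y" "Nb X v \<union> Nb Y v = N v" "k X = 2" "k Y = 2" "\<not> P X v \<le> 3" for X Y
        proof (rule ccontr)
          assume n: "\<not> P Y v \<le> 2"
          obtain b c where b: "Nb X v = {b, c}" "b \<noteq> c" "pocket adj U x0 v b c" using nb[OF X(1)] X(7) by force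
          have "tla v (Nb Y v)" using pk[OF X(1-3,5) _ X(7)] X(6) d by simp
          then obtain b' c' where b': "Nb Y v = {b', c'}" "b' \<noteq> c'" "pocket adj U x0 v b' c'" using nb[OF X(2)] n by force
          have "{b, c} \<inter> {b', c'} = {}" using Nb_disjoint[OF M(1)[OF X(1)] M(1)[OF X(2)] X(3), of v] b(1) b'(1) by simp
          moreover have "N v = {b, c, b', c'}" using X(4) b(1) b'(1) by auto
          ultimately show False using no_two_pockets[OF v, of b c b' c'] b b' by auto
        qed
        have DU: "Nb D v \<union> Nb C v = N v" using CU by blast
        show ?thesis using half[OF CM DM CD(2) CU k2] half[OF DM CM CD(2)[symmetric] DU k2(2,1)] pp k2 d unfolding s by linarith
      qed
      have mixed: "P C' v + P D' v \<le> 10" if X: "C' \<in> M" "D' \<in> M" "C' \<noteq> D'" "k C' = 2" "k D' = 3" "dg v = 5" for C' D'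
      proof (cases "P C' v \<le> 3")
        case True then show ?thesis using p7[OF X(2,5)] by linarith
      next
        case False
        then have "tla v (Nb D' v)" using pk[OF X(1-4)] X(5,6) by simp
        then have "P D' v \<le> 6" using G(5)[OF X(2) X(2)] X(5) by (auto simp: k_def)
        then show ?thesis using p4[OF X(1,4)] by linarith
      qed
      have five: ?thesis if d: "dg v = 5"
        using mixed[OF CM DM CD(2) _ _ d] mixed[OF DM CM CD(2)[symmetric] _ _ d] kk pp ks d unfolding s by linarith
      have "dg v = 4 \<or> dg v = 5" using ks kk False by linarith
      then show ?thesis using four five by blast
    qed
  qed
  then show ?thesis by (simp add: M_def)
qed

lemma faces_at: assumes "v \<in> U" shows "card {f \<in> F. v \<in> Vf f} = dg v"
proof -
  let ?E = "{e \<in> edges adj U. v \<in> e}"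
  have inj: "inj_on (\<lambda>y. {v, y}) (N v)" by (auto simp: inj_on_def doubleton_eq_iff)
  have cE: "card ?E = dg v" "finite ?E" unfolding edge_at[OF assms] using card_image[OF inj] finN by simp_all
  have c: "card {e \<in> ?E. e \<in> ce f} = (if v \<in> Vf f then 2 else 0)" if f: "f \<in> F" for f
  proof (cases "v \<in> Vf f")
    case True
    obtain p s where e: "p \<noteq> s" "{e \<in> ce f. v \<in> e} = {{v, p}, {v, s}}" using cyc_edges_at[OF cycF[OF f] True] by metis
    have "{e \<in> ?E. e \<in> ce f} = {e \<in> ce f. v \<in> e}" using ceF[OF f] by blast
    then show ?thesis using True e by (simp add: doubleton_eq_iff)
  next
    case False
    then have "{e \<in> ?E. e \<in> ce f} = {}" using cyc_mem[OF cycF[OF f]] by blast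
    then show ?thesis using False by (simp only: card.empty if_False)
  qed
  have "(\<Sum>f\<in>F. card {e \<in> ?E. e \<in> ce f}) = (\<Sum>e\<in>?E. 2)"
    by (rule sum_multicount_gen) (use finF cE twoF in auto)
  moreover have "(\<Sum>f\<in>F. card {e \<in> ?E. e \<in> ce f}) = (\<Sum>f\<in>F. if v \<in> Vf f then 2 else 0)" by (rule sum.cong) (use c in auto)
  moreover have "\<dots> = 2 * card {f \<in> F. v \<in> Vf f}" using finF by (simp add: sum.If_cases Int_def)
  ultimately show ?thesis using cE by simp
qed

lemma degree_sum: "(\<Sum>v\<in>U. dg v) = 2 * card (edges adj U)"
proof -
  have fE: "finite (edges adj U)" using finU finite_edges by blast
  have "(\<Sum>v\<in>U. card {e \<in> edges adj U. v \<in> e}) = (\<Sum>e\<in>edges adj U. 2)"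
  proof (rule sum_multicount_gen[OF finU fE], rule ballI)
    fix e assume "e \<in> edges adj U"
    then obtain x y where e: "e = {x, y}" "x \<in> U" "y \<in> U" "adj x y" by (auto elim: edgesE)
    then have "{i \<in> U. i \<in> e} = {x, y}" "x \<noteq> y" using airr by auto
    then show "card {i \<in> U. i \<in> e} = 2" by simp
  qed
  moreover have "card {e \<in> edges adj U. v \<in> e} = dg v" if "v \<in> U" for v
    unfolding edge_at[OF that] by (rule card_image) (auto simp: inj_on_def doubleton_eq_iff)
  ultimately show ?thesis by simp
qed

lemma length_sum: "(\<Sum>f\<in>F. length (bd f)) = 2 * card (edges adj U)"
proof -
  have fE: "finite (edges adj U)" using finU finite_edges by blast
  have "(\<Sum>f\<in>F. card {e \<in> edges adj U. e \<in> ce f}) = (\<Sum>e\<in>edges adj U. 2)"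
    by (rule sum_multicount_gen[OF finF fE]) (use twoF in auto)
  moreover have "card {e \<in> edges adj U. e \<in> ce f} = length (bd f)" if "f \<in> F" for f
  proof -
    have "{e \<in> edges adj U. e \<in> ce f} = ce f" using ceF[OF that] by blast
    then show ?thesis using card_cedges(1)[OF cycF[OF that]] by simp
  qed
  ultimately show ?thesis by simp
qed

text \<open>A cluster of three triangles determines its \<open>K\<^sub>4\<close>, and different clusters have different ones since they share no edge; so the \<open>K\<^sub>4\<close> contribute at most two units each.\<close>

lemma weight_bound:
  assumes P: "\<And>C. C \<in> CS \<Longrightarrow> good C (P C)"
  shows "(\<Sum>f\<in>SF. val f) \<le> (\<Sum>v\<in>U. \<Sum>C\<in>{C \<in> CS. v \<in> VC C}. P C v) + 2 * card (K4s adj U)"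
proof -
  have disj: "C \<inter> C' = {}" if "C \<in> CS" "C' \<in> CS" "C \<noteq> C'" for C C' using CS_facts(5)[OF that(1,2)] that(3) by blast
  have VU: "VC C \<subseteq> U" if "C \<in> CS" for C
  proof
    fix v assume "v \<in> VC C"
    then obtain f where "f \<in> C" "v \<in> Vf f" by (auto simp: VC_def)
    then show "v \<in> U" using VfU CS_facts(2)[OF that] SF_F by blast
  qed
  have "(\<Sum>f\<in>SF. val f) = (\<Sum>f\<in>\<Union>CS. val f)" by (simp add: CS_facts(4))
  also have "\<dots> = (\<Sum>C\<in>CS. \<Sum>f\<in>C. val f)"
    by (subst sum.Union_disjoint) (use CS_facts(3) disj in auto)
  also have "\<dots> \<le> (\<Sum>C\<in>CS. (\<Sum>v\<in>VC C. P C v) + (if card C = 3 then 2 else 0))"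
    by (rule sum_mono) (use P in \<open>auto simp: good_def\<close>)
  also have "\<dots> = (\<Sum>C\<in>CS. \<Sum>v\<in>VC C. P C v) + (\<Sum>C\<in>CS. if card C = 3 then 2 else 0)" by (rule sum.distrib)
  also have "(\<Sum>C\<in>CS. \<Sum>v\<in>VC C. P C v) = (\<Sum>C\<in>CS. \<Sum>v\<in>{v \<in> U. v \<in> VC C}. P C v)"
  proof (rule sum.cong[OF refl])
    fix C assume "C \<in> CS"
    then have "{v \<in> U. v \<in> VC C} = VC C" using VU by blast
    then show "(\<Sum>v\<in>VC C. P C v) = (\<Sum>v\<in>{v \<in> U. v \<in> VC C}. P C v)" by simp
  qed
  also have "\<dots> = (\<Sum>v\<in>U. \<Sum>C\<in>{C \<in> CS. v \<in> VC C}. P C v)" by (rule sum.swap_restrict[OF CS_facts(1) finU])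
  also have "(\<Sum>C\<in>CS. if card C = 3 then 2 else 0) = 2 * card {C \<in> CS. card C = 3}"
    using CS_facts(1) by (simp add: sum.If_cases Int_def)
  also have "card {C \<in> CS. card C = 3} \<le> card (K4s adj U)"
  proof (rule card_inj_on_le[of VC])
    have g: "VC C \<in> K4s adj U" "\<And>x y. x \<in> VC C \<Longrightarrow> y \<in> VC C \<Longrightarrow> x \<noteq> y \<Longrightarrow> y \<in> Nb C x" if "C \<in> CS" "card C = 3" for C
      using P[OF that(1)] that(2) unfolding good_def by blast+
    show "VC ` {C \<in> CS. card C = 3} \<subseteq> K4s adj U" using g(1) by blast
    show "finite (K4s adj U)" using finite_K4s[OF finU] .
    show "inj_on VC {C \<in> CS. card C = 3}"
    proof (rule inj_onI, elim CollectE conjE)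
      fix C D assume C: "C \<in> CS" "card C = 3" and D: "D \<in> CS" "card D = 3" and e: "VC C = VC D"
      have c4: "card (VC C) = 4" using g(1)[OF C] by (simp add: K4s_def)
      then have "finite (VC C)" using card_ge_0_finite by force
      then obtain x y where xy: "x \<in> VC C" "y \<in> VC C" "x \<noteq> y" using card_le_Suc0_iff_eq[of "VC C"] c4 by auto
      have "y \<in> Nb C x" using g(2)[OF C] xy by blast
      moreover have "y \<in> Nb D x" using g(2)[OF D] xy e by blast
      ultimately show "C = D" using Nb_disjoint[OF C(1) D(1)] by blast
    qed
  qed
  finally show ?thesis by simp
qed

text \<open>With \<open>d\<close> the degree of \<open>x0\<close>, the term of \<open>x0\<close> together with the constant \<open>24\<close> amounts to \<open>4 d + 14\<close>. On the other side stand the payment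
of \<open>x0\<close>, at most \<open>4 d\<close>, or for \<open>d \<le> 3\<close> the exempt faces, of weight at most \<open>8 d\<close>; neither is enough.\<close>

lemma discharging_contradiction:
  assumes len: "\<And>f. f \<in> F \<Longrightarrow> length (bd f) \<noteq> 5 \<and> length (bd f) \<noteq> 6"
    and euler: "card F + card U = card (edges adj U) + 2"
    and dense: "2 * card U + card (K4s adj U) \<le> card (edges adj U) + 2"
  shows False
proof -
  define w where "w = (\<lambda>f. if length (bd f) = 3 then 8 else if length (bd f) = 4 then 6 else (0::nat))"
  \<comment> \<open>each face has length at least \<open>7\<close> after a triangle has been credited with \<open>4\<close> and a quadrangle with \<open>3\<close>; all is doubled\<close>
  have "14 * card F = (\<Sum>f\<in>F. 14)" by simp
  also have "\<dots> \<le> (\<Sum>f\<in>F. 2 * length (bd f) + w f)"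
  proof (rule sum_mono)
    fix f assume f: "f \<in> F"
    have "length (bd f) \<ge> 3" using cycF[OF f] by (simp add: cyc_def)
    then have "length (bd f) = 3 \<or> length (bd f) = 4 \<or> length (bd f) \<ge> 7" using len[OF f] by linarith
    then show "14 \<le> 2 * length (bd f) + w f" by (auto simp: w_def)
  qed
  also have "\<dots> = 4 * card (edges adj U) + (\<Sum>f\<in>F. w f)"
    using length_sum by (simp add: sum.distrib sum_distrib_left[symmetric])
  finally have 1: "14 * card F \<le> 4 * card (edges adj U) + (\<Sum>f\<in>F. w f)" .
  have SFF: "SF \<subseteq> F" by (auto simp: SF_def)
  have "(\<Sum>f\<in>F. w f) = (\<Sum>f\<in>SF. w f) + (\<Sum>f\<in>F - SF. w f)" using sum.subset_diff[OF SFF finF, of w] by simp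
  moreover have "(\<Sum>f\<in>SF. w f) = (\<Sum>f\<in>SF. val f)" by (rule sum.cong) (use len34 in \<open>auto simp: w_def val_def\<close>)
  moreover have "(\<Sum>f\<in>F - SF. w f) \<le> (if dg x0 \<le> 3 then 8 * dg x0 else 0)"
  proof (cases "dg x0 \<le> 3")
    case True
    have "(\<Sum>f\<in>F - SF. w f) = (\<Sum>f\<in>{f \<in> F - SF. x0 \<in> Vf f}. w f)"
      by (rule sum.mono_neutral_right) (use finF in \<open>auto simp: w_def SF_def\<close>)
    also have "\<dots> \<le> card {f \<in> F - SF. x0 \<in> Vf f} * 8" using sum_bounded_above[of "{f \<in> F - SF. x0 \<in> Vf f}" w 8] by (simp add: w_def)
    also have "card {f \<in> F - SF. x0 \<in> Vf f} \<le> card {f \<in> F. x0 \<in> Vf f}" by (rule card_mono) (use finF in auto)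
    finally show ?thesis using True faces_at[OF x0U] by simp
  next
    case False
    have "(\<Sum>f\<in>F - SF. w f) = 0" by (rule sum.neutral) (use False in \<open>auto simp: w_def SF_def\<close>)
    then show ?thesis by simp
  qed
  ultimately have 2: "(\<Sum>f\<in>F. w f) \<le> (\<Sum>f\<in>SF. val f) + (if dg x0 \<le> 3 then 8 * dg x0 else 0)" by linarith
  have "\<forall>C\<in>CS. \<exists>p. good C p" using good_exists by blast
  then obtain P where P: "\<And>C. C \<in> CS \<Longrightarrow> good C (P C)" using bchoice[of CS good] by blast
  define S where "S = (\<lambda>v. \<Sum>C\<in>{C \<in> CS. v \<in> VC C}. P C v)"
  have 3: "(\<Sum>f\<in>SF. val f) \<le> (\<Sum>v\<in>U. S v) + 2 * card (K4s adj U)" using weight_bound[OF P] by (simp add: S_def)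
  have 4: "(\<Sum>v\<in>U. S v) = S x0 + (\<Sum>v\<in>U - {x0}. S v)" using sum.remove[OF finU x0U] .
  have 5: "(\<Sum>v\<in>U. dg v) = dg x0 + (\<Sum>v\<in>U - {x0}. dg v)" using sum.remove[OF finU x0U] .
  have "(\<Sum>v\<in>U - {x0}. S v + 10) \<le> (\<Sum>v\<in>U - {x0}. 4 * dg v)" unfolding S_def by (rule sum_mono) (rule vertex_pays, use P in auto)
  then have 6: "(\<Sum>v\<in>U - {x0}. S v) + 10 * card (U - {x0}) \<le> 4 * (\<Sum>v\<in>U - {x0}. dg v)"
    by (simp add: sum.distrib sum_distrib_left)
  have 7: "card U = Suc (card (U - {x0}))" using card.remove[OF finU x0U] .
  have 8: "S x0 \<le> (if dg x0 \<le> 3 then 0 else 4 * dg x0)"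
  proof (cases "dg x0 \<le> 3")
    case True
    have "x0 \<notin> VC C" if "C \<in> CS" for C using CS_facts(2)[OF that] True by (auto simp: VC_def SF_def)
    then have none: "{C \<in> CS. x0 \<in> VC C} = {}" by blast
    show ?thesis unfolding S_def none by simp
  next
    case False
    have "S x0 \<le> (\<Sum>C\<in>{C \<in> CS. x0 \<in> VC C}. 4 * card {f \<in> C. x0 \<in> Vf f})"
      unfolding S_def by (rule sum_mono) (use P in \<open>auto simp: good_def\<close>)
    also have "\<dots> = 4 * (\<Sum>C\<in>{C \<in> CS. x0 \<in> VC C}. card {f \<in> C. x0 \<in> Vf f})" by (simp add: sum_distrib_left)
    also have "(\<Sum>C\<in>{C \<in> CS. x0 \<in> VC C}. card {f \<in> C. x0 \<in> Vf f}) = card (\<Union>C\<in>{C \<in> CS. x0 \<in> VC C}. {f \<in> C. x0 \<in> Vf f})"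
    proof (rule card_UN_disjoint[symmetric])
      show "finite {C \<in> CS. x0 \<in> VC C}" using CS_facts(1) by simp
      show "\<forall>C\<in>{C \<in> CS. x0 \<in> VC C}. finite {f \<in> C. x0 \<in> Vf f}" using CS_facts(3) by simp
      show "\<forall>C\<in>{C \<in> CS. x0 \<in> VC C}. \<forall>D\<in>{C \<in> CS. x0 \<in> VC C}. C \<noteq> D \<longrightarrow> {f \<in> C. x0 \<in> Vf f} \<inter> {f \<in> D. x0 \<in> Vf f} = {}"
        using CS_facts(5) by blast
    qed
    also have "\<dots> \<le> card {f \<in> F. x0 \<in> Vf f}"
    proof (rule card_mono)
      show "finite {f \<in> F. x0 \<in> Vf f}" using finF by simp
      have "C \<subseteq> F" if "C \<in> CS" for C using CS_facts(2)[OF that] SF_F by blast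
      then show "(\<Union>C\<in>{C \<in> CS. x0 \<in> VC C}. {f \<in> C. x0 \<in> Vf f}) \<subseteq> {f \<in> F. x0 \<in> Vf f}" by blast
    qed
    finally show ?thesis using False faces_at[OF x0U] by simp
  qed
  show False
  proof (cases "dg x0 \<le> 3")
    case True
    then show False using 1 2 3 4 5 6 7 8 euler dense degree_sum by simp
  next
    case False
    then show False using 1 2 3 4 5 6 7 8 euler dense degree_sum by simp
  qed
qed

end

section \<open>The induction\<close>

lemma colour_union:
  assumes split: "U = A \<union> B" "A \<inter> B \<subseteq> {z}" "z \<in> B" and apart: "\<And>x y. x \<in> A - B \<Longrightarrow> y \<in> B - A \<Longrightarrow> \<not> adj x y"
    and sym: "\<And>x y. adj x y \<Longrightarrow> adj y x" and ne: "L z \<noteq> {}"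
    and A: "col adj L A \<phi>" and B: "\<And>q. q \<in> L z \<Longrightarrow> \<exists>\<psi>. col adj L B \<psi> \<and> \<psi> z = q"
  shows "\<exists>\<psi>. col adj L U \<psi> \<and> (\<forall>v\<in>A. \<psi> v = \<phi> v)"
proof -
  obtain q where q: "q \<in> L z" "z \<in> A \<Longrightarrow> q = \<phi> z" using ne A by (cases "z \<in> A") (auto simp: col_def)
  obtain \<psi> where s: "col adj L B \<psi>" "\<psi> z = q" using B[OF q(1)] by blast
  let ?h = "\<lambda>v. if v \<in> A then \<phi> v else \<psi> v"
  have cross: "\<phi> x \<noteq> \<psi> y" if "x \<in> A" "y \<in> B - A" "adj x y" for x y
  proof -
    have "x \<in> B" using apart[of x y] that by blast
    then have "x = z" "\<phi> x = \<psi> x" using that(1) split(2) q(2) s(2) by auto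
    then show ?thesis using s(1) that(2,3) \<open>x \<in> B\<close> by (auto simp: col_def)
  qed
  have "col adj L U ?h" unfolding col_def
  proof (intro conjI ballI impI)
    fix v assume "v \<in> U" then show "?h v \<in> L v" using A s(1) split(1) by (auto simp: col_def)
  next
    fix x y assume h: "x \<in> U" "y \<in> U" "adj x y"
    show "?h x \<noteq> ?h y"
    proof (cases "x \<in> A"; cases "y \<in> A")
      assume "x \<in> A" "y \<in> A" then show ?thesis using A h by (auto simp: col_def)
    next
      assume "x \<in> A" "y \<notin> A" then show ?thesis using cross[of x y] h split(1) by auto
    next
      assume "x \<notin> A" "y \<in> A" then show ?thesis using cross[of y x] sym[OF h(3)] h split(1) by force
    next
      assume "x \<notin> A" "y \<notin> A" then show ?thesis using s(1) h split(1) by (auto simp: col_def)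
    qed
  qed
  then show ?thesis by (intro exI[of _ ?h]) simp
qed

text \<open>A vertex of the one that is missing in the other completes a 5-cycle.\<close>

lemma K4s_share_no_edge:
  assumes sym: "\<And>x y. R x y \<Longrightarrow> R y x"
    and no5: "\<And>a b c d e. distinct [a, b, c, d, e] \<Longrightarrow> R a b \<Longrightarrow> R b c \<Longrightarrow> R c d \<Longrightarrow> R d e \<Longrightarrow> R e a \<Longrightarrow> False"
    and T: "T \<in> K4s R U" "T' \<in> K4s R U" "x \<in> T" "y \<in> T" "x \<in> T'" "y \<in> T'" "x \<noteq> y"
  shows "T = T'"
proof (rule ccontr)
  assume n: "T \<noteq> T'"
  have K: "card T = 4" "card T' = 4" "\<And>u v. u \<in> T \<Longrightarrow> v \<in> T \<Longrightarrow> u \<noteq> v \<Longrightarrow> R u v" "\<And>u v. u \<in> T' \<Longrightarrow> v \<in> T' \<Longrightarrow> u \<noteq> v \<Longrightarrow> R u v"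
    using T by (auto simp: K4s_def)
  have fin: "finite T" "finite T'" using K card_ge_0_finite by force+
  have "card (T - {x, y}) = 2" using K(1) fin T by (simp add: card_Diff_subset)
  then obtain a b where ab: "T - {x, y} = {a, b}" "a \<noteq> b" by (auto simp: card_2_iff)
  have "\<not> T' \<subseteq> T" using card_subset_eq[OF fin(1), of T'] K n by auto
  then obtain c where c: "c \<in> T'" "c \<notin> T" by blast
  have m: "a \<in> T" "b \<in> T" "a \<noteq> x" "a \<noteq> y" "b \<noteq> x" "b \<noteq> y" using ab by auto
  have "c \<noteq> x" "c \<noteq> y" "c \<noteq> a" "c \<noteq> b" using c m T by auto
  then show False using no5[of x c y a b] K(3,4) T m c ab(2) by auto
qed

text \<open>A minimal counterexample has no separation of order at most one by \<open>colour_union\<close>, so it is 2-connected, and the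
faces of its drawing lead to \<open>discharging_contradiction\<close>.\<close>

lemma colour_with_root:
  assumes P: "plane_graph V adj pos \<gamma>" and L: "listed V adj L"
    and no5: "\<And>a b c d e. distinct [a, b, c, d, e] \<Longrightarrow> adj a b \<Longrightarrow> adj b c \<Longrightarrow> adj c d \<Longrightarrow> adj d e \<Longrightarrow> adj e a \<Longrightarrow> False"
    and no6: "\<And>a1 a2 a3 a4 a5 a6. distinct [a1, a2, a3, a4, a5, a6] \<Longrightarrow> adj a1 a2 \<Longrightarrow> adj a2 a3 \<Longrightarrow> adj a3 a4 \<Longrightarrow> adj a4 a5 \<Longrightarrow> adj a5 a6 \<Longrightarrow> adj a6 a1 \<Longrightarrow> False"
  shows "U \<subseteq> V \<Longrightarrow> x0 \<in> U \<Longrightarrow> p0 \<in> L x0 \<Longrightarrow> \<exists>\<phi>. col adj L U \<phi> \<and> \<phi> x0 = p0"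
proof (induction "card U" arbitrary: U x0 p0 rule: less_induct)
  case less
  interpret L: listed V adj L by (rule L)
  interpret P: plane_graph V adj pos \<gamma> by (rule P)
  have finU: "finite U" using less.prems(1) L.finV finite_subset by blast
  have IH: "\<exists>\<phi>. col adj L S \<phi> \<and> \<phi> x = p" if "S \<subset> U" "x \<in> S" "p \<in> L x" for S x p
  proof (rule less.hyps)
    show "card S < card U" using that(1) finU by (rule psubset_card_mono[rotated])
    show "S \<subseteq> V" using that(1) less.prems(1) by blast
  qed (use that in auto)
  show ?case
  proof (rule ccontr)
    assume stuck: "\<not> ?case"
    interpret C: critical V adj L U x0 p0
    proof (unfold_locales)
      show "\<exists>\<phi>. col adj L S \<phi> \<and> \<phi> x0 = p0" if "S \<subset> U" "x0 \<in> S" for S using IH[OF that] less.prems(3) .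
    qed (use less.prems stuck no5 in blast)+
    have ne: "L v \<noteq> {}" if "v \<in> U" for v using L.list3[of v] that less.prems(1) by auto
    have split: False if h: "U = A \<union> B" "A \<inter> B \<subseteq> {z}" "z \<in> B" "A \<noteq> U" "B \<noteq> U" "x0 \<in> A"
        "\<And>x y. x \<in> A - B \<Longrightarrow> y \<in> B - A \<Longrightarrow> \<not> adj x y" for A B z
    proof -
      have pr: "A \<subset> U" "B \<subset> U" using h by blast+
      obtain \<phi> where f: "col adj L A \<phi>" "\<phi> x0 = p0" using IH[OF pr(1) h(6) less.prems(3)] by blast
      have "L z \<noteq> {}" using ne h by blast
      then obtain \<psi> where "col adj L U \<psi>" "\<forall>v\<in>A. \<psi> v = \<phi> v"
        using colour_union[OF h(1,2,3,7) L.asym _ f(1) IH[OF pr(2) h(3)]] by blast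
      then show False using stuck f(2) h(6) by auto
    qed
    have cU: "conn adj U" unfolding conn_def
    proof (intro allI impI, elim conjE)
      fix B assume B: "B \<subseteq> U" "B \<noteq> {}" "B \<noteq> U"
      show "\<exists>x\<in>B. \<exists>y\<in>U - B. adj x y"
      proof (rule ccontr)
        assume n: "\<not> ?thesis"
        have n': "\<not> adj x y" "\<not> adj y x" if "x \<in> B" "y \<in> U - B" for x y using n that L.asym by blast+
        obtain a b where ab: "a \<in> B" "b \<in> U - B" using B by blast
        show False
        proof (cases "x0 \<in> B")
          case True
          show False by (rule split[of B "U - B" b]) (use B ab True n' in auto)
        next
          case False
          show False by (rule split[of "U - B" B a]) (use B ab False n' less.prems in auto)
        qed
      qed
    qed
    have cz: "conn adj (U - {z})" if z: "z \<in> U" for z unfolding conn_def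
    proof (intro allI impI, elim conjE)
      fix B assume B: "B \<subseteq> U - {z}" "B \<noteq> {}" "B \<noteq> U - {z}"
      show "\<exists>x\<in>B. \<exists>y\<in>U - {z} - B. adj x y"
      proof (rule ccontr)
        assume n: "\<not> ?thesis"
        have n': "\<not> adj x y" "\<not> adj y x" if "x \<in> B" "y \<in> U - {z} - B" for x y using n that L.asym by blast+
        obtain a b where ab: "a \<in> B" "b \<in> U - {z} - B" using B by blast
        show False
        proof (cases "x0 \<in> B")
          case True
          show False by (rule split[of "insert z B" "U - B" z]) (use B ab True n' z in auto)
        next
          case False
          show False by (rule split[of "U - B" "insert z B" z]) (use B ab False n' z less.prems in auto)
        qed
      qed
    qed
    have "\<exists>v\<in>U. v \<noteq> x0"
    proof (rule ccontr)
      assume "\<not> ?thesis"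
      then have "U = {x0}" using less.prems(2) by blast
      then have "col adj L U (\<lambda>_. p0)" using less.prems(3) L.airr by (auto simp: col_def)
      then show False using stuck by blast
    qed
    then obtain v where v: "v \<in> U" "v \<noteq> x0" by blast
    have "card (nb adj U v) \<le> card U" by (rule card_mono[OF finU]) (auto simp: nb_def)
    then have c3: "card U \<ge> 3" using C.degree_ge_3[OF v] by linarith
    have "twoconn adj U" unfolding twoconn_def using finU c3 cU cz by blast
    then obtain F bd where fs: "P.face_sys (edges adj U) F bd" using P.face_sys_exists by blast
    note D = P.face_sysD[OF fs]
    interpret faced V adj L U x0 p0 F bd
    proof unfold_locales
      show "finite F" by (rule D(3))
      show "cyc adj (bd f)" "cedges (bd f) \<subseteq> edges adj U" if "f \<in> F" for f using D(9,10)[OF that] .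
      show "card {f \<in> F. e \<in> cedges (bd f)} = 2" if "e \<in> edges adj U" for e by (rule D(12)[OF that])
      show "\<exists>f\<in>F. \<exists>e\<in>X. \<exists>e'\<in>edges adj U - X. x \<in> e' \<and> e \<in> cedges (bd f) \<and> e' \<in> cedges (bd f)"
        if "X \<subseteq> {e \<in> edges adj U. x \<in> e}" "X \<noteq> {}" "X \<noteq> {e \<in> edges adj U. x \<in> e}" for X x by (rule D(14)[OF that])
    qed (rule no6)
    show False
    proof (rule discharging_contradiction)
      fix f assume "f \<in> F"
      then have c: "cyc adj (bd f)" using cycF by blast
      show "length (bd f) \<noteq> 5 \<and> length (bd f) \<noteq> 6"
      proof (intro conjI notI)
        assume "length (bd f) = 5"
        then obtain a b c d e where b: "bd f = [a, b, c, d, e]" by (auto simp: length_Suc_conv eval_nat_numeral)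
        show False by (rule no5[of a b c d e]) (use c b in \<open>auto simp: cyc_def\<close>)
      next
        assume "length (bd f) = 6"
        then obtain a1 a2 a3 a4 a5 a6 where b: "bd f = [a1, a2, a3, a4, a5, a6]" by (auto simp: length_Suc_conv eval_nat_numeral)
        show False by (rule no6[of a1 a2 a3 a4 a5 a6]) (use c b in \<open>auto simp: cyc_def\<close>)
      qed
    next
      have "\<Union> (edges adj U) = U" by (rule Union_edges[OF cU]) (use c3 L.asym in auto)
      then show "card F + card U = card (edges adj U) + 2" using D(13) by simp
    next
      show "2 * card U + card (K4s adj U) \<le> card (edges adj U) + 2"
      proof (rule L.critical_dense[OF less.prems(1,2) _ C.smaller stuck])
        fix T T' e assume h: "T \<in> K4s adj U" "T' \<in> K4s adj U" "e \<in> edges adj U" "e \<subseteq> T" "e \<subseteq> T'"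
        obtain x y where xy: "e = {x, y}" "adj x y" using h(3) by (auto simp: edges_def)
        then have m: "x \<in> T" "y \<in> T" "x \<in> T'" "y \<in> T'" "x \<noteq> y" using h(4,5) L.airr by auto
        show "T = T'" by (rule K4s_share_no_edge[where R = adj, OF _ _ h(1,2) m]) (assumption | rule L.asym | rule no5)+
      qed
    qed
  qed
qed

lemma (in pair_wf_digraph) vertex_cycle_5:
  assumes "distinct [a, b, c, d, e]" "(a, b) \<in> parcs G" "(b, c) \<in> parcs G" "(c, d) \<in> parcs G" "(d, e) \<in> parcs G" "(e, a) \<in> parcs G"
  shows "has_cycle_of_length G 5"
  unfolding has_cycle_of_length_def
  by (rule exI[of _ "[(a, b), (b, c), (c, d), (d, e), (e, a)]"])
    (use assms in_arcsD1 in \<open>auto simp: cycle_def awalk_def intro!: exI[of _ a]\<close>)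

lemma (in pair_wf_digraph) vertex_cycle_6:
  assumes "distinct [a, b, c, d, e, f]" "(a, b) \<in> parcs G" "(b, c) \<in> parcs G" "(c, d) \<in> parcs G" "(d, e) \<in> parcs G" "(e, f) \<in> parcs G" "(f, a) \<in> parcs G"
  shows "has_cycle_of_length G 6"
  unfolding has_cycle_of_length_def
  by (rule exI[of _ "[(a, b), (b, c), (c, d), (d, e), (e, f), (f, a)]"])
    (use assms in_arcsD1 in \<open>auto simp: cycle_def awalk_def intro!: exI[of _ a]\<close>)

theorem theorem3:
  fixes G :: "'a pair_pre_digraph"
  assumes "pair_graph G"
    and "planar G"
    and "\<not> has_cycle_of_length G 5"
    and "\<not> has_cycle_of_length G 6"
  shows "choosable TYPE('c) 3 1 G"
  unfolding choosable_def
proof (intro allI impI, elim conjE)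
  fix L :: "'a \<Rightarrow> 'c set"
  assume big: "\<forall>v\<in>pverts G. infinite (L v) \<or> 3 \<le> card (L v)"
    and small: "\<forall>(x, y)\<in>parcs G. finite (L x \<inter> L y) \<and> card (L x \<inter> L y) \<le> 1"
  interpret G: pair_graph G by (rule assms(1))
  define adj where "adj = (\<lambda>x y. (x, y) \<in> parcs G)"
  obtain pos \<gamma> where dr: "plane_drawing G pos \<gamma>" using assms(2) by (auto simp: planar_def)
  have sym: "adj y x" if "adj x y" for x y
    using G.pair_sym_arcs that unfolding adj_def symmetric_def by (auto elim: symE)
  have irr: "\<not> adj x x" for x using G.pair_no_loops[of "(x, x)"] by (auto simp: adj_def)
  have aV: "x \<in> pverts G" if "adj x y" for x y using that G.in_arcsD1 by (simp add: adj_def)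
  have P: "plane_graph (pverts G) adj pos \<gamma>"
  proof
    have d: "arc (\<gamma> (x, y)) \<and> pathstart (\<gamma> (x, y)) = pos x \<and> pathfinish (\<gamma> (x, y)) = pos y \<and> \<gamma> (y, x) = reversepath (\<gamma> (x, y)) \<and>
        (\<forall>w\<in>pverts G - {x, y}. pos w \<notin> path_image (\<gamma> (x, y)))" if "adj x y" for x y
      using dr that unfolding plane_drawing_def adj_def by fast
    show "inj_on pos (pverts G)" using dr by (simp add: plane_drawing_def)
    show "arc (\<gamma> (x, y))" "pathstart (\<gamma> (x, y)) = pos x" "pathfinish (\<gamma> (x, y)) = pos y" "\<gamma> (y, x) = reversepath (\<gamma> (x, y))"
      if "adj x y" for x y using d[OF that] by blast+
    show "w = x \<or> w = y" if "adj x y" "w \<in> pverts G" "pos w \<in> path_image (\<gamma> (x, y))" for x y w using d[OF that(1)] that(2,3) by blast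
    show "path_image (\<gamma> (x, y)) \<inter> path_image (\<gamma> (u, v)) \<subseteq> pos ` ({x, y} \<inter> {u, v})"
      if "adj x y" "adj u v" "{x, y} \<noteq> {u, v}" for x y u v
    proof -
      have "\<forall>(u, v)\<in>parcs G. \<forall>(x, y)\<in>parcs G. {u, v} \<noteq> {x, y} \<longrightarrow>
          path_image (\<gamma> (u, v)) \<inter> path_image (\<gamma> (x, y)) \<subseteq> pos ` ({u, v} \<inter> {x, y})"
        using dr unfolding plane_drawing_def by (elim conjE)
      from bspec[OF this that(1)[unfolded adj_def], unfolded prod.case, THEN bspec, OF that(2)[unfolded adj_def]]
      show ?thesis using that(3) by (simp only: prod.case) blast
    qed
  qed (use sym irr aV in blast)+
  have "\<forall>v\<in>pverts G. \<exists>S\<subseteq>L v. card S = 3"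
  proof
    fix v assume "v \<in> pverts G"
    then consider "infinite (L v)" | "3 \<le> card (L v)" using big by blast
    then show "\<exists>S\<subseteq>L v. card S = 3"
    proof cases
      case 1 then show ?thesis using infinite_arbitrarily_large[of "L v" 3] by blast
    next
      case 2 then show ?thesis using obtain_subset_with_card_n[of 3 "L v"] by metis
    qed
  qed
  then obtain L' where L': "\<And>v. v \<in> pverts G \<Longrightarrow> L' v \<subseteq> L v \<and> card (L' v) = 3" by metis
  have listed: "listed (pverts G) adj L'"
  proof
    show "card (L' x \<inter> L' y) \<le> 1" if "adj x y" for x y
    proof -
      have "finite (L x \<inter> L y)" "card (L x \<inter> L y) \<le> 1" using small that by (auto simp: adj_def)
      moreover have "L' x \<inter> L' y \<subseteq> L x \<inter> L y" using L'[OF aV[OF that]] L'[OF aV[OF sym[OF that]]] by blast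
      ultimately show ?thesis using card_mono[of "L x \<inter> L y" "L' x \<inter> L' y"] by linarith
    qed
  qed (use G.pair_finite_verts sym irr aV L' in blast)+
  have no5: False if "distinct [a, b, c, d, e]" "adj a b" "adj b c" "adj c d" "adj d e" "adj e a" for a b c d e
    using G.vertex_cycle_5[OF that[unfolded adj_def]] assms(3) by blast
  have no6: False if "distinct [a, b, c, d, e, f]" "adj a b" "adj b c" "adj c d" "adj d e" "adj e f" "adj f a" for a b c d e f
    using G.vertex_cycle_6[OF that[unfolded adj_def]] assms(4) by blast
  show "\<exists>\<phi>. list_coloring G L \<phi>"
  proof (cases "pverts G = {}")
    case True
    then have "parcs G = {}" using G.in_arcsD1 by auto
    then show ?thesis using True by (simp add: list_coloring_def)
  next
    case False
    then obtain x0 where x0: "x0 \<in> pverts G" by blast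
    then have "L' x0 \<noteq> {}" using L'[OF x0] by auto
    then obtain p0 where p0: "p0 \<in> L' x0" by blast
    have "\<exists>\<phi>. col adj L' (pverts G) \<phi> \<and> \<phi> x0 = p0"
    proof (rule colour_with_root[OF P listed _ _ subset_refl x0 p0])
      show False if "distinct [a, b, c, d, e]" "adj a b" "adj b c" "adj c d" "adj d e" "adj e a" for a b c d e
        by (rule no5[OF that])
      show False if "distinct [a, b, c, d, e, f]" "adj a b" "adj b c" "adj c d" "adj d e" "adj e f" "adj f a" for a b c d e f
        by (rule no6[OF that])
    qed
    then obtain \<phi> where f: "col adj L' (pverts G) \<phi>" by blast
    have "list_coloring G L \<phi>" unfolding list_coloring_def
    proof (intro conjI ballI)
      fix v assume "v \<in> pverts G" then show "\<phi> v \<in> L v" using f L' by (auto simp: col_def)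
    next
      fix e assume e: "e \<in> parcs G"
      obtain x y where xy: "e = (x, y)" by (cases e)
      have a: "adj x y" using e xy by (simp add: adj_def)
      have "\<phi> x \<noteq> \<phi> y" using f a aV[OF a] aV[OF sym[OF a]] by (auto simp: col_def)
      then show "case e of (x, y) \<Rightarrow> \<phi> x \<noteq> \<phi> y" using xy by simp
    qed
    then show ?thesis by blast
  qed
qed

end
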